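(* Let $B_1\subset\mathbb{R}^n$ be the open unit ball centered at the origin, let $f\in W^{1,2}(B_1,\mathcal{A}_Q(\mathbb{R}^m))$ be a Dir-stationary map, and suppose that $$\lim_{r\to0}\frac{1}{r^N}\int_{B_r}|f|^2\,dx=0\qquad\text{for every }N\in\mathbb{N},$$ where $B_r$ is the ball of radius $r$ centered at the origin. Then $f\equiv Q[\![0]\!]$ in $B_1$.
   Context: $\mathcal{A}_Q(\mathbb{R}^m)$ is the space of unordered $Q$-tuples of points of $\mathbb{R}^m$, written $T=\sum_{i=1}^Q[\![P_i]\!]$ (sums of $Q$ Dirac masses), with metric $\mathcal{G}(\sum_i[\![P_i]\!],\sum_i[\![S_i]\!])=\min_{\sigma}\big(\sum_i|P_i-S_{\sigma(i)}|^2\big)^{1/2}$, the minimum over permutations $\sigma$ of $\{1,\dots,Q\}$. $Q[\![0]\!]$ is the point $0$ with multiplicity $Q$. For $\Omega\subset\mathbb{R}^n$ open, a measurable $f:\Omega\to\mathcal{A}_Q(\mathbb{R}^m)$ belongs to $W^{1,2}(\Omega,\mathcal{A}_Q(\mathbb{R}^m))$ if $|f|\in L^2(\Omega)$ and there are $\varphi_1,\dots,\varphi_n\in L^2(\Omega)$ such that for every $T\in\mathcal{A}_Q(\mathbb{R}^m)$ the function $x\mapsto\mathcal{G}(f(x),T)$ is in $W^{1,2}_{\rm loc}(\Omega)$ and $|\partial_j\mathcal{G}(f,T)|\le\varphi_j$ a.e. for each $j$. One writes $f=\sum_i[\![f_i]\!]$ with a measurable selection $f_i$; such $f$ is approximately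 differentiable a.e., with differential $\sum_i[\![Df_i]\!]$, where the $m\times n$ matrices $Df_i(x)$ are paired with the values $f_i(x)$ and $Df_i(x)=Df_j(x)$ whenever $f_i(x)=f_j(x)$. Set $|f|^2=\sum_i|f_i|^2$, $|Df|^2=\sum_i|Df_i|^2$, and $\langle A:B\rangle=\mathrm{tr}(A^TB)$. $f\in W^{1,2}(\Omega,\mathcal{A}_Q(\mathbb{R}^m))$ is Dir-stationary if both of the following hold: (outer variations) $\int_\Omega\sum_i\big[\langle Df_i(x):D_x\psi(x,f_i(x))\rangle+\langle Df_i(x):D_u\psi(x,f_i(x))\cdot Df_i(x)\rangle\big]dx=0$ for every $\psi(x,u)\in C^\infty(\Omega\times\mathbb{R}^m;\mathbb{R}^m)$ with compact support in $x$ and satisfying, for some constant $C$, $|D_u\psi|\le C<\infty$ and $|\psi|+|D_x\psi|\le C(1+|u|)$; (inner variations) $2\int_\Omega\sum_{i=1}^Q\langle Df_i:Df_i\cdot D\phi\rangle\,dx-\int_\Omega|Df|^2\,\mathrm{div}\,\phi\,dx=0$ for every $\phi\in C_c^\infty(\Omega,\mathbb{R}^n)$. *)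

theory Defs
  imports "HOL-Analysis.Analysis" "HOL-Combinatorics.Permutations"
begin

section \<open>The metric space of unordered \<open>Q\<close>-tuples\<close>

text \<open>A sum of \<open>Q\<close> Dirac masses is represented by a multiset of size \<open>Q\<close>.\<close>

definition Qpoint :: "nat \<Rightarrow> (nat \<Rightarrow> 'a) \<Rightarrow> 'a multiset"
  where "Qpoint Q P = (\<Sum>i<Q. {#P i#})"

definition AQ :: "nat \<Rightarrow> 'a multiset set"
  where "AQ Q = {T. size T = Q}"

definition enum_of :: "nat \<Rightarrow> 'a multiset \<Rightarrow> nat \<Rightarrow> 'a"
  where "enum_of Q T = (SOME P. T = Qpoint Q P)"

text \<open>The metric is computed with arbitrarily chosen enumerations of the two points; lemma
  \<open>Gdist_Qpoint\<close> below shows that the choice is irrelevant.\<close>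

definition Gdist :: "nat \<Rightarrow> 'a::real_normed_vector multiset \<Rightarrow> 'a multiset \<Rightarrow> real"
  where "Gdist Q T S =
    Min ((\<lambda>\<sigma>. sqrt (\<Sum>i<Q. (norm (enum_of Q T i - enum_of Q S (\<sigma> i)))\<^sup>2)) ` {\<sigma>. \<sigma> permutes {..<Q}})"

definition Qnorm :: "'a::real_normed_vector multiset \<Rightarrow> real"
  where "Qnorm T = sqrt (\<Sum>p\<in>#T. (norm p)\<^sup>2)"

lemma Qpoint_image_mset: "Qpoint Q P = image_mset P (mset_set {..<Q})"
  unfolding Qpoint_def by (induction Q) (auto simp: lessThan_Suc)

lemma Qpoint_in_AQ: "Qpoint Q P \<in> AQ Q"
  by (simp add: AQ_def Qpoint_image_mset)

lemma AQ_eq_range: "AQ Q = range (Qpoint Q)"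
proof (intro equalityI subsetI)
  fix T :: "'a multiset" assume "T \<in> AQ Q"
  then have sz: "size T = Q" by (simp add: AQ_def)
  obtain xs where xs: "mset xs = T" using ex_mset by blast
  have len: "length xs = Q" using xs sz by auto
  have "T = Qpoint Q (\<lambda>i. xs ! i)"
    unfolding Qpoint_image_mset xs[symmetric] len[symmetric]
    unfolding mset_set_upto_eq_mset_upto mset_map[symmetric] map_nth by (rule refl)
  then show "T \<in> range (Qpoint Q)" by blast
qed (auto simp: Qpoint_in_AQ)

lemma Qpoint_enum_of: "T \<in> AQ Q \<Longrightarrow> Qpoint Q (enum_of Q T) = T"
proof -
  assume "T \<in> AQ Q"
  then have "\<exists>P. T = Qpoint Q P" unfolding AQ_eq_range by blast
  then have "T = Qpoint Q (enum_of Q T)" unfolding enum_of_def by (rule someI_ex)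
  then show ?thesis by (rule sym)
qed

lemma Qpoint_eqD:
  assumes "Qpoint Q P = Qpoint Q R"
  obtains \<sigma> where "\<sigma> permutes {..<Q}" "\<And>i. i < Q \<Longrightarrow> P i = R (\<sigma> i)"
proof -
  have "image_mset P (mset_set {..<Q}) = image_mset R (mset_set {..<Q})"
    using assms by (simp add: Qpoint_image_mset)
  then obtain \<sigma> where "\<sigma> permutes {..<Q}" "\<forall>i\<in>{..<Q}. P i = R (\<sigma> i)"
    by (rule image_mset_eq_implies_permutes[OF finite_lessThan])
  then show thesis by (intro that) auto
qed

definition tuple_cost :: "nat \<Rightarrow> (nat \<Rightarrow> 'a::real_normed_vector) \<Rightarrow> (nat \<Rightarrow> 'a) \<Rightarrow> (nat \<Rightarrow> nat) \<Rightarrow> real"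
  where "tuple_cost Q P R \<sigma> = sqrt (\<Sum>i<Q. (norm (P i - R (\<sigma> i)))\<^sup>2)"

lemma tuple_cost_reindex:
  assumes "\<tau> permutes {..<Q}"
  shows "tuple_cost Q P R \<sigma> = tuple_cost Q (P \<circ> \<tau>) R (\<sigma> \<circ> \<tau>)"
  unfolding tuple_cost_def using sum.permute[OF assms, of "\<lambda>i. (norm (P i - R (\<sigma> i)))\<^sup>2"]
  by (simp add: o_def)

lemma finite_tuple_costs: "finite (tuple_cost Q P R ` {\<sigma>. \<sigma> permutes {..<Q}})"
  by (intro finite_imageI finite_permutations) simp

lemma tuple_costs_nonempty: "tuple_cost Q P R ` {\<sigma>. \<sigma> permutes {..<Q}} \<noteq> {}"
  using permutes_id by blast

lemma tuple_costs_subset: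
  assumes "Qpoint Q P = Qpoint Q P'" "Qpoint Q R = Qpoint Q R'"
  shows "tuple_cost Q P R ` {\<sigma>. \<sigma> permutes {..<Q}} \<subseteq> tuple_cost Q P' R' ` {\<sigma>. \<sigma> permutes {..<Q}}"
proof clarify
  fix \<sigma> :: "nat \<Rightarrow> nat" assume \<sigma>: "\<sigma> permutes {..<Q}"
  obtain \<alpha> where \<alpha>: "\<alpha> permutes {..<Q}" "\<And>i. i < Q \<Longrightarrow> P' i = P (\<alpha> i)"
    using Qpoint_eqD[OF assms(1)[symmetric]] by blast
  obtain \<beta> where \<beta>: "\<beta> permutes {..<Q}" "\<And>i. i < Q \<Longrightarrow> R i = R' (\<beta> i)"
    using Qpoint_eqD[OF assms(2)] by blast
  have lt: "\<sigma> (\<alpha> i) < Q" if "i < Q" for i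
    using that permutes_in_image[OF \<sigma>, of "\<alpha> i"] permutes_in_image[OF \<alpha>(1), of i] by simp
  have "tuple_cost Q P R \<sigma> = tuple_cost Q P' R' (\<beta> \<circ> (\<sigma> \<circ> \<alpha>))"
    unfolding tuple_cost_reindex[OF \<alpha>(1), of P R \<sigma>]
    by (simp add: tuple_cost_def \<alpha>(2) \<beta>(2) lt)
  moreover have "\<beta> \<circ> (\<sigma> \<circ> \<alpha>) permutes {..<Q}"
    using \<sigma> \<alpha>(1) \<beta>(1) by (simp add: permutes_compose)
  ultimately show "tuple_cost Q P R \<sigma> \<in> tuple_cost Q P' R' ` {\<sigma>. \<sigma> permutes {..<Q}}"
    by blast
qed

lemma Gdist_tuple_cost:
  "Gdist Q T S = Min (tuple_cost Q (enum_of Q T) (enum_of Q S) ` {\<sigma>. \<sigma> permutes {..<Q}})"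
  by (simp add: Gdist_def tuple_cost_def)

lemma Gdist_Qpoint:
  "Gdist Q (Qpoint Q P) (Qpoint Q R) =
    Min ((\<lambda>\<sigma>. sqrt (\<Sum>i<Q. (norm (P i - R (\<sigma> i)))\<^sup>2)) ` {\<sigma>. \<sigma> permutes {..<Q}})"
proof -
  have "tuple_cost Q (enum_of Q (Qpoint Q P)) (enum_of Q (Qpoint Q R)) ` {\<sigma>. \<sigma> permutes {..<Q}} =
      tuple_cost Q P R ` {\<sigma>. \<sigma> permutes {..<Q}}"
    by (intro equalityI tuple_costs_subset) (simp_all add: Qpoint_enum_of Qpoint_in_AQ)
  then show ?thesis
    by (simp add: Gdist_tuple_cost tuple_cost_def)
qed

lemma Gdist_attained:
  obtains \<sigma> where "\<sigma> permutes {..<Q}" "Gdist Q T S = tuple_cost Q (enum_of Q T) (enum_of Q S) \<sigma>"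
  using Min_in[OF finite_tuple_costs tuple_costs_nonempty, of Q "enum_of Q T" "enum_of Q S"]
  unfolding Gdist_tuple_cost by blast

lemma Gdist_nonneg: "0 \<le> Gdist Q T S"
proof -
  obtain \<sigma> where "Gdist Q T S = tuple_cost Q (enum_of Q T) (enum_of Q S) \<sigma>"
    by (rule Gdist_attained)
  then show ?thesis by (simp add: tuple_cost_def sum_nonneg)
qed

lemma Gdist_le:
  "\<sigma> permutes {..<Q} \<Longrightarrow> Gdist Q T S \<le> tuple_cost Q (enum_of Q T) (enum_of Q S) \<sigma>"
  unfolding Gdist_tuple_cost by (intro Min_le finite_tuple_costs) blast

lemma Gdist_sym_le: "Gdist Q T S \<le> Gdist Q S T"
proof -
  obtain \<sigma> where \<sigma>: "\<sigma> permutes {..<Q}"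
    and eq: "Gdist Q S T = tuple_cost Q (enum_of Q S) (enum_of Q T) \<sigma>"
    by (rule Gdist_attained)
  have "tuple_cost Q (enum_of Q S) (enum_of Q T) \<sigma> =
      tuple_cost Q (enum_of Q S \<circ> inv \<sigma>) (enum_of Q T) (\<sigma> \<circ> inv \<sigma>)"
    by (rule tuple_cost_reindex) (rule permutes_inv[OF \<sigma>])
  also have "\<dots> = tuple_cost Q (enum_of Q T) (enum_of Q S) (inv \<sigma>)"
    by (simp add: tuple_cost_def permutes_inv_o[OF \<sigma>] norm_minus_commute)
  finally show ?thesis
    using Gdist_le[OF permutes_inv[OF \<sigma>], of T S] eq by simp
qed

lemma Gdist_triangle: "Gdist Q T V \<le> Gdist Q T S + Gdist Q S V"
proof -
  let ?T = "enum_of Q T" and ?S = "enum_of Q S" and ?V = "enum_of Q V"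
  obtain \<sigma> where \<sigma>: "\<sigma> permutes {..<Q}" and eq1: "Gdist Q T S = tuple_cost Q ?T ?S \<sigma>"
    by (rule Gdist_attained)
  obtain \<tau> where \<tau>: "\<tau> permutes {..<Q}" and eq2: "Gdist Q S V = tuple_cost Q ?S ?V \<tau>"
    by (rule Gdist_attained)
  have "Gdist Q T V \<le> tuple_cost Q ?T ?V (\<tau> \<circ> \<sigma>)"
    by (rule Gdist_le) (rule permutes_compose[OF \<sigma> \<tau>])
  also have "\<dots> = L2_set (\<lambda>i. norm (?T i - ?V (\<tau> (\<sigma> i)))) {..<Q}"
    by (simp add: tuple_cost_def L2_set_def)
  also have "\<dots> \<le> L2_set (\<lambda>i. norm (?T i - ?S (\<sigma> i)) + norm (?S (\<sigma> i) - ?V (\<tau> (\<sigma> i)))) {..<Q}"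
  proof (rule L2_set_mono)
    fix i
    show "norm (?T i - ?V (\<tau> (\<sigma> i))) \<le> norm (?T i - ?S (\<sigma> i)) + norm (?S (\<sigma> i) - ?V (\<tau> (\<sigma> i)))"
      using norm_triangle_ineq[of "?T i - ?S (\<sigma> i)" "?S (\<sigma> i) - ?V (\<tau> (\<sigma> i))"] by simp
  qed simp
  also have "\<dots> \<le> L2_set (\<lambda>i. norm (?T i - ?S (\<sigma> i))) {..<Q}
      + L2_set (\<lambda>i. norm (?S (\<sigma> i) - ?V (\<tau> (\<sigma> i)))) {..<Q}"
    by (rule L2_set_triangle_ineq)
  also have "\<dots> = Gdist Q T S + tuple_cost Q (?S \<circ> \<sigma>) ?V (\<tau> \<circ> \<sigma>)"
    by (simp add: eq1 tuple_cost_def L2_set_def)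
  also have "\<dots> = Gdist Q T S + Gdist Q S V"
    by (simp add: eq2 tuple_cost_reindex[OF \<sigma>, symmetric])
  finally show ?thesis .
qed

lemma Gdist_eq_0_iff:
  assumes "T \<in> AQ Q" "S \<in> AQ Q"
  shows "Gdist Q T S = 0 \<longleftrightarrow> T = S"
proof
  assume 0: "Gdist Q T S = 0"
  obtain \<sigma> where \<sigma>: "\<sigma> permutes {..<Q}"
    and eq0: "Gdist Q T S = tuple_cost Q (enum_of Q T) (enum_of Q S) \<sigma>"
    by (rule Gdist_attained)
  have eq: "\<forall>i<Q. enum_of Q T i = enum_of Q S (\<sigma> i)"
    using 0 eq0 by (simp add: tuple_cost_def sum_nonneg_eq_0_iff)
  have "T = Qpoint Q (enum_of Q T)"
    by (simp add: Qpoint_enum_of assms)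
  also have "\<dots> = (\<Sum>i<Q. {#enum_of Q S (\<sigma> i)#})"
    using eq by (simp add: Qpoint_def)
  also have "\<dots> = Qpoint Q (enum_of Q S)"
    unfolding Qpoint_def using sum.permute[OF \<sigma>, of "\<lambda>i. {#enum_of Q S i#}"] by (simp add: o_def)
  also have "\<dots> = S"
    by (simp add: Qpoint_enum_of assms)
  finally show "T = S" .
next
  assume "T = S"
  have "Gdist Q T T \<le> 0"
    using Gdist_le[OF permutes_id, of Q T T] by (simp add: tuple_cost_def)
  moreover have "0 \<le> Gdist Q T T"
    by (rule Gdist_nonneg)
  ultimately show "Gdist Q T S = 0"
    using \<open>T = S\<close> by simp
qed

lemma Metric_space_AQ: "Metric_space (AQ Q) (Gdist Q)"
proof
  show "0 \<le> Gdist Q x y" for x y :: "'a multiset"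
    by (rule Gdist_nonneg)
  show "Gdist Q x y = Gdist Q y x" for x y :: "'a multiset"
    by (intro antisym Gdist_sym_le)
qed (auto simp: Gdist_eq_0_iff intro: Gdist_triangle)

definition AQ_borel :: "nat \<Rightarrow> 'a::real_normed_vector multiset measure"
  where "AQ_borel Q = sigma (AQ Q) {U. openin (Metric_space.mtopology (AQ Q) (Gdist Q)) U}"

section \<open>Smooth functions and weak derivatives\<close>

primrec C_on :: "nat \<Rightarrow> 'a::real_normed_vector set \<Rightarrow> ('a \<Rightarrow> 'b::real_normed_vector) \<Rightarrow> bool"
  where
    "C_on 0 S f \<longleftrightarrow> continuous_on S f"
  | "C_on (Suc k) S f \<longleftrightarrow> (\<forall>x\<in>S. f differentiable (at x)) \<and>
       (\<forall>v. C_on k S (\<lambda>x. frechet_derivative f (at x) v))"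

definition smooth_on :: "'a::real_normed_vector set \<Rightarrow> ('a \<Rightarrow> 'b::real_normed_vector) \<Rightarrow> bool"
  where "smooth_on S f \<longleftrightarrow> (\<forall>k. C_on k S f)"

definition test_function :: "'a::real_normed_vector set \<Rightarrow> ('a \<Rightarrow> 'b::real_normed_vector) \<Rightarrow> bool"
  where "test_function \<Omega> \<phi> \<longleftrightarrow> smooth_on \<Omega> \<phi> \<and>
    compact (closure (support_on \<Omega> \<phi>)) \<and> closure (support_on \<Omega> \<phi>) \<subseteq> \<Omega>"

definition L1_loc :: "'a::euclidean_space set \<Rightarrow> ('a \<Rightarrow> real) \<Rightarrow> bool"
  where "L1_loc \<Omega> g \<longleftrightarrow> g \<in> borel_measurable (lebesgue_on \<Omega>) \<and>
    (\<forall>K. compact K \<and> K \<subseteq> \<Omega> \<longrightarrow> integrable (lebesgue_on K) g)"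

definition L2 :: "'a::euclidean_space set \<Rightarrow> ('a \<Rightarrow> real) \<Rightarrow> bool"
  where "L2 \<Omega> g \<longleftrightarrow> g \<in> borel_measurable (lebesgue_on \<Omega>) \<and>
    integrable (lebesgue_on \<Omega>) (\<lambda>x. (g x)\<^sup>2)"

definition L2_loc :: "'a::euclidean_space set \<Rightarrow> ('a \<Rightarrow> real) \<Rightarrow> bool"
  where "L2_loc \<Omega> g \<longleftrightarrow> g \<in> borel_measurable (lebesgue_on \<Omega>) \<and>
    (\<forall>K. compact K \<and> K \<subseteq> \<Omega> \<longrightarrow> integrable (lebesgue_on K) (\<lambda>x. (g x)\<^sup>2))"

definition weak_partial ::
    "(real^'n) set \<Rightarrow> 'n \<Rightarrow> (real^'n \<Rightarrow> real) \<Rightarrow> (real^'n \<Rightarrow> real) \<Rightarrow> bool"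
  where "weak_partial \<Omega> j g h \<longleftrightarrow> L1_loc \<Omega> g \<and> L1_loc \<Omega> h \<and>
    (\<forall>\<eta> :: real^'n \<Rightarrow> real. test_function \<Omega> \<eta> \<longrightarrow>
      (LINT x|lebesgue_on \<Omega>. g x * frechet_derivative \<eta> (at x) (axis j 1)) =
      - (LINT x|lebesgue_on \<Omega>. h x * \<eta> x))"

definition W12_loc :: "(real^'n) set \<Rightarrow> (real^'n \<Rightarrow> real) \<Rightarrow> bool"
  where "W12_loc \<Omega> g \<longleftrightarrow> L2_loc \<Omega> g \<and> (\<forall>j. \<exists>h. L2_loc \<Omega> h \<and> weak_partial \<Omega> j g h)"

section \<open>Sobolev \<open>Q\<close>-valued maps and their differentials\<close>

definition W12 :: "nat \<Rightarrow> (real^'n) set \<Rightarrow> (real^'n \<Rightarrow> (real^'m) multiset) set"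
  where "W12 Q \<Omega> = {f. f \<in> measurable (lebesgue_on \<Omega>) (AQ_borel Q) \<and>
    L2 \<Omega> (\<lambda>x. Qnorm (f x)) \<and>
    (\<exists>\<phi>. (\<forall>j. L2 \<Omega> (\<phi> j)) \<and>
      (\<forall>T\<in>AQ Q. W12_loc \<Omega> (\<lambda>x. Gdist Q (f x) T) \<and>
        (\<forall>j h. weak_partial \<Omega> j (\<lambda>x. Gdist Q (f x) T) h \<longrightarrow>
          (AE x in lebesgue_on \<Omega>. \<bar>h x\<bar> \<le> \<phi> j x))))}"

definition measurable_selection ::
    "nat \<Rightarrow> (real^'n) set \<Rightarrow> (real^'n \<Rightarrow> (real^'m) multiset) \<Rightarrow> (nat \<Rightarrow> real^'n \<Rightarrow> real^'m) \<Rightarrow> bool"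
  where "measurable_selection Q \<Omega> f g \<longleftrightarrow>
    (\<forall>i<Q. g i \<in> borel_measurable (lebesgue_on \<Omega>)) \<and> (\<forall>x\<in>\<Omega>. f x = Qpoint Q (\<lambda>i. g i x))"

definition density_one :: "'a::euclidean_space set \<Rightarrow> 'a \<Rightarrow> bool"
  where "density_one E x \<longleftrightarrow> E \<in> sets lebesgue \<and>
    ((\<lambda>r. measure lebesgue (E \<inter> ball x r) / measure lebesgue (ball x r)) \<longlongrightarrow> 1) (at_right 0)"

text \<open>\<open>P\<close> enumerates the values of \<open>f\<close> at \<open>x\<close>, and \<open>L i\<close> is the matrix paired with the value \<open>P i\<close>:
  the restriction of \<open>f\<close> to a set of density one at \<open>x\<close> agrees to first order with the
  multivalued affine map with sheets \<open>P i + L i (y - x)\<close>.\<close>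

definition has_approx_differential ::
    "nat \<Rightarrow> (real^'n) set \<Rightarrow> (real^'n \<Rightarrow> (real^'m) multiset) \<Rightarrow> real^'n \<Rightarrow>
      (nat \<Rightarrow> real^'m) \<Rightarrow> (nat \<Rightarrow> real^'n^'m) \<Rightarrow> bool"
  where "has_approx_differential Q \<Omega> f x P L \<longleftrightarrow>
    f x = Qpoint Q P \<and>
    (\<forall>i<Q. \<forall>j<Q. P i = P j \<longrightarrow> L i = L j) \<and>
    (\<exists>E\<subseteq>\<Omega>. x \<in> E \<and> density_one E x \<and>
      ((\<lambda>y. Gdist Q (f y) (Qpoint Q (\<lambda>i. P i + L i *v (y - x))) / norm (y - x)) \<longlongrightarrow> 0)
        (at x within E))"

definition ae_differential ::
    "nat \<Rightarrow> (real^'n) set \<Rightarrow> (real^'n \<Rightarrow> (real^'m) multiset) \<Rightarrow>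
      (nat \<Rightarrow> real^'n \<Rightarrow> real^'m) \<Rightarrow> (nat \<Rightarrow> real^'n \<Rightarrow> real^'n^'m) \<Rightarrow> bool"
  where "ae_differential Q \<Omega> f g D \<longleftrightarrow>
    (\<forall>i<Q. D i \<in> borel_measurable (lebesgue_on \<Omega>)) \<and>
    (AE x in lebesgue_on \<Omega>. has_approx_differential Q \<Omega> f x (\<lambda>i. g i x) (\<lambda>i. D i x))"

section \<open>Stationarity\<close>

definition frob :: "real^'n^'m \<Rightarrow> real^'n^'m \<Rightarrow> real"
  where "frob A B = trace (transpose A ** B)"

text \<open>The library norm of a matrix is its Frobenius norm.\<close>

lemma frob_eq_inner: "frob A B = A \<bullet> B"
proof -
  have "frob A B = (\<Sum>j\<in>UNIV. \<Sum>i\<in>UNIV. A $ i $ j * B $ i $ j)"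
    by (simp add: frob_def trace_def transpose_def matrix_matrix_mult_def)
  also have "\<dots> = (\<Sum>i\<in>UNIV. \<Sum>j\<in>UNIV. A $ i $ j * B $ i $ j)"
    by (rule sum.swap)
  finally show ?thesis
    by (simp add: inner_vec_def)
qed

lemma frob_self: "frob A A = (norm A)\<^sup>2"
  by (simp add: frob_eq_inner power2_norm_eq_inner)

definition Dx :: "((real^'n) \<times> (real^'m) \<Rightarrow> real^'m) \<Rightarrow> real^'n \<Rightarrow> real^'m \<Rightarrow> real^'n^'m"
  where "Dx \<psi> x u = jacobian (\<lambda>y. \<psi> (y, u)) (at x)"

definition Du :: "((real^'n) \<times> (real^'m) \<Rightarrow> real^'m) \<Rightarrow> real^'n \<Rightarrow> real^'m \<Rightarrow> real^'m^'m"
  where "Du \<psi> x u = jacobian (\<lambda>w. \<psi> (x, w)) (at u)"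

definition divergence :: "(real^'n \<Rightarrow> real^'n) \<Rightarrow> real^'n \<Rightarrow> real"
  where "divergence \<phi> x = trace (jacobian \<phi> (at x))"

definition outer_field :: "(real^'n) set \<Rightarrow> ((real^'n) \<times> (real^'m) \<Rightarrow> real^'m) \<Rightarrow> bool"
  where "outer_field \<Omega> \<psi> \<longleftrightarrow> smooth_on (\<Omega> \<times> UNIV) \<psi> \<and>
    (\<exists>K. compact K \<and> K \<subseteq> \<Omega> \<and> (\<forall>x\<in>\<Omega> - K. \<forall>u. \<psi> (x, u) = 0)) \<and>
    (\<exists>C. \<forall>x\<in>\<Omega>. \<forall>u. norm (Du \<psi> x u) \<le> C \<and> norm (\<psi> (x, u)) + norm (Dx \<psi> x u) \<le> C * (1 + norm u))"

definition outer_stationary ::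
    "nat \<Rightarrow> (real^'n) set \<Rightarrow> (nat \<Rightarrow> real^'n \<Rightarrow> real^'m) \<Rightarrow> (nat \<Rightarrow> real^'n \<Rightarrow> real^'n^'m) \<Rightarrow> bool"
  where "outer_stationary Q \<Omega> g D \<longleftrightarrow> (\<forall>\<psi>. outer_field \<Omega> \<psi> \<longrightarrow>
    (LINT x|lebesgue_on \<Omega>. (\<Sum>i<Q. frob (D i x) (Dx \<psi> x (g i x)) +
       frob (D i x) (Du \<psi> x (g i x) ** D i x))) = 0)"

definition inner_stationary ::
    "nat \<Rightarrow> (real^'n) set \<Rightarrow> (nat \<Rightarrow> real^'n \<Rightarrow> real^'n^'m) \<Rightarrow> bool"
  where "inner_stationary Q \<Omega> D \<longleftrightarrow> (\<forall>\<phi> :: real^'n \<Rightarrow> real^'n. test_function \<Omega> \<phi> \<longrightarrow>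
    2 * (LINT x|lebesgue_on \<Omega>. (\<Sum>i<Q. frob (D i x) (D i x ** jacobian \<phi> (at x))))
    - (LINT x|lebesgue_on \<Omega>. (\<Sum>i<Q. (norm (D i x))\<^sup>2) * divergence \<phi> x) = 0)"

text \<open>Maps in \<open>W12\<close> admit \<open>g\<close> and \<open>D\<close> as below, the pairs \<open>(g i x, D i x)\<close> are determined almost
  everywhere up to a permutation of the indices, and the integrals do not see such permutations;
  so it does not matter which selection is used.\<close>

definition Dir_stationary :: "nat \<Rightarrow> (real^'n) set \<Rightarrow> (real^'n \<Rightarrow> (real^'m) multiset) \<Rightarrow> bool"
  where "Dir_stationary Q \<Omega> f \<longleftrightarrow> f \<in> W12 Q \<Omega> \<and>
    (\<exists>g D. measurable_selection Q \<Omega> f g \<and> ae_differential Q \<Omega> f g D \<and>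
      outer_stationary Q \<Omega> g D \<and> inner_stationary Q \<Omega> D)"

end

theory Submission
  imports Defs
begin

text \<open>The theorem is Almgren's frequency argument. Put \<open>n = CARD('n)\<close>, let \<open>\<zeta> s = exp (- 1 / s)\<close> for \<open>s > 0\<close> and
\<open>\<zeta> s = 0\<close> otherwise, and evaluate \<open>\<zeta>\<close> and \<open>\<zeta>'\<close> at \<open>1 - |x|\<^sup>2 / r\<^sup>2\<close> in the integrals

  \<open>D r = \<integral> \<zeta> |Df|\<^sup>2\<close>, \<open>H r = \<integral> \<zeta>' |f|\<^sup>2\<close>, \<open>E r = \<integral> \<zeta>' |Df x|\<^sup>2\<close>.

The outer variation \<open>\<zeta> u\<close> gives \<open>r\<^sup>2 D = 2 \<integral> \<zeta>' f \<bullet> Df x\<close>, the inner variation \<open>\<zeta> x\<close> gives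
\<open>r D' = (n - 2) D + 4 E / r\<^sup>2\<close>, and the chain rule \<open>\<partial>\<^sub>v |f|\<^sup>2 = 2 f \<bullet> Df v\<close> gives \<open>r H' = n H + r\<^sup>2 D\<close>. By the
Cauchy-Schwarz inequality \<open>(r\<^sup>2 D)\<^sup>2 \<le> 4 H E\<close>, so the frequency \<open>N = r\<^sup>2 D / H\<close> is nondecreasing wherever
\<open>H > 0\<close>. If \<open>H r\<^sub>0 > 0\<close> for some \<open>r\<^sub>0 < 1\<close>, then \<open>r H' = (n + N) H \<le> (n + N r\<^sub>0) H\<close> below \<open>r\<^sub>0\<close>, so \<open>H\<close> decays at
most like a power of \<open>r\<close>. In particular \<open>H\<close> has no zero in \<open>(0, r\<^sub>0]\<close>, the estimate holds down to the
origin, and \<open>f\<close> does not vanish there to infinite order. Hence \<open>H r = 0\<close> for all \<open>r < 1\<close>. The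
argument is carried by the lemmas \<open>energy_derivative\<close>, \<open>height_derivative\<close>, \<open>Cauchy_Schwarz_frequency\<close> and
\<open>height_lower_bound\<close>.

The definition of a stationary map relates two objects that are given independently: weak derivatives
of the scalar functions \<open>x \<mapsto> G (f x, T)\<close>, and a differential \<open>Df\<close> that exists pointwise in the approximate
sense. That \<open>Df\<close> is locally square integrable and that the chain rule holds must be proved, and both
follow from a study of difference quotients. Integrating the weak derivatives along segments
(\<open>shift_formula\<close>) and taking the supremum over a countable dense set of points \<open>T\<close> bounds
\<open>G (f (x + w), f x)\<close> by the integral of an \<open>L\<^sup>2\<close> function over the segment from \<open>x\<close> to \<open>x + w\<close>
(\<open>W12_difference_bound\<close>). Approximate differentiability says that, for almost every \<open>x\<close>, the rescaled
error \<open>G (f (x + t v), f x + t Df x v) / t\<close> tends to 0 in measure with respect to \<open>v\<close>; along a sequence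
\<open>t k \<longlonglongrightarrow> 0\<close> it tends to 0 for almost every pair \<open>(x, v)\<close> (\<open>blowup_sequence\<close>). Fatou's lemma now gives
\<open>\<integral>\<integral> |Df x v|\<^sup>2 < \<infinity>\<close>. Finally, difference quotients that are bounded in \<open>L\<^sup>2\<close> and converge almost everywhere
converge in \<open>L\<^sup>1\<close>; this identifies the weak derivative of a bounded Lipschitz function of \<open>|f|\<close>, and
\<open>chain_rule\<close> follows by letting that function tend to \<open>|f|\<^sup>2\<close>.\<close>

section \<open>Smooth cutoffs\<close>

lemma C_on_subset: "C_on k S f \<Longrightarrow> T \<subseteq> S \<Longrightarrow> C_on k T f"
proof (induction k arbitrary: f)
  case 0
  then show ?case by (auto intro: continuous_on_subset)
next
  case (Suc k)
  then show ?case by (auto simp: subset_iff)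
qed

lemma C_on_SucI:
  assumes "\<And>x. (f has_derivative f' x) (at x)" and "\<And>v. C_on k UNIV (\<lambda>x. f' x v)"
  shows "C_on (Suc k) UNIV f"
proof -
  have "frechet_derivative f (at x) = f' x" for x
    using frechet_derivative_at[OF assms(1)] by simp
  then show ?thesis
    using assms by (auto simp: differentiable_def)
qed

lemma C_on_SucD:
  assumes "C_on (Suc k) UNIV f"
  shows "(f has_derivative frechet_derivative f (at x)) (at x)"
    and "C_on k UNIV (\<lambda>x. frechet_derivative f (at x) v)"
  using assms by (auto simp: frechet_derivative_works)

lemma C_on_Suc_imp: "C_on (Suc k) S f \<Longrightarrow> C_on k S f"
proof (induction k arbitrary: f)
  case 0
  then have "\<forall>x\<in>S. isCont f x"
    by (auto intro: differentiable_imp_continuous_within)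
  then show ?case by (simp add: continuous_at_imp_continuous_on)
next
  case (Suc k)
  then show ?case by (metis C_on.simps(2))
qed

lemma C_on_const: "C_on k UNIV (\<lambda>x. c)"
proof (induction k arbitrary: c)
  case (Suc k)
  show ?case by (rule C_on_SucI[where f' = "\<lambda>x v. 0"]) (auto intro: Suc)
qed simp

lemma C_on_bounded_linear: "bounded_linear f \<Longrightarrow> C_on k UNIV f"
proof (induction k)
  case 0
  then show ?case by (simp add: linear_continuous_on)
next
  case (Suc k)
  show ?case
    by (rule C_on_SucI[where f' = "\<lambda>x. f"])
      (auto intro: C_on_const bounded_linear_imp_has_derivative Suc)
qed

lemma C_on_add:
  "C_on k UNIV f \<Longrightarrow> C_on k UNIV g \<Longrightarrow> C_on k UNIV (\<lambda>x. f x + g x)"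
proof (induction k arbitrary: f g)
  case 0
  then show ?case by (simp add: continuous_on_add)
next
  case (Suc k)
  note f = C_on_SucD[OF Suc.prems(1)] and g = C_on_SucD[OF Suc.prems(2)]
  show ?case
    by (rule C_on_SucI) (rule has_derivative_add[OF f(1) g(1)], rule Suc.IH[OF f(2) g(2)])
qed

lemma C_on_scaleR:
  fixes f :: "'a::real_normed_vector \<Rightarrow> real" and g :: "'a \<Rightarrow> 'b::real_normed_vector"
  shows "C_on k UNIV f \<Longrightarrow> C_on k UNIV g \<Longrightarrow> C_on k UNIV (\<lambda>x. f x *\<^sub>R g x)"
proof (induction k arbitrary: f g)
  case 0
  then show ?case by (simp add: continuous_on_scaleR)
next
  case (Suc k)
  note f = C_on_SucD[OF Suc.prems(1)] and g = C_on_SucD[OF Suc.prems(2)]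
  show ?case
    by (rule C_on_SucI) (rule has_derivative_scaleR[OF f(1) g(1)],
      intro C_on_add Suc.IH f(2) g(2) Suc.prems[THEN C_on_Suc_imp])
qed

text \<open>The derivative of \<open>h\<close> at \<open>s\<close> is multiplication by its value \<open>h' s\<close> on \<open>1\<close>, and \<open>h'\<close> is one step less
smooth than \<open>h\<close>; this is what lets the induction on \<open>k\<close> proceed for all \<open>h\<close> and \<open>f\<close> simultaneously.\<close>

lemma C_on_compose_real:
  fixes f :: "'a::real_normed_vector \<Rightarrow> real" and h :: "real \<Rightarrow> real"
  shows "C_on k UNIV h \<Longrightarrow> C_on k UNIV f \<Longrightarrow> C_on k UNIV (\<lambda>x. h (f x))"
proof (induction k arbitrary: h f)
  case 0
  then show ?case by (auto intro: continuous_on_compose2)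
next
  case (Suc k)
  note h = C_on_SucD[OF Suc.prems(1)] and f = C_on_SucD[OF Suc.prems(2)]
  define h' where "h' s = frechet_derivative h (at s) 1" for s
  have "frechet_derivative h (at s) v = v *\<^sub>R h' s" for s v
    using linear_scale[OF has_derivative_linear[OF h(1)[of s]], of v 1]
    by (simp only: real_scaleR_def mult_1_right h'_def)
  then have d: "((\<lambda>x. h (f x)) has_derivative (\<lambda>v. frechet_derivative f (at x) v *\<^sub>R h' (f x))) (at x)" for x
    using has_derivative_compose[OF f(1)[of x] h(1)[of "f x"]] by simp
  have "C_on k UNIV h'"
    unfolding h'_def[abs_def] by (rule h(2))
  then have c: "C_on k UNIV (\<lambda>x. h' (f x))"
    by (rule Suc.IH) (rule Suc.prems(2)[THEN C_on_Suc_imp])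
  show ?case
    by (rule C_on_SucI[OF d C_on_scaleR[OF f(2) c]])
qed

lemma C_on_compose_linear:
  assumes L: "bounded_linear L"
  shows "C_on k UNIV f \<Longrightarrow> C_on k UNIV (\<lambda>x. f (L x))"
proof (induction k arbitrary: f)
  case 0
  then show ?case
    using linear_continuous_on[OF L] by (auto intro: continuous_on_compose2)
next
  case (Suc k)
  note f = C_on_SucD[OF Suc.prems]
  have "((\<lambda>x. f (L x)) has_derivative (\<lambda>v. frechet_derivative f (at (L x)) (L v))) (at x)" for x
    by (rule has_derivative_compose[OF bounded_linear_imp_has_derivative[OF L] f(1)])
  then show ?case
    by (rule C_on_SucI) (rule Suc.IH[OF f(2)])
qed

lemma smooth_on_const: "smooth_on UNIV (\<lambda>x. c)"
  unfolding smooth_on_def using C_on_const by blast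

lemma smooth_on_bounded_linear: "bounded_linear L \<Longrightarrow> smooth_on UNIV L"
  unfolding smooth_on_def using C_on_bounded_linear by blast

lemma smooth_on_add: "smooth_on UNIV f \<Longrightarrow> smooth_on UNIV g \<Longrightarrow> smooth_on UNIV (\<lambda>x. f x + g x)"
  unfolding smooth_on_def using C_on_add by blast

lemma smooth_on_scaleR:
  fixes f :: "'a::real_normed_vector \<Rightarrow> real"
  shows "smooth_on UNIV f \<Longrightarrow> smooth_on UNIV g \<Longrightarrow> smooth_on UNIV (\<lambda>x. f x *\<^sub>R g x)"
  unfolding smooth_on_def using C_on_scaleR by blast

lemma smooth_on_compose_real:
  fixes f :: "'a::real_normed_vector \<Rightarrow> real" and h :: "real \<Rightarrow> real"
  assumes "smooth_on UNIV h" "smooth_on UNIV f"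
  shows "smooth_on UNIV (\<lambda>x. h (f x))"
  unfolding smooth_on_def using C_on_compose_real[of _ h f] assms by (simp add: smooth_on_def)

lemma smooth_on_compose_linear:
  "bounded_linear L \<Longrightarrow> smooth_on UNIV f \<Longrightarrow> smooth_on UNIV (\<lambda>x. f (L x))"
  unfolding smooth_on_def using C_on_compose_linear by blast

lemma smooth_on_mult:
  fixes f g :: "'a::real_normed_vector \<Rightarrow> real"
  shows "smooth_on UNIV f \<Longrightarrow> smooth_on UNIV g \<Longrightarrow> smooth_on UNIV (\<lambda>x. f x * g x)"
  using smooth_on_scaleR[of f g] by simp

lemma smooth_on_subset: "smooth_on S f \<Longrightarrow> T \<subseteq> S \<Longrightarrow> smooth_on T f"
  by (auto simp: smooth_on_def intro: C_on_subset)

lemma smooth_on_prod: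
  fixes f :: "'i \<Rightarrow> 'a::real_normed_vector \<Rightarrow> real"
  assumes "\<And>i. i \<in> I \<Longrightarrow> smooth_on UNIV (f i)"
  shows "smooth_on UNIV (\<lambda>x. \<Prod>i\<in>I. f i x)"
  using assms by (induction I rule: infinite_finite_induct) (auto intro: smooth_on_const smooth_on_mult)

lemma smooth_on_has_derivative:
  "smooth_on UNIV f \<Longrightarrow> (f has_derivative frechet_derivative f (at x)) (at x)"
  using C_on_SucD(1)[of 0 f] by (simp add: smooth_on_def del: C_on.simps)

lemma smooth_on_frechet_derivative:
  "smooth_on UNIV f \<Longrightarrow> smooth_on UNIV (\<lambda>x. frechet_derivative f (at x) v)"
  using C_on_SucD(2)[of _ f v] by (simp add: smooth_on_def del: C_on.simps)

lemma smooth_on_continuous: "smooth_on UNIV f \<Longrightarrow> continuous_on UNIV f"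
  unfolding smooth_on_def by (metis C_on.simps(1))

lemma C_on_translate: "C_on k UNIV f \<Longrightarrow> C_on k UNIV (\<lambda>x. f (x + c))"
proof (induction k arbitrary: f)
  case 0
  then show ?case by (auto intro!: continuous_on_compose2[of UNIV f] continuous_intros)
next
  case (Suc k)
  note f = C_on_SucD[OF Suc.prems]
  have "((\<lambda>x. f (x + c)) has_derivative frechet_derivative f (at (x + c))) (at x)" for x
    using has_derivative_compose[of "\<lambda>x. x + c" "\<lambda>v. v" x UNIV f, OF _ f(1)[of "x + c"]]
    by (simp add: has_derivative_add_const)
  then show ?case
    by (rule C_on_SucI) (rule Suc.IH[OF f(2)])
qed

lemma smooth_on_translate: "smooth_on UNIV f \<Longrightarrow> smooth_on UNIV (\<lambda>x. f (x + c))"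
  by (simp add: smooth_on_def C_on_translate)

lemma frechet_derivative_translate:
  assumes "smooth_on UNIV f"
  shows "frechet_derivative (\<lambda>x. f (x + c)) (at x) = frechet_derivative f (at (x + c))"
proof -
  have "((\<lambda>x. f (x + c)) has_derivative frechet_derivative f (at (x + c))) (at x)"
    using has_derivative_compose[of "\<lambda>x. x + c" "\<lambda>v. v" x UNIV f,
        OF _ smooth_on_has_derivative[OF assms, of "x + c"]]
    by (simp add: has_derivative_add_const)
  then show ?thesis using frechet_derivative_at by metis
qed

lemma continuous_compact_support_bounded:
  fixes \<eta> :: "'a::euclidean_space \<Rightarrow> real"
  assumes "continuous_on UNIV \<eta>" and "\<And>x. \<rho> < norm x \<Longrightarrow> \<eta> x = 0"
  shows "\<exists>C\<ge>0. \<forall>x. \<bar>\<eta> x\<bar> \<le> C"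
proof -
  have "bounded (\<eta> ` cball 0 \<rho>)"
    using assms(1) by (intro compact_imp_bounded compact_continuous_image) (auto intro: continuous_on_subset)
  then obtain C where C: "\<And>x. x \<in> cball 0 \<rho> \<Longrightarrow> norm (\<eta> x) \<le> C"
    unfolding bounded_iff by blast
  have "\<bar>\<eta> x\<bar> \<le> max C 0" for x
    using C[of x] assms(2)[of x] by (cases "\<rho> < norm x") auto
  then show ?thesis by (intro exI[of _ "max C 0"]) auto
qed

lemma frechet_derivative_zero_outside:
  assumes "\<And>x. \<rho> < norm x \<Longrightarrow> \<eta> x = 0" and "\<rho> < norm x"
  shows "frechet_derivative \<eta> (at x) v = (0::'b::real_normed_vector)"
proof -
  have "((\<lambda>x. 0) has_derivative (\<lambda>v. 0)) (at x)" by simp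
  then have "(\<eta> has_derivative (\<lambda>v. 0)) (at x)"
    by (rule has_derivative_transform_within_open[of _ _ _ _ "{y. \<rho> < norm y}"])
      (use assms in \<open>auto intro!: open_Collect_less continuous_intros\<close>)
  then show ?thesis using frechet_derivative_at by metis
qed

lemma smooth_on_inner_self: "smooth_on UNIV (\<lambda>x::'a::real_inner. x \<bullet> x)"
  unfolding smooth_on_def
proof
  fix k
  have "C_on (Suc k) UNIV (\<lambda>x::'a. x \<bullet> x)"
  proof (rule C_on_SucI)
    show "((\<lambda>x. x \<bullet> x) has_derivative (\<lambda>v. x \<bullet> v + v \<bullet> x)) (at x)" for x :: 'a
      by (auto intro!: derivative_eq_intros)
    show "C_on k UNIV (\<lambda>x. x \<bullet> v + v \<bullet> x)" for v :: 'a
      by (intro C_on_add C_on_bounded_linear bounded_linear_inner_left bounded_linear_inner_right)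
  qed
  then show "C_on k UNIV (\<lambda>x::'a. x \<bullet> x)"
    by (rule C_on_Suc_imp)
qed

text \<open>These functions span the derivatives of \<open>exp (- 1 / s)\<close>, extended by 0 to \<open>s \<le> 0\<close>.\<close>

definition flat :: "nat \<Rightarrow> real \<Rightarrow> real"
  where "flat k s = (if 0 < s then exp (- (1 / s)) / s ^ k else 0)"

lemma flat_nonneg [simp]: "0 \<le> flat k s"
  by (simp add: flat_def)

lemma flat_pos [simp]: "0 < s \<Longrightarrow> 0 < flat k s"
  by (simp add: flat_def)

lemma flat_nonpos [simp]: "s \<le> 0 \<Longrightarrow> flat k s = 0"
  by (simp add: flat_def)

text \<open>With \<open>y = 1 / s\<close> this is \<open>y ^ k / k! \<le> exp y\<close>: one term of the exponential series.\<close>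

lemma flat_le: "flat k s \<le> fact k"
proof (cases "0 < s")
  case True
  define y where "y = 1 / s"
  have y: "0 < y" using True by (simp add: y_def)
  have "(\<Sum>n\<in>{k}. y ^ n /\<^sub>R fact n) \<le> (\<Sum>n. y ^ n /\<^sub>R fact n)"
    using y by (intro sum_le_suminf summable_exp_generic) auto
  then have "y ^ k / fact k \<le> exp y"
    by (simp add: exp_def field_simps)
  then have "y ^ k * exp (- y) \<le> fact k"
    using y by (simp add: exp_minus field_simps)
  then show ?thesis
    using True by (simp add: flat_def y_def field_simps)
qed simp

lemma flat_abs_le: "\<bar>flat k s\<bar> \<le> fact k"
  using flat_le[of k s] by simp

text \<open>Differentiation stays inside the span of the functions \<^term>\<open>flat k\<close>, which is what makes all
  of them smooth. At \<open>s = 0\<close> the quotient bound comes from \<open>flat k s = s\<^sup>2 * flat (k + 2) s\<close>.\<close>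

lemma flat_has_derivative:
  "(flat k has_real_derivative flat (k + 2) s - real k * flat (k + 1) s) (at s)"
proof (cases s "0::real" rule: linorder_cases)
  case less
  have "((\<lambda>s. 0) has_real_derivative 0) (at s)" by simp
  then have "(flat k has_real_derivative 0) (at s)"
    by (rule has_field_derivative_transform_within_open[of _ _ _ "{..<0}"]) (use less in auto)
  then show ?thesis using less by simp
next
  case equal
  have bound: "\<bar>flat k h\<bar> \<le> fact (k + 2) * h\<^sup>2" for h
  proof (cases "0 < h")
    case True
    then have "flat k h = flat (k + 2) h * h\<^sup>2"
      by (simp add: flat_def power_add power2_eq_square)
    then show ?thesis
      using flat_le[of "k + 2" h] by (simp add: mult_right_mono del: fact_Suc)
  qed simp
  have "((\<lambda>h. flat k h / h) \<longlongrightarrow> 0) (at 0)"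
  proof (rule tendsto_rabs_zero_cancel, rule tendsto_sandwich[where f = "\<lambda>_. 0"])
    show "\<forall>\<^sub>F h in at 0. \<bar>flat k h / h\<bar> \<le> fact (k + 2) * \<bar>h\<bar>"
    proof (rule eventually_at_filter[THEN iffD2], rule always_eventually, intro allI impI)
      fix h :: real assume "h \<noteq> 0"
      have "\<bar>flat k h\<bar> \<le> (fact (k + 2) * \<bar>h\<bar>) * \<bar>h\<bar>"
        using bound[of h] by (metis abs_mult_self_eq mult.assoc power2_eq_square)
      with \<open>h \<noteq> 0\<close> show "\<bar>flat k h / h\<bar> \<le> fact (k + 2) * \<bar>h\<bar>"
        unfolding abs_divide by (intro pos_divide_le_eq[THEN iffD2]) auto
    qed
    show "((\<lambda>h. fact (k + 2) * \<bar>h\<bar>) \<longlongrightarrow> (0::real)) (at 0)"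
      by (auto intro!: tendsto_eq_intros)
  qed (auto intro: tendsto_const)
  then show ?thesis
    unfolding equal has_field_derivative_iff by simp
next
  case greater
  have eq: "flat j t = exp (- inverse t) * inverse t ^ j" if "0 < t" for j t
    using that by (simp add: flat_def divide_inverse power_inverse)
  have "((\<lambda>s. exp (- inverse s)) has_real_derivative exp (- inverse s) * (inverse s * inverse s)) (at s)"
    using greater by (auto intro!: derivative_eq_intros)
  moreover have "((\<lambda>s. inverse s ^ k) has_real_derivative - (real k * inverse s ^ (k + 1))) (at s)"
    using DERIV_power[OF DERIV_inverse[of s], of k] greater
    by (cases k) (simp_all add: power2_eq_square ac_simps)
  ultimately have "((\<lambda>s. exp (- inverse s) * inverse s ^ k) has_real_derivative
      flat (k + 2) s - real k * flat (k + 1) s) (at s)"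
    by (rule DERIV_mult[THEN DERIV_cong]) (simp add: eq[OF greater])
  then show ?thesis
    by (rule has_field_derivative_transform_within_open[of _ _ _ "{0<..}"])
      (use greater eq in auto)
qed

lemma smooth_on_flat: "smooth_on UNIV (flat k)"
  unfolding smooth_on_def
proof
  show "C_on m UNIV (flat k)" for m
  proof (induction m arbitrary: k)
    case 0
    show ?case
      by (auto intro!: continuous_at_imp_continuous_on DERIV_isCont flat_has_derivative)
  next
    case (Suc m)
    have cmul: "C_on m UNIV f \<Longrightarrow> C_on m UNIV (\<lambda>x. c * f x)" for c and f :: "real \<Rightarrow> real"
      using C_on_scaleR[OF C_on_const[of m c], of f] by simp
    show ?case
    proof (rule C_on_SucI)
      show "(flat k has_derivative (\<lambda>v. v * (flat (k + 2) s + (- real k) * flat (k + 1) s))) (at s)" for s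
        using flat_has_derivative[of k s]
        unfolding has_field_derivative_def by (simp add: mult.commute[of _ "_ - _"])
      show "C_on m UNIV (\<lambda>s. v * (flat (k + 2) s + (- real k) * flat (k + 1) s))" for v
        by (intro cmul C_on_add Suc)
    qed
  qed
qed

text \<open>For \<open>k = 0\<close> this is the radial cutoff \<open>\<zeta> (1 - |x|\<^sup>2 / r\<^sup>2)\<close> used in both variations, and \<open>k = 2\<close> is the same
expression with \<open>\<zeta>'\<close> in place of \<open>\<zeta>\<close>.\<close>

definition bump :: "nat \<Rightarrow> real \<Rightarrow> 'a::real_inner \<Rightarrow> real"
  where "bump k r x = flat k (1 - (x \<bullet> x) / r\<^sup>2)"

lemma bump_nonneg [simp]: "0 \<le> bump k r x"
  and bump_le: "bump k r x \<le> fact k"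
  and bump_abs_le: "\<bar>bump k r x\<bar> \<le> fact k"
  by (simp_all add: bump_def flat_le flat_abs_le)

lemma bump_pos: "norm x < r \<Longrightarrow> 0 < bump k r x"
proof -
  assume r: "norm x < r"
  then have "(norm x)\<^sup>2 < r\<^sup>2" by (intro power_strict_mono) auto
  then show ?thesis
    using r norm_ge_zero[of x]
    by (auto simp: bump_def dot_square_norm divide_less_eq intro!: flat_pos simp del: norm_ge_zero)
qed

lemma bump_outside: "0 < r \<Longrightarrow> r \<le> norm x \<Longrightarrow> bump k r x = 0"
proof -
  assume r: "0 < r" "r \<le> norm x"
  then have "r\<^sup>2 \<le> (norm x)\<^sup>2" by (intro power_mono) auto
  then show ?thesis
    using r by (auto simp: bump_def dot_square_norm le_divide_eq intro!: flat_nonpos)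
qed

lemma smooth_on_bump: "smooth_on UNIV (bump k r)"
proof -
  have "smooth_on UNIV (\<lambda>x::'a. flat k (1 + (- 1 / r\<^sup>2) * (x \<bullet> x)))"
    by (intro smooth_on_compose_real[OF smooth_on_flat] smooth_on_add smooth_on_const
        smooth_on_mult smooth_on_inner_self)
  then show ?thesis by (simp add: bump_def[abs_def])
qed

lemma bump_has_derivative:
  "(bump k r has_derivative
     (\<lambda>v. (bump (k + 2) r x - real k * bump (k + 1) r x) * (- (2 / r\<^sup>2) * (x \<bullet> v)))) (at x)"
proof -
  have "((\<lambda>x. 1 - (x \<bullet> x) / r\<^sup>2) has_derivative (\<lambda>v. - (2 / r\<^sup>2) * (x \<bullet> v))) (at x)"
    by (auto intro!: derivative_eq_intros simp: inner_commute divide_inverse)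
  from has_derivative_compose[OF this flat_has_derivative[unfolded has_field_derivative_def]]
  show ?thesis by (simp add: bump_def[abs_def] mult.commute)
qed

lemma bump_borel [measurable]: "bump k r \<in> borel_measurable borel"
  by (intro borel_measurable_continuous_onI smooth_on_continuous smooth_on_bump)

lemma test_functionI:
  fixes \<eta> :: "'a::euclidean_space \<Rightarrow> 'b::real_normed_vector"
  assumes "smooth_on UNIV \<eta>" and "\<rho> < 1" and "\<And>x. \<rho> < norm x \<Longrightarrow> \<eta> x = 0"
  shows "test_function (ball 0 1) \<eta>"
proof -
  have sub: "closure (support_on (ball 0 1) \<eta>) \<subseteq> cball 0 \<rho>"
    using assms(3) by (intro closure_minimal) (auto simp: in_support_on, force)
  then have "compact (closure (support_on (ball 0 1) \<eta>))"
    by (meson bounded_cball bounded_subset closed_closure compact_eq_bounded_closed)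
  then show ?thesis
    using sub assms(1,2) smooth_on_subset[of UNIV \<eta> "ball 0 1"] unfolding test_function_def by fastforce
qed

section \<open>Integration lemmas\<close>

lemma lborel_translate: "distr lborel borel (\<lambda>x::'a::euclidean_space. x + w) = lborel"
proof -
  have "(+) w = (\<lambda>x. x + w)" by (auto simp: add.commute)
  then show ?thesis using lborel_distr_plus[of w] by simp
qed

lemma nn_integral_lborel_translate:
  fixes f :: "'a::euclidean_space \<Rightarrow> ennreal"
  assumes [measurable]: "f \<in> borel_measurable borel"
  shows "(\<integral>\<^sup>+x. f (x + w) \<partial>lborel) = (\<integral>\<^sup>+x. f x \<partial>lborel)"
  by (subst (2) lborel_translate[symmetric, of w]) (simp add: nn_integral_distr)

lemma integral_lborel_translate:
  fixes f :: "'a::euclidean_space \<Rightarrow> real"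
  assumes [measurable]: "f \<in> borel_measurable borel"
  shows "(LBINT x. f (x + w)) = (LBINT x. f x)"
  by (subst (2) lborel_translate[symmetric, of w]) (simp add: integral_distr)

lemma integrable_lborel_translate:
  fixes f :: "'a::euclidean_space \<Rightarrow> real"
  assumes "integrable lborel f"
  shows "integrable lborel (\<lambda>x. f (x + w))"
proof -
  have [measurable]: "f \<in> borel_measurable borel" using assms by auto
  have "integrable (distr lborel borel (\<lambda>x. x + w)) f" using assms by (simp add: lborel_translate)
  then show ?thesis by (simp add: integrable_distr_eq)
qed

lemma integrable_mult_bounded:
  fixes v e :: "'a \<Rightarrow> real"
  assumes "integrable M v" "e \<in> borel_measurable M" "\<And>x. \<bar>e x\<bar> \<le> c"
  shows "integrable M (\<lambda>x. v x * e x)"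
proof (rule Bochner_Integration.integrable_bound)
  show "integrable M (\<lambda>x. c * v x)" using assms(1) by simp
  have "\<bar>e x\<bar> \<le> \<bar>c\<bar>" for x using assms(3)[of x] by linarith
  then show "AE x in M. norm (v x * e x) \<le> norm (c * v x)"
    by (simp add: abs_mult mult.commute[of "\<bar>v _\<bar>"] mult_right_mono)
qed (use assms in measurable)

lemma ennreal_abs_integral_le: "ennreal \<bar>\<integral>x. f x \<partial>M\<bar> \<le> (\<integral>\<^sup>+x. ennreal \<bar>f x\<bar> \<partial>M)"
  using integral_norm_bound_ennreal[of M f] by (cases "integrable M f") (auto simp: not_integrable_integral_eq)

text \<open>A proper subspace is a null set. Several identities that are linear in a direction \<open>v\<close> are obtained only
for almost every \<open>v\<close>; this lemma extends them to every direction.\<close>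

lemma subspace_ae_ball_UNIV:
  fixes S :: "'a::euclidean_space set"
  assumes "subspace S" and "AE v in lborel. norm v < 1 \<longrightarrow> v \<in> S"
  shows "S = UNIV"
proof (rule ccontr)
  assume "S \<noteq> UNIV"
  then have "dim S < DIM('a)"
    using assms(1) dim_eq_full[of S] dim_subset_UNIV[of S] span_eq_iff[of S] by force
  then have "S \<in> null_sets lebesgue"
    using negligible_lowdim negligible_iff_null_sets by blast
  then have "AE v in lebesgue. v \<notin> S"
    by (rule AE_not_in)
  moreover have "AE v in lebesgue. norm v < 1 \<longrightarrow> v \<in> S"
    using assms(2) by (rule AE_completion)
  ultimately have "AE v in lebesgue. v \<notin> ball (0::'a) 1"
    by eventually_elim auto
  then have "ball (0::'a) 1 \<in> null_sets lebesgue"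
    by (subst (asm) AE_iff_null_sets[symmetric]) auto
  then show False
    using content_ball_pos[of 1 "0::'a"] by (auto simp: measure_def)
qed

text \<open>A Vitali-type convergence theorem. Boundedness in \<open>L\<^sup>2\<close> makes the sequence uniformly integrable: for every
\<open>K \<ge> 1\<close>, \<open>|z| \<le> K min 1 |z| + z\<^sup>2 / K\<close>, where the first term tends to 0 by dominated convergence and the
second has integral at most \<open>C / K\<close>.\<close>

lemma L2_bounded_imp_L1_tendsto:
  fixes Z :: "nat \<Rightarrow> 'a \<Rightarrow> real"
  assumes [measurable]: "\<And>n. Z n \<in> borel_measurable M" "S \<in> sets M"
    and S: "emeasure M S < \<infinity>" "\<And>n x. x \<notin> S \<Longrightarrow> Z n x = 0"
    and lim: "AE x in M. (\<lambda>n. Z n x) \<longlonglongrightarrow> 0"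
    and L2: "\<And>n. (\<integral>\<^sup>+x. ennreal ((Z n x)\<^sup>2) \<partial>M) \<le> ennreal C"
  shows "\<And>n. integrable M (Z n)" and "(\<lambda>n. \<integral>x. \<bar>Z n x\<bar> \<partial>M) \<longlonglongrightarrow> 0"
proof -
  define C' where "C' = max C 0"
  have C': "0 \<le> C'" by (simp add: C'_def)
  have sq: "integrable M (\<lambda>x. (Z n x)\<^sup>2)" for n
    using L2[of n] by (intro integrableI_bounded) (auto simp: less_top[symmetric] top_unique)
  have sqC: "(\<integral>x. (Z n x)\<^sup>2 \<partial>M) \<le> C'" for n
  proof -
    have "ennreal (\<integral>x. (Z n x)\<^sup>2 \<partial>M) \<le> ennreal C'"
      using L2[of n] ennreal_leI[of C C'] nn_integral_eq_integral[OF sq[of n]]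
      by (simp add: C'_def order_trans)
    then show ?thesis using C' by simp
  qed
  have one: "integrable M (indicat_real S)"
    using S(1) by simp
  have mi: "integrable M (\<lambda>x. min 1 \<bar>Z n x\<bar>)" for n
    by (rule Bochner_Integration.integrable_bound[OF one])
      (auto simp: indicator_def S(2))
  have pt: "\<bar>z\<bar> \<le> K * min 1 \<bar>z\<bar> + z\<^sup>2 / K" if K: "1 \<le> K" for z K :: real
  proof (cases "\<bar>z\<bar> \<le> 1")
    case True
    have "\<bar>z\<bar> \<le> K * \<bar>z\<bar>" using K by (simp add: mult_le_cancel_right1)
    moreover have "0 \<le> z\<^sup>2 / K" using K by simp
    ultimately show ?thesis using True by (simp add: min_def)
  next
    case False
    show ?thesis
    proof (cases "\<bar>z\<bar> \<le> K")
      case True then show ?thesis using False K by (simp add: min_def add_increasing2)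
    next
      case F: False
      then have "K * \<bar>z\<bar> \<le> \<bar>z\<bar> * \<bar>z\<bar>" by (intro mult_right_mono) auto
      then have "\<bar>z\<bar> \<le> z\<^sup>2 / K" using K by (simp add: pos_le_divide_eq power2_eq_square mult.commute)
      then show ?thesis using False K by (simp add: min_def)
    qed
  qed
  show int: "integrable M (Z n)" for n
    by (rule Bochner_Integration.integrable_bound[OF Bochner_Integration.integrable_add[OF mi sq, of n n]])
      (use pt[of 1 "Z n _"] in auto)
  have lim1: "(\<lambda>n. \<integral>x. min 1 \<bar>Z n x\<bar> \<partial>M) \<longlonglongrightarrow> (\<integral>x. 0 \<partial>M)"
  proof (rule integral_dominated_convergence[OF _ _ one])
    show "AE x in M. (\<lambda>n. min 1 \<bar>Z n x\<bar>) \<longlonglongrightarrow> 0"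
      using lim
    proof eventually_elim
      case (elim x)
      have "(\<lambda>n. min 1 \<bar>Z n x\<bar>) \<longlonglongrightarrow> min 1 \<bar>0\<bar>"
        by (intro tendsto_min tendsto_rabs tendsto_const elim)
      then show ?case by simp
    qed
  qed (auto simp: indicator_def S(2))
  show "(\<lambda>n. \<integral>x. \<bar>Z n x\<bar> \<partial>M) \<longlonglongrightarrow> 0"
  proof (rule LIMSEQ_I)
    fix e :: real assume e: "0 < e"
    \<comment> \<open>With this \<open>K\<close> the term \<open>C' / K\<close> is at most \<open>e / 4\<close>.\<close>
    define K where "K = max 1 (4 * C' / e)"
    have K: "1 \<le> K" "0 < K" by (auto simp: K_def)
    have "C' / K \<le> e / 4"
    proof -
      have "4 * C' / e \<le> K" by (simp add: K_def)
      then have "C' \<le> e / 4 * K" using e by (simp add: pos_divide_le_eq mult.commute)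
      then show ?thesis using K by (simp add: pos_divide_le_eq)
    qed
    from lim1 e K obtain N where N: "\<And>n. N \<le> n \<Longrightarrow> \<bar>\<integral>x. min 1 \<bar>Z n x\<bar> \<partial>M\<bar> < e / (4 * K)"
      by (auto simp: LIMSEQ_iff dest!: spec[of _ "e / (4 * K)"])
    show "\<exists>N. \<forall>n\<ge>N. norm ((\<integral>x. \<bar>Z n x\<bar> \<partial>M) - 0) < e"
    proof (intro exI allI impI)
      fix n assume n: "N \<le> n"
      have "(\<integral>x. \<bar>Z n x\<bar> \<partial>M) \<le> (\<integral>x. K * min 1 \<bar>Z n x\<bar> + (Z n x)\<^sup>2 / K \<partial>M)"
        using mi sq int K by (intro integral_mono pt) auto
      also have "\<dots> = K * (\<integral>x. min 1 \<bar>Z n x\<bar> \<partial>M) + (\<integral>x. (Z n x)\<^sup>2 \<partial>M) / K"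
        using mi[of n] sq[of n] by simp
      also have "\<dots> \<le> e / 4 + C' / K"
        using N[OF n] K sqC[of n] by (intro add_mono divide_right_mono) (auto simp: field_simps abs_less_iff)
      also have "\<dots> \<le> e / 4 + e / 4" using \<open>C' / K \<le> e / 4\<close> by linarith
      also have "\<dots> < e" using e by simp
      finally show "norm ((\<integral>x. \<bar>Z n x\<bar> \<partial>M) - 0) < e" by simp
    qed
  qed
qed

lemma has_real_derivative_integral:
  fixes F :: "'a \<Rightarrow> real" and g g' :: "real \<Rightarrow> 'a \<Rightarrow> real"
  assumes F: "integrable M F"
    and [measurable]: "\<And>r. g r \<in> borel_measurable M" "\<And>r. g' r \<in> borel_measurable M"
    and bound: "\<And>r x. \<bar>g r x\<bar> \<le> B"
    and U: "open U" "convex U" "r0 \<in> U"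
    and der: "\<And>r x. r \<in> U \<Longrightarrow> ((\<lambda>r. g r x) has_real_derivative g' r x) (at r)"
    and bound': "\<And>r x. r \<in> U \<Longrightarrow> \<bar>g' r x\<bar> \<le> B'"
  shows "((\<lambda>r. \<integral>x. F x * g r x \<partial>M) has_real_derivative (\<integral>x. F x * g' r0 x \<partial>M)) (at r0)"
proof -
  have [measurable]: "F \<in> borel_measurable M" using F by auto
  have int: "integrable M (\<lambda>x. F x * g r x)" for r
  proof (rule Bochner_Integration.integrable_bound[of _ "\<lambda>x. B * F x"])
    show "AE x in M. norm (F x * g r x) \<le> norm (B * F x)"
    proof (rule AE_I2)
      fix x
      have "\<bar>g r x\<bar> \<le> \<bar>B\<bar>" using bound[of r x] by linarith
      then show "norm (F x * g r x) \<le> norm (B * F x)"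
        by (simp add: abs_mult mult.commute[of "\<bar>F x\<bar>"] mult_right_mono)
    qed
  qed (use F in auto)
  show ?thesis
    unfolding has_field_derivative_iff tendsto_at_iff_sequentially
  proof (intro allI impI)
    fix X :: "nat \<Rightarrow> real"
    assume X: "\<forall>i. X i \<in> UNIV - {r0}" "X \<longlonglongrightarrow> r0"
    have "eventually (\<lambda>i. X i \<in> U) sequentially"
      using topological_tendstoD[OF X(2) U(1,3)] .
    then obtain N where N: "\<And>i. N \<le> i \<Longrightarrow> X i \<in> U" by (auto simp: eventually_sequentially)
    define Y where "Y i = X (i + N)" for i
    have Y: "Y i \<in> U" "Y i \<noteq> r0" for i using N X by (auto simp: Y_def)
    have Ylim: "Y \<longlonglongrightarrow> r0" unfolding Y_def using X(2) by (rule LIMSEQ_ignore_initial_segment)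
    have "(\<lambda>i. \<integral>x. F x * ((g (Y i) x - g r0 x) / (Y i - r0)) \<partial>M) \<longlonglongrightarrow> (\<integral>x. F x * g' r0 x \<partial>M)"
    proof (rule integral_dominated_convergence[where w = "\<lambda>x. B' * \<bar>F x\<bar>"])
      show "integrable M (\<lambda>x. B' * \<bar>F x\<bar>)" using F by auto
      show "AE x in M. (\<lambda>i. F x * ((g (Y i) x - g r0 x) / (Y i - r0))) \<longlonglongrightarrow> F x * g' r0 x"
      proof (intro AE_I2 tendsto_mult_left)
        fix x
        show "(\<lambda>i. (g (Y i) x - g r0 x) / (Y i - r0)) \<longlonglongrightarrow> g' r0 x"
          using der[OF U(3), of x] Y(2) Ylim
          unfolding has_field_derivative_iff tendsto_at_iff_sequentially by (auto simp: o_def)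
      qed
      show "AE x in M. norm (F x * ((g (Y i) x - g r0 x) / (Y i - r0))) \<le> B' * \<bar>F x\<bar>" for i
      proof (rule AE_I2)
        fix x
        have "norm (g (Y i) x - g r0 x) \<le> B' * norm (Y i - r0)"
          by (rule field_differentiable_bound[OF U(2), where f' = "\<lambda>r. g' r x"])
            (use der bound' Y U in \<open>auto intro: DERIV_subset\<close>)
        then have "\<bar>(g (Y i) x - g r0 x) / (Y i - r0)\<bar> \<le> B'"
          using Y(2)[of i] by (simp add: abs_divide pos_divide_le_eq)
        then show "norm (F x * ((g (Y i) x - g r0 x) / (Y i - r0))) \<le> B' * \<bar>F x\<bar>"
          by (simp only: real_norm_def abs_mult) (metis abs_ge_zero mult.commute mult_right_mono)
      qed
    qed measurable
    moreover have "(\<integral>x. F x * ((g (Y i) x - g r0 x) / (Y i - r0)) \<partial>M)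
        = ((\<integral>x. F x * g (Y i) x \<partial>M) - (\<integral>x. F x * g r0 x \<partial>M)) / (Y i - r0)" for i
      by (subst Bochner_Integration.integral_diff[OF int int, symmetric],
          subst integral_divide_zero[symmetric]) (simp add: right_diff_distrib)
    ultimately have "(\<lambda>i. ((\<integral>x. F x * g (X (i + N)) x \<partial>M) - (\<integral>x. F x * g r0 x \<partial>M)) / (X (i + N) - r0))
        \<longlonglongrightarrow> (\<integral>x. F x * g' r0 x \<partial>M)"
      using X(1) by (simp add: Y_def)
    from LIMSEQ_offset[OF this]
    show "((\<lambda>y. ((\<integral>x. F x * g y x \<partial>M) - (\<integral>x. F x * g r0 x \<partial>M)) / (y - r0)) \<circ> X) \<longlonglongrightarrow> (\<integral>x. F x * g' r0 x \<partial>M)"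
      by (simp add: o_def)
  qed
qed

text \<open>\<open>flat 0 (k s)\<close> tends to 1 for \<open>s > 0\<close> and vanishes for \<open>s \<le> 0\<close>, so smooth functions approximate the
indicators of boxes pointwise and boundedly.\<close>

lemma box_indicator_tendsto:
  "(\<lambda>k. \<Prod>i\<in>Basis. flat 0 (real k * ((x - a) \<bullet> i)) * flat 0 (real k * ((b - x) \<bullet> i)))
     \<longlonglongrightarrow> indicat_real (box a b) (x::'a::euclidean_space)"
proof -
  have one: "(\<lambda>k. flat 0 (real k * s)) \<longlonglongrightarrow> (if 0 < s then 1 else 0)" for s :: real
  proof (cases "0 < s")
    case True
    have "(\<lambda>k. exp (- ((1 / s) * (1 / real k)))) \<longlonglongrightarrow> exp (- ((1 / s) * 0))"
      by (intro tendsto_exp tendsto_minus tendsto_mult tendsto_const lim_1_over_n)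
    then have "(\<lambda>k. exp (- ((1 / s) * (1 / real k)))) \<longlonglongrightarrow> 1" by simp
    moreover have "\<forall>\<^sub>F k in sequentially. exp (- ((1 / s) * (1 / real k))) = flat 0 (real k * s)"
      using eventually_gt_at_top[of 0] by eventually_elim (use True in \<open>simp add: flat_def mult.commute\<close>)
    ultimately show ?thesis using True by (simp add: filterlim_cong[OF refl refl])
  next
    case False
    then have "flat 0 (real k * s) = 0" for k
      by (intro flat_nonpos) (simp add: mult_nonneg_nonpos)
    then show ?thesis using False by simp
  qed
  have "(\<lambda>k. \<Prod>i\<in>Basis. flat 0 (real k * ((x - a) \<bullet> i)) * flat 0 (real k * ((b - x) \<bullet> i)))
     \<longlonglongrightarrow> (\<Prod>i\<in>Basis. (if 0 < (x - a) \<bullet> i then 1 else 0) * (if 0 < (b - x) \<bullet> i then 1 else 0))"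
    by (intro tendsto_prod tendsto_mult one)
  also have "(\<Prod>i\<in>Basis. (if 0 < (x - a) \<bullet> i then 1 else 0) * (if 0 < (b - x) \<bullet> i then 1 else 0 :: real))
      = indicat_real (box a b) x"
  proof (cases "x \<in> box a b")
    case True
    then show ?thesis by (auto simp: mem_box inner_diff_left intro!: prod.neutral)
  next
    case False
    then obtain i where "i \<in> Basis" "\<not> (0 < (x - a) \<bullet> i \<and> 0 < (b - x) \<bullet> i)"
      by (auto simp: mem_box inner_diff_left)
    then have "(\<Prod>i\<in>Basis. (if 0 < (x - a) \<bullet> i then 1 else 0) * (if 0 < (b - x) \<bullet> i then 1 else 0 :: real)) = 0"
      by (intro prod_zero) auto
    then show ?thesis using False by simp
  qed
  finally show ?thesis .
qed

text \<open>The fundamental lemma of the calculus of variations. Multiplying \<open>F\<close> by a cutoff that is positive exactly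
on the ball makes every smooth function admissible as a second factor, so the integrals over all boxes
vanish, and boxes generate the Borel sets.\<close>

lemma ae_zero_if_tests_vanish:
  fixes F :: "'a::euclidean_space \<Rightarrow> real"
  assumes F: "integrable lborel F" and \<rho>: "0 < \<rho>"
    and test: "\<And>\<eta>. smooth_on UNIV \<eta> \<Longrightarrow> (\<And>x. \<rho> \<le> norm x \<Longrightarrow> \<eta> x = 0) \<Longrightarrow> (LBINT x. F x * \<eta> x) = 0"
  shows "AE x in lborel. norm x < \<rho> \<longrightarrow> F x = 0"
proof -
  define G where "G x = F x * bump 0 \<rho> x" for x
  have [measurable]: "F \<in> borel_measurable borel" using F by auto
  have bd: "\<bar>flat 0 s\<bar> \<le> 1" "\<bar>bump 0 \<rho> x\<bar> \<le> 1" for s and x :: 'a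
    using flat_abs_le[of 0 s] bump_abs_le[of 0 \<rho> x] by auto
  have G: "integrable lborel G"
    unfolding G_def
    by (rule Bochner_Integration.integrable_bound[OF F])
      (auto simp only: real_norm_def abs_mult intro!: AE_I2 mult_left_le bd, measurable)
  have [measurable]: "G \<in> borel_measurable borel" using G by auto
  have int: "set_integrable lborel A G" if "A \<in> sets borel" for A
    using integrable_mult_indicator[OF _ G, of A] that by (simp add: set_integrable_def)
  have all: "(LBINT x. G x) = 0"
    unfolding G_def by (rule test[OF smooth_on_bump]) (rule bump_outside[OF \<rho>])
  have box: "set_lebesgue_integral lborel (box a b) G = 0" for a b
  proof -
    define cut where "cut k x = (\<Prod>i\<in>Basis. flat 0 (real k * ((x - a) \<bullet> i)) * flat 0 (real k * ((b - x) \<bullet> i)))"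
      for k and x :: 'a
    have sm: "smooth_on UNIV (cut k)" for k
    proof -
      have "smooth_on UNIV (\<lambda>x. \<Prod>i\<in>Basis. flat 0 (real k * (x \<bullet> i) + - (real k * (a \<bullet> i)))
          * flat 0 ((- real k) * (x \<bullet> i) + real k * (b \<bullet> i)))"
        by (intro smooth_on_prod smooth_on_mult smooth_on_compose_real[OF smooth_on_flat]
            smooth_on_add smooth_on_const smooth_on_bounded_linear bounded_linear_inner_left)
      then show ?thesis by (simp add: cut_def[abs_def] inner_diff_left right_diff_distrib algebra_simps)
    qed
    have [measurable]: "cut k \<in> borel_measurable borel" for k
      by (intro borel_measurable_continuous_onI smooth_on_continuous sm)
    have "\<bar>cut k x\<bar> \<le> 1" for k x
      unfolding cut_def abs_prod abs_mult by (intro prod_le_1) (auto intro!: mult_le_one bd flat_le[where k = 0, simplified])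
    then have cut: "\<bar>G x\<bar> * \<bar>cut k x\<bar> \<le> \<bar>G x\<bar>" for k x
      by (rule mult_left_le) simp
    have "(\<lambda>k. LBINT x. G x * cut k x) \<longlonglongrightarrow> (LBINT x. G x * indicat_real (box a b) x)"
    proof (rule integral_dominated_convergence[where w = "\<lambda>x. \<bar>G x\<bar>"])
      show "AE x in lborel. (\<lambda>k. G x * cut k x) \<longlonglongrightarrow> G x * indicat_real (box a b) x"
        unfolding cut_def by (intro AE_I2 tendsto_mult_left box_indicator_tendsto)
    qed (use G cut in \<open>auto simp: abs_mult\<close>)
    moreover have "(LBINT x. G x * cut k x) = 0" for k
      unfolding G_def mult.assoc
      by (rule test) (auto intro!: smooth_on_mult smooth_on_bump sm simp: bump_outside[OF \<rho>])
    ultimately have "(LBINT x. G x * indicat_real (box a b) x) = 0"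
      by (simp add: LIMSEQ_const_iff)
    then show ?thesis by (simp add: set_lebesgue_integral_def mult.commute)
  qed
  let ?E = "range (\<lambda>(a, b). box a b :: 'a set)"
  have "set_lebesgue_integral lborel A G = 0" if "A \<in> sets borel" for A
  proof -
    have "Int_stable ?E" by (auto simp: Int_stable_def box_Int_box)
    moreover have "?E \<subseteq> Pow UNIV" by simp
    moreover have "A \<in> sigma_sets UNIV ?E" using that by (simp add: borel_eq_box)
    ultimately show ?thesis
    proof (induction rule: sigma_sets_induct_disjoint)
      case (basic A) then show ?case using box by auto
    next
      case empty show ?case by (simp add: set_lebesgue_integral_def)
    next
      case (compl A)
      then have A: "A \<in> sets borel" by (simp add: borel_eq_box)
      have "set_lebesgue_integral lborel (UNIV - A) G = (LBINT x. G x - indicat_real A x *\<^sub>R G x)"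
        unfolding set_lebesgue_integral_def
        by (intro Bochner_Integration.integral_cong) (auto simp: indicator_def)
      also have "\<dots> = (LBINT x. G x) - set_lebesgue_integral lborel A G"
        unfolding set_lebesgue_integral_def
        by (rule Bochner_Integration.integral_diff[OF G int[OF A, unfolded set_integrable_def]])
      finally have "set_lebesgue_integral lborel (UNIV - A) G = (LBINT x. G x) - set_lebesgue_integral lborel A G" .
      then show ?case using all compl by simp
    next
      case (union A)
      then have A: "A i \<in> sets borel" for i by (auto simp: borel_eq_box)
      have "set_lebesgue_integral lborel (\<Union>i. A i) G = (\<Sum>i. set_lebesgue_integral lborel (A i) G)"
        using union(1) A by (intro lebesgue_integral_countable_add int) (auto simp: disjoint_family_on_def)
      then show ?case using union by simp
    qed
  qed
  then have "AE x in lborel. G x = 0"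
    by (intro density_unique_real[OF G, of "\<lambda>_. 0", simplified]) (auto simp: set_lebesgue_integral_def)
  then show ?thesis
  proof eventually_elim
    case (elim x)
    then show ?case using bump_pos[of x \<rho> 0] by (auto simp: G_def)
  qed
qed

text \<open>A weak derivative \<open>H\<close> in the direction \<open>w\<close> may be integrated along segments parallel to \<open>w\<close>. Tested against
\<open>\<eta>\<close>, the difference \<open>u (x + w) - u x\<close> becomes the integral of \<open>u\<close> against \<open>\<eta> (x - w) - \<eta> x\<close>. The fundamental
theorem of calculus applies to the smooth function \<open>\<eta>\<close>, and every translate \<open>\<eta> (x - s w)\<close> is again
admissible in the weak formulation.\<close>

lemma shift_formula:
  fixes u H :: "'a::euclidean_space \<Rightarrow> real"
  assumes u: "integrable lborel u" and H: "integrable lborel H"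
    and weak: "\<And>\<eta>. smooth_on UNIV \<eta> \<Longrightarrow> (\<And>x. \<sigma> < norm x \<Longrightarrow> \<eta> x = 0) \<Longrightarrow>
      (LBINT x. u x * frechet_derivative \<eta> (at x) w) = - (LBINT x. H x * \<eta> x)"
    and \<rho>: "0 < \<rho>" "\<rho> + norm w \<le> \<sigma>"
  shows "AE x in lborel. norm x < \<rho> \<longrightarrow> u (x + w) - u x = (LBINT s. indicat_real {0..1} s * H (x + s *\<^sub>R w))"
proof -
  have [measurable]: "u \<in> borel_measurable borel" "H \<in> borel_measurable borel"
    using u H by auto
  let ?I = "indicat_real {0..1::real}"
  have I: "integrable lborel ?I" by (intro integrable_real_indicator) auto
  define K where "K x = (LBINT s. ?I s * H (x + s *\<^sub>R w))" for x
  have intK2: "integrable (lborel \<Otimes>\<^sub>M lborel) (\<lambda>(s, x). ?I s * H (x + s *\<^sub>R w))"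
  proof (rule lborel_pair.Fubini_integrable)
    have "(LBINT x. norm (case (s, x) of (s, x) \<Rightarrow> ?I s * H (x + s *\<^sub>R w))) = ?I s * (LBINT x. \<bar>H x\<bar>)" for s
      using integral_lborel_translate[of "\<lambda>x. \<bar>H x\<bar>" "s *\<^sub>R w"] by (simp add: abs_mult)
    then show "integrable lborel (\<lambda>s. LBINT x. norm (case (s, x) of (s, x) \<Rightarrow> ?I s * H (x + s *\<^sub>R w)))"
      using I by simp
    show "AE s in lborel. integrable lborel (\<lambda>x. case (s, x) of (s, x) \<Rightarrow> ?I s * H (x + s *\<^sub>R w))"
      using integrable_lborel_translate[OF H] by simp
  qed measurable
  have intK: "integrable lborel K"
    using lborel_pair.integrable_snd[OF intK2] by (simp add: K_def[abs_def])
  have F: "integrable lborel (\<lambda>x. u (x + w) - u x - K x)"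
    by (intro Bochner_Integration.integrable_diff integrable_lborel_translate u intK)
  have "AE x in lborel. norm x < \<rho> \<longrightarrow> u (x + w) - u x - K x = 0"
  proof (rule ae_zero_if_tests_vanish[OF F \<rho>(1)])
    fix \<eta> :: "'a \<Rightarrow> real"
    assume sm: "smooth_on UNIV \<eta>" and out: "\<And>x. \<rho> \<le> norm x \<Longrightarrow> \<eta> x = 0"
    define D where "D x = frechet_derivative \<eta> (at x) w" for x
    have Dc: "continuous_on UNIV D"
      unfolding D_def by (intro smooth_on_continuous smooth_on_frechet_derivative sm)
    have [measurable]: "\<eta> \<in> borel_measurable borel" "D \<in> borel_measurable borel"
      using Dc smooth_on_continuous[OF sm] by (auto intro: borel_measurable_continuous_onI)
    obtain C where C: "0 \<le> C" "\<And>x. \<bar>\<eta> x\<bar> \<le> C"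
      using continuous_compact_support_bounded[OF smooth_on_continuous[OF sm] out[OF less_imp_le]] by blast
    have "D x = 0" if "\<rho> < norm x" for x
      unfolding D_def by (rule frechet_derivative_zero_outside[OF _ that]) (simp add: out)
    from continuous_compact_support_bounded[OF Dc this]
    obtain C1 where C1: "0 \<le> C1" "\<And>x. \<bar>D x\<bar> \<le> C1" by blast
    note mult = integrable_mult_bounded
    have 1: "(LBINT x. u (x + w) * \<eta> x) = (LBINT x. u x * \<eta> (x + - w))"
      using integral_lborel_translate[of "\<lambda>x. u (x + w) * \<eta> x" "- w"] by simp
    have FTC: "\<eta> (y + - w) - \<eta> y = (LBINT s. ?I s * - D (y + - (s *\<^sub>R w)))" for y
    proof -
      have "has_bochner_integral lborel (\<lambda>s. ?I s *\<^sub>R - D (y + - (s *\<^sub>R w)))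
          (\<eta> (y + - (1 *\<^sub>R w)) - \<eta> (y + - (0 *\<^sub>R w)))"
      proof (rule has_bochner_integral_FTC_Icc)
        fix s :: real
        have "((\<lambda>s. \<eta> (y + - (s *\<^sub>R w))) has_derivative
            (\<lambda>t. frechet_derivative \<eta> (at (y + - (s *\<^sub>R w))) (- (t *\<^sub>R w)))) (at s)"
          by (rule has_derivative_compose[OF _ smooth_on_has_derivative[OF sm]])
            (auto intro!: derivative_eq_intros)
        also have "(\<lambda>t. frechet_derivative \<eta> (at (y + - (s *\<^sub>R w))) (- (t *\<^sub>R w)))
            = (\<lambda>t. t *\<^sub>R - D (y + - (s *\<^sub>R w)))"
          using has_derivative_linear[OF smooth_on_has_derivative[OF sm]]
          by (auto simp: D_def linear_neg linear_scale)
        finally show "((\<lambda>s. \<eta> (y + - (s *\<^sub>R w))) has_vector_derivative - D (y + - (s *\<^sub>R w))) (at s within {0..1})"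
          unfolding has_vector_derivative_def by (rule has_derivative_at_withinI)
      next
        show "continuous_on {0..1} (\<lambda>s. - D (y + - (s *\<^sub>R w)))"
          by (intro continuous_on_minus continuous_on_compose2[OF Dc] continuous_intros) auto
      qed simp
      then show ?thesis by (simp add: has_bochner_integral_iff)
    qed
    have int2: "integrable (lborel \<Otimes>\<^sub>M lborel) (\<lambda>(s, x). u x * (?I s * - D (x + - (s *\<^sub>R w))))"
    proof (rule Bochner_Integration.integrable_bound)
      show "integrable (lborel \<Otimes>\<^sub>M lborel) (\<lambda>(s, x). ?I s * (C1 * u x))"
        using u by (intro lborel_pair.Fubini_integrable) (auto simp: abs_mult)
      show "AE z in lborel \<Otimes>\<^sub>M lborel. norm (case z of (s, x) \<Rightarrow> u x * (?I s * - D (x + - (s *\<^sub>R w))))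
          \<le> norm (case z of (s, x) \<Rightarrow> ?I s * (C1 * u x))"
      proof (rule AE_I2, clarify)
        fix s :: real and x
        have "\<bar>u x\<bar> * (\<bar>?I s\<bar> * \<bar>D (x + - (s *\<^sub>R w))\<bar>) \<le> \<bar>u x\<bar> * (\<bar>?I s\<bar> * C1)"
          by (intro mult_left_mono C1) auto
        then show "norm (u x * (?I s * - D (x + - (s *\<^sub>R w)))) \<le> norm (?I s * (C1 * u x))"
          using C1(1) by (simp add: abs_mult mult_ac)
      qed
    qed measurable
    have int3: "integrable (lborel \<Otimes>\<^sub>M lborel) (\<lambda>(s, x). (?I s * H (x + s *\<^sub>R w)) * \<eta> x)"
    proof (rule Bochner_Integration.integrable_bound[OF integrable_mult_left[OF intK2, of C]])
      show "AE z in lborel \<Otimes>\<^sub>M lborel. norm (case z of (s, x) \<Rightarrow> (?I s * H (x + s *\<^sub>R w)) * \<eta> x)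
          \<le> norm ((case z of (s, x) \<Rightarrow> ?I s * H (x + s *\<^sub>R w)) * C)"
        using C by (intro AE_I2) (auto simp: abs_mult intro!: mult_left_mono)
    qed measurable
    have inner: "(LBINT x. u x * (?I s * - D (x + - (s *\<^sub>R w)))) = (LBINT x. (?I s * H (x + s *\<^sub>R w)) * \<eta> x)" for s
    proof (cases "s \<in> {0..1}")
      case True
      have "(LBINT x. u x * D (x + - (s *\<^sub>R w))) = - (LBINT x. H x * \<eta> (x + - (s *\<^sub>R w)))"
      proof -
        have "\<eta> (x + - (s *\<^sub>R w)) = 0" if "\<sigma> < norm x" for x
        proof (rule out)
          have "norm (s *\<^sub>R w) \<le> norm w" using True by (simp add: mult_left_le_one_le)
          then show "\<rho> \<le> norm (x + - (s *\<^sub>R w))"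
            using that \<rho>(2) norm_triangle_ineq2[of x "s *\<^sub>R w"] by simp
        qed
        from weak[OF smooth_on_translate[OF sm, of "- (s *\<^sub>R w)"] this]
        show ?thesis unfolding D_def frechet_derivative_translate[OF sm] by simp
      qed
      also have "(LBINT x. H x * \<eta> (x + - (s *\<^sub>R w))) = (LBINT x. H (x + s *\<^sub>R w) * \<eta> x)"
        using integral_lborel_translate[of "\<lambda>x. H x * \<eta> (x + - (s *\<^sub>R w))" "s *\<^sub>R w"] by simp
      finally show ?thesis using True by simp
    qed simp
    have "(LBINT x. u (x + w) * \<eta> x) - (LBINT x. u x * \<eta> x) = (LBINT x. u x * (\<eta> (x + - w) - \<eta> x))"
      unfolding 1 right_diff_distrib
      by (rule Bochner_Integration.integral_diff[symmetric]) (auto intro!: mult[OF u] C)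
    also have "\<dots> = (LBINT x. LBINT s. u x * (?I s * - D (x + - (s *\<^sub>R w))))"
      unfolding FTC by simp
    also have "\<dots> = (LBINT s. LBINT x. u x * (?I s * - D (x + - (s *\<^sub>R w))))"
      by (rule lborel_pair.Fubini_integral[OF int2])
    also have "\<dots> = (LBINT s. LBINT x. (?I s * H (x + s *\<^sub>R w)) * \<eta> x)"
      unfolding inner ..
    also have "\<dots> = (LBINT x. LBINT s. (?I s * H (x + s *\<^sub>R w)) * \<eta> x)"
      by (rule lborel_pair.Fubini_integral[OF int3, symmetric])
    also have "\<dots> = (LBINT x. K x * \<eta> x)"
      unfolding K_def by simp
    finally have eq: "(LBINT x. u (x + w) * \<eta> x) - (LBINT x. u x * \<eta> x) = (LBINT x. K x * \<eta> x)" .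
    have i: "integrable lborel (\<lambda>x. u (x + w) * \<eta> x)" "integrable lborel (\<lambda>x. u x * \<eta> x)"
        "integrable lborel (\<lambda>x. K x * \<eta> x)"
      by (auto intro!: mult C integrable_lborel_translate u intK)
    show "(LBINT x. (u (x + w) - u x - K x) * \<eta> x) = 0"
      unfolding left_diff_distrib using eq i by simp
  qed
  then show ?thesis by (simp add: K_def)
qed

section \<open>Borel representatives\<close>

lemma lebesgue_on_AE_iff:
  fixes B :: "'a::euclidean_space set"
  assumes "B \<in> sets borel"
  shows "(AE x in lebesgue_on B. P x) \<longleftrightarrow> (AE x in lborel. x \<in> B \<longrightarrow> P x)"
  using assms by (subst AE_restrict_space_iff) (auto simp: AE_completion_iff)

lemma lebesgue_on_borel:
  fixes B :: "'a::euclidean_space set" and F F' :: "'a \<Rightarrow> real"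
  assumes B: "B \<in> sets borel" and F': "F' \<in> borel_measurable borel"
    and ae: "AE x in lborel. x \<in> B \<longrightarrow> F x = F' x"
  shows lebesgue_on_integral_borel: "(LINT x|lebesgue_on B. F x) = (LBINT x. indicat_real B x * F' x)"
    and lebesgue_on_integrable_borel: "integrable (lebesgue_on B) F \<longleftrightarrow> integrable lborel (\<lambda>x. indicat_real B x * F' x)"
proof -
  have [measurable]: "B \<in> sets borel" "F' \<in> borel_measurable borel" by fact+
  have eq: "AE x in lebesgue. indicat_real B x * F' x = indicat_real B x * F x"
    using AE_completion[OF ae] by eventually_elim (auto simp: indicator_def)
  have m': "(\<lambda>x. indicat_real B x * F' x) \<in> borel_measurable lborel"
    by measurable
  then have mc: "(\<lambda>x. indicat_real B x * F' x) \<in> borel_measurable lebesgue"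
    by (rule measurable_completion)
  have m: "(\<lambda>x. indicat_real B x * F x) \<in> borel_measurable lebesgue"
    by (rule borel_measurable_AE[OF mc eq])
  have "(LINT x|lebesgue_on B. F x) = (LINT x|lebesgue. indicat_real B x * F x)"
    using B by (subst integral_restrict_space) auto
  also have "\<dots> = (LINT x|lebesgue. indicat_real B x * F' x)"
    using eq by (intro integral_cong_AE m mc) auto
  also have "\<dots> = (LBINT x. indicat_real B x * F' x)"
    by (rule integral_completion[OF m'])
  finally show "(LINT x|lebesgue_on B. F x) = (LBINT x. indicat_real B x * F' x)" .
  have "integrable (lebesgue_on B) F \<longleftrightarrow> integrable lebesgue (\<lambda>x. indicat_real B x * F x)"
    using B by (subst integrable_restrict_space) auto
  also have "\<dots> \<longleftrightarrow> integrable lebesgue (\<lambda>x. indicat_real B x * F' x)"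
    using eq by (intro integrable_cong_AE m mc) auto
  also have "\<dots> \<longleftrightarrow> integrable lborel (\<lambda>x. indicat_real B x * F' x)"
    by (rule integrable_completion[OF m'])
  finally show "integrable (lebesgue_on B) F \<longleftrightarrow> integrable lborel (\<lambda>x. indicat_real B x * F' x)" .
qed

lemma borel_representative_real:
  fixes F :: "'a::euclidean_space \<Rightarrow> real"
  assumes B: "B \<in> sets borel" and F: "F \<in> borel_measurable (lebesgue_on B)"
  shows "\<exists>F'\<in>borel_measurable borel. AE x in lborel. x \<in> B \<longrightarrow> F x = F' x"
proof -
  have "(\<lambda>x. if x \<in> B then F x else 0) \<in> borel_measurable lebesgue"
    using F B by (intro borel_measurable_if_I) auto
  then obtain F' where "F' \<in> borel_measurable lborel" "AE x in lborel. (if x \<in> B then F x else 0) = F' x"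
    using completion_ex_borel_measurable_real by blast
  then show ?thesis by (intro bexI[of _ F']) (auto elim: eventually_mono)
qed

text \<open>Compositions such as \<open>f (x + t v)\<close> must be measurable in the pair \<open>(x, v)\<close>. This can fail for functions
that are only Lebesgue measurable, so all data are replaced by Borel functions.\<close>

lemma borel_representative:
  fixes F :: "'a::euclidean_space \<Rightarrow> 'b::euclidean_space"
  assumes B: "B \<in> sets borel" and F: "F \<in> borel_measurable (lebesgue_on B)"
  obtains F' where "F' \<in> borel_measurable borel" "AE x in lborel. x \<in> B \<longrightarrow> F x = F' x"
    "\<And>x. x \<notin> B \<Longrightarrow> F' x = 0"
proof -
  have "\<exists>F'\<in>borel_measurable borel. AE x in lborel. x \<in> B \<longrightarrow> F x \<bullet> b = F' x" for b
    by (rule borel_representative_real[OF B]) (use F in measurable)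
  then obtain G where G: "\<And>b. G b \<in> borel_measurable borel" "\<And>b. AE x in lborel. x \<in> B \<longrightarrow> F x \<bullet> b = G b x"
    by metis
  have "AE x in lborel. \<forall>b\<in>Basis. x \<in> B \<longrightarrow> F x \<bullet> b = G b x"
    using G(2) by (intro AE_finite_allI) auto
  then have ae: "AE x in lborel. x \<in> B \<longrightarrow> F x = indicat_real B x *\<^sub>R (\<Sum>b\<in>Basis. G b x *\<^sub>R b)"
    by eventually_elim (metis (mono_tags, lifting) euclidean_representation indicator_simps(1) scaleR_one sum.cong)
  show thesis
  proof (rule that[OF _ ae])
    show "(\<lambda>x. indicat_real B x *\<^sub>R (\<Sum>b\<in>Basis. G b x *\<^sub>R b)) \<in> borel_measurable borel"
      using B G(1) by measurable
  qed simp
qed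

section \<open>Distances between tuples\<close>

abbreviation tdist :: "nat \<Rightarrow> (nat \<Rightarrow> 'a::real_normed_vector) \<Rightarrow> (nat \<Rightarrow> 'a) \<Rightarrow> real"
  where "tdist Q P R \<equiv> Gdist Q (Qpoint Q P) (Qpoint Q R)"

lemma tdist_Min: "tdist Q P R = Min (tuple_cost Q P R ` {\<sigma>. \<sigma> permutes {..<Q}})"
  by (simp add: Gdist_Qpoint tuple_cost_def)

lemma tdist_attained: "\<exists>\<sigma>. \<sigma> permutes {..<Q} \<and> tdist Q P R = tuple_cost Q P R \<sigma>"
  using Min_in[OF finite_tuple_costs tuple_costs_nonempty, of Q P R] unfolding tdist_Min by auto

lemma tdist_le: "\<sigma> permutes {..<Q} \<Longrightarrow> tdist Q P R \<le> tuple_cost Q P R \<sigma>"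
  unfolding tdist_Min by (intro Min_le finite_tuple_costs) blast

lemma tdist_le_id: "tdist Q P R \<le> sqrt (\<Sum>i<Q. (norm (P i - R i))\<^sup>2)"
  using tdist_le[OF permutes_id, of Q P R] by (simp add: tuple_cost_def)

lemma Gdist_sym: "Gdist Q T S = Gdist Q S T"
  by (intro antisym Gdist_sym_le)

lemma tdist_measurable [measurable (raw)]:
  fixes p r :: "'i \<Rightarrow> nat \<Rightarrow> 'b::euclidean_space"
  assumes [measurable]: "\<And>i. (\<lambda>x. p x i) \<in> borel_measurable M" "\<And>i. (\<lambda>x. r x i) \<in> borel_measurable M"
  shows "(\<lambda>x. tdist Q (p x) (r x)) \<in> borel_measurable M"
  unfolding Gdist_Qpoint
  by (intro borel_measurable_Min finite_permutations) (auto intro: borel_measurable_sqrt)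

definition tnorm :: "nat \<Rightarrow> (nat \<Rightarrow> 'a::real_normed_vector) \<Rightarrow> real"
  where "tnorm Q P = sqrt (\<Sum>i<Q. (norm (P i))\<^sup>2)"

lemma tnorm_nonneg [simp]: "0 \<le> tnorm Q P"
  by (simp add: tnorm_def sum_nonneg)

lemma tnorm_sq: "(tnorm Q P)\<^sup>2 = (\<Sum>i<Q. (norm (P i))\<^sup>2)"
  by (simp add: tnorm_def sum_nonneg)

lemma Qnorm_Qpoint: "Qnorm (Qpoint Q P) = tnorm Q P"
  by (simp add: Qnorm_def tnorm_def Qpoint_image_mset image_mset.compositionality o_def sum_unfold_sum_mset)

lemma sum_inner_le_tnorm:
  fixes P L :: "nat \<Rightarrow> 'a::real_inner"
  shows "\<bar>\<Sum>i<Q. P i \<bullet> L i\<bar> \<le> tnorm Q P * tnorm Q L"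
proof -
  have "\<bar>\<Sum>i<Q. P i \<bullet> L i\<bar> \<le> (\<Sum>i<Q. \<bar>norm (P i)\<bar> * \<bar>norm (L i)\<bar>)"
    by (rule order_trans[OF sum_abs sum_mono]) (simp add: Cauchy_Schwarz_ineq2)
  also have "\<dots> \<le> L2_set (\<lambda>i. norm (P i)) {..<Q} * L2_set (\<lambda>i. norm (L i)) {..<Q}"
    by (rule L2_set_mult_ineq)
  finally show ?thesis by (simp add: tnorm_def L2_set_def)
qed

lemma tnorm_measurable [measurable (raw)]:
  fixes p :: "'i \<Rightarrow> nat \<Rightarrow> 'b::euclidean_space"
  assumes [measurable]: "\<And>i. (\<lambda>x. p x i) \<in> borel_measurable M"
  shows "(\<lambda>x. tnorm Q (p x)) \<in> borel_measurable M"
  unfolding tnorm_def by measurable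

text \<open>After reindexing along an optimal permutation this is the triangle inequality in \<open>L2_set\<close>.\<close>

lemma tnorm_diff_le: "tnorm Q P - tnorm Q R \<le> tdist Q P R"
proof -
  obtain \<sigma> where \<sigma>: "\<sigma> permutes {..<Q}" and eq: "tdist Q P R = tuple_cost Q P R \<sigma>"
    using tdist_attained by blast
  have "tnorm Q P = L2_set (\<lambda>i. norm (P i)) {..<Q}"
    by (simp add: tnorm_def L2_set_def)
  also have "\<dots> \<le> L2_set (\<lambda>i. norm (P i - R (\<sigma> i)) + norm (R (\<sigma> i))) {..<Q}"
    by (intro L2_set_mono) (auto intro: norm_triangle_sub[THEN order_trans] simp: add.commute)
  also have "\<dots> \<le> L2_set (\<lambda>i. norm (P i - R (\<sigma> i))) {..<Q} + L2_set (\<lambda>i. norm (R (\<sigma> i))) {..<Q}"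
    by (rule L2_set_triangle_ineq)
  also have "L2_set (\<lambda>i. norm (R (\<sigma> i))) {..<Q} = tnorm Q R"
    unfolding tnorm_def L2_set_def
    using sum.permute[OF \<sigma>, of "\<lambda>i. (norm (R i))\<^sup>2"] by (simp add: o_def)
  finally show ?thesis by (simp add: eq tuple_cost_def L2_set_def)
qed

lemma abs_tnorm_diff_le: "\<bar>tnorm Q P - tnorm Q R\<bar> \<le> tdist Q P R"
  using tnorm_diff_le[of Q P R] tnorm_diff_le[of Q R P] Gdist_sym[of Q "Qpoint Q P" "Qpoint Q R"] by linarith

text \<open>A bounded replacement of \<open>s\<^sup>2\<close> that, unlike \<open>s\<^sup>2\<close>, is Lipschitz (with constant \<open>m\<close>). Difference quotients of
\<open>trunc m |f|\<close> are therefore controlled by those of \<open>f\<close> itself.\<close>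

definition trunc :: "real \<Rightarrow> real \<Rightarrow> real"
  where "trunc m s = s\<^sup>2 / (1 + s\<^sup>2 / m\<^sup>2)"

lemma trunc_half:
  assumes m: "0 < m"
  shows "s / (1 + s\<^sup>2 / m\<^sup>2) \<le> m / (2::real)"
proof -
  have pos: "0 < 1 + s\<^sup>2 / m\<^sup>2" by (intro add_pos_nonneg) auto
  have "0 \<le> (1 - s / m)\<^sup>2" by simp
  then have "2 * (s / m) \<le> 1 + s\<^sup>2 / m\<^sup>2" by (simp add: power2_diff power_divide)
  then have "m / 2 * (2 * (s / m)) \<le> m / 2 * (1 + s\<^sup>2 / m\<^sup>2)" using m by (intro mult_left_mono) auto
  then have "s \<le> m / 2 * (1 + s\<^sup>2 / m\<^sup>2)" using m by simp
  then show ?thesis using pos by (simp add: pos_divide_le_eq)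
qed

text \<open>With \<open>A = 1 + a\<^sup>2 / m\<^sup>2\<close> and \<open>B = 1 + b\<^sup>2 / m\<^sup>2\<close> the difference equals \<open>(a - b) (a + b) / (A B)\<close>, and
\<open>a / A + b / B \<le> m\<close>.\<close>

lemma trunc_Lipschitz:
  assumes m: "0 < m" and "0 \<le> a" "0 \<le> b"
  shows "\<bar>trunc m a - trunc m b\<bar> \<le> m * \<bar>a - b\<bar>"
proof -
  have pos: "0 < 1 + s\<^sup>2 / m\<^sup>2" "1 \<le> 1 + s\<^sup>2 / m\<^sup>2" for s
    using m by (auto intro: add_pos_nonneg)
  note half = trunc_half[OF m]
  define A B where "A = 1 + a\<^sup>2 / m\<^sup>2" and "B = 1 + b\<^sup>2 / m\<^sup>2"
  have AB: "1 \<le> A" "1 \<le> B" using pos by (auto simp: A_def B_def)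
  have "trunc m a - trunc m b = (a\<^sup>2 * B - b\<^sup>2 * A) / (A * B)"
    using AB by (simp add: trunc_def A_def[symmetric] B_def[symmetric] diff_frac_eq)
  also have "a\<^sup>2 * B - b\<^sup>2 * A = (a - b) * (a + b)"
    by (simp add: A_def B_def algebra_simps power2_eq_square)
  finally have eq: "\<bar>trunc m a - trunc m b\<bar> = \<bar>a - b\<bar> * ((a + b) / (A * B))"
    using AB assms by (simp add: abs_mult)
  have "(a + b) / (A * B) \<le> a / A + b / B"
  proof -
    have "a / (A * B) \<le> a / A" "b / (A * B) \<le> b / B"
      using AB assms by (auto intro!: divide_left_mono mult_pos_pos simp: mult_le_cancel_left1 mult_le_cancel_right1)
    then show ?thesis by (simp add: add_divide_distrib)
  qed
  also have "\<dots> \<le> m" using half[of a, folded A_def] half[of b, folded B_def] by linarith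
  finally show ?thesis unfolding eq by (subst mult.commute[of m]) (intro mult_left_mono, auto)
qed

lemma trunc_bounds: "0 \<le> trunc m s" "trunc m s \<le> s\<^sup>2"
proof -
  have "1 \<le> 1 + s\<^sup>2 / m\<^sup>2" by simp
  then have "s\<^sup>2 / (1 + s\<^sup>2 / m\<^sup>2) \<le> s\<^sup>2 / 1" by (intro divide_left_mono mult_pos_pos) (auto intro: add_pos_nonneg)
  then show "0 \<le> trunc m s" "trunc m s \<le> s\<^sup>2" by (simp_all add: trunc_def)
qed

lemma trunc_tnorm_line_derivative:
  fixes P L :: "nat \<Rightarrow> 'a::real_inner"
  shows "((\<lambda>t. trunc m (tnorm Q (\<lambda>i. P i + t *\<^sub>R L i))) has_real_derivative
    2 * (\<Sum>i<Q. P i \<bullet> L i) / (1 + (tnorm Q P)\<^sup>2 / m\<^sup>2)\<^sup>2) (at 0)"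
proof -
  define N where "N t = (\<Sum>i<Q. (norm (P i + t *\<^sub>R L i))\<^sup>2)" for t
  have N: "(N has_real_derivative 2 * (\<Sum>i<Q. P i \<bullet> L i)) (at 0)"
    unfolding N_def power2_norm_eq_inner
    by (auto intro!: derivative_eq_intros simp: has_field_derivative_def inner_commute sum_distrib_left
        sum_distrib_right algebra_simps sum.distrib)
  have N0: "N 0 = (\<Sum>i<Q. (norm (P i))\<^sup>2)" by (simp add: N_def)
  have pos: "0 < 1 + N 0 / m\<^sup>2" by (intro add_pos_nonneg) (auto simp: N_def sum_nonneg)
  have "((\<lambda>t. N t / (1 + N t / m\<^sup>2)) has_real_derivative
      (2 * (\<Sum>i<Q. P i \<bullet> L i) * (1 + N 0 / m\<^sup>2) - N 0 * (2 * (\<Sum>i<Q. P i \<bullet> L i) / m\<^sup>2))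
        / ((1 + N 0 / m\<^sup>2) * (1 + N 0 / m\<^sup>2))) (at 0)"
    using DERIV_divide[OF N DERIV_add[OF DERIV_const[of 1] DERIV_cdivide[OF N, of "m\<^sup>2"]]] pos by simp
  moreover have "2 * (\<Sum>i<Q. P i \<bullet> L i) * (1 + N 0 / m\<^sup>2) - N 0 * (2 * (\<Sum>i<Q. P i \<bullet> L i) / m\<^sup>2)
      = 2 * (\<Sum>i<Q. P i \<bullet> L i)"
    by (simp add: algebra_simps)
  ultimately show ?thesis
    by (simp only: trunc_def tnorm_sq N_def[symmetric] N0[symmetric] power2_eq_square[of "1 + N 0 / m\<^sup>2"])
qed

text \<open>For small \<open>t\<close> every matching costs at least as much as the identity: pairing \<open>P i\<close> with a different point
\<open>P (\<sigma> i)\<close> costs at least the gap between them minus \<open>t |L i|\<close>, and the gap is at least \<open>2 t |L i|\<close>.\<close>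

lemma tdist_line_lower:
  fixes P L :: "nat \<Rightarrow> 'a::real_normed_vector"
  shows "\<exists>d>0. \<forall>t. 0 < t \<and> t < d \<longrightarrow> t * tnorm Q L \<le> tdist Q (\<lambda>i. P i + t *\<^sub>R L i) P"
proof -
  \<comment> \<open>the positive gaps between the points; 1 only makes the set nonempty\<close>
  define G where "G = insert 1 ((\<lambda>(i, j). norm (P i - P j)) ` ({..<Q} \<times> {..<Q}) \<inter> {0<..})"
  define K where "K = 1 + (\<Sum>i<Q. norm (L i))"
  have G: "finite G" "G \<noteq> {}" "\<And>x. x \<in> G \<Longrightarrow> 0 < x" by (auto simp: G_def)
  have K: "0 < K" by (auto simp: K_def sum_nonneg intro: add_pos_nonneg)
  have LK: "norm (L i) \<le> K" if "i < Q" for i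
    using that member_le_sum[of i "{..<Q}" "\<lambda>i. norm (L i)"] by (simp add: K_def)
  have m: "0 < Min G" using G by simp
  show ?thesis
  proof (intro exI conjI allI impI)
    show "0 < Min G / (2 * K)" using m K by simp
    fix t assume t: "0 < t \<and> t < Min G / (2 * K)"
    then have tK: "2 * (t * K) \<le> Min G" using K by (simp add: pos_less_divide_eq mult_ac)
    obtain \<sigma> where \<sigma>: "\<sigma> permutes {..<Q}"
      and eq: "tdist Q (\<lambda>i. P i + t *\<^sub>R L i) P = tuple_cost Q (\<lambda>i. P i + t *\<^sub>R L i) P \<sigma>"
      using tdist_attained by blast
    have "t * norm (L i) \<le> norm (P i + t *\<^sub>R L i - P (\<sigma> i))" if i: "i < Q" for i
    proof (cases "P i = P (\<sigma> i)")
      case True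
      then show ?thesis using t by simp
    next
      case False
      have "\<sigma> i < Q" using permutes_in_image[OF \<sigma>, of i] i by simp
      then have "norm (P i - P (\<sigma> i)) \<in> G" using False i by (force simp: G_def)
      then have "2 * (t * K) \<le> norm (P i - P (\<sigma> i))" using tK Min_le[OF G(1)] by fastforce
      moreover have "t * norm (L i) \<le> t * K" "norm (t *\<^sub>R L i) = t * norm (L i)" using LK[OF i] t by simp_all
      moreover have "norm (P i - P (\<sigma> i)) \<le> norm (P i + t *\<^sub>R L i - P (\<sigma> i)) + norm (t *\<^sub>R L i)"
        using norm_triangle_ineq4[of "P i + t *\<^sub>R L i - P (\<sigma> i)" "t *\<^sub>R L i"] by (simp add: algebra_simps)
      ultimately show ?thesis by linarith
    qed
    then have "(\<Sum>i<Q. (t * norm (L i))\<^sup>2) \<le> (\<Sum>i<Q. (norm (P i + t *\<^sub>R L i - P (\<sigma> i)))\<^sup>2)"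
      using t by (intro sum_mono power_mono) auto
    moreover have "t * tnorm Q L = sqrt (\<Sum>i<Q. (t * norm (L i))\<^sup>2)"
      using t by (simp add: tnorm_def power_mult_distrib sum_distrib_left[symmetric] real_sqrt_mult)
    ultimately show "t * tnorm Q L \<le> tdist Q (\<lambda>i. P i + t *\<^sub>R L i) P"
      by (simp add: eq tuple_cost_def)
  qed
qed

lemma countable_dense_AQ:
  obtains \<T> :: "(nat \<Rightarrow> 'a::euclidean_space) set"
  where "countable \<T>" "\<And>P e. 0 < e \<Longrightarrow> \<exists>R\<in>\<T>. tdist Q P R < e"
proof -
  obtain D :: "'a set" where D: "countable D" "\<And>X. open X \<Longrightarrow> X \<noteq> {} \<Longrightarrow> \<exists>d \<in> D. d \<in> X"
    using countable_dense_setE by blast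
  let ?T = "(\<lambda>xs i. xs ! i) ` lists D"
  show thesis
  proof
    show "countable ?T" using D(1) by auto
    fix P :: "nat \<Rightarrow> 'a" and e :: real assume e: "0 < e"
    define c where "c = e / (1 + real Q)"
    have c: "0 < c" using e by (simp add: c_def)
    have "\<forall>i. \<exists>d\<in>D. d \<in> ball (P i) c" using D(2)[of "ball (P _) c"] c by (auto simp: centre_in_ball)
    then have "\<exists>r. \<forall>i. r i \<in> D \<and> dist (P i) (r i) < c" by (intro choice) auto
    then obtain r where r: "\<And>i. r i \<in> D" "\<And>i. dist (P i) (r i) < c" by blast
    have "tdist Q P (\<lambda>i. map r [0..<Q] ! i) \<le> L2_set (\<lambda>i. norm (P i - map r [0..<Q] ! i)) {..<Q}"
      using tdist_le_id[of Q P "\<lambda>i. map r [0..<Q] ! i"] unfolding L2_set_def .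
    also have "\<dots> \<le> (\<Sum>i<Q. norm (P i - map r [0..<Q] ! i))"
      by (rule L2_set_le_sum) simp
    also have "\<dots> \<le> (\<Sum>i<Q. c)"
      using r(2) by (intro sum_mono) (auto simp: dist_norm intro: less_imp_le)
    also have "\<dots> < e" using e c by (simp add: c_def field_simps)
    finally show "\<exists>R\<in>?T. tdist Q P R < e"
      using r(1) by (intro bexI[of _ "\<lambda>i. map r [0..<Q] ! i"] image_eqI[of _ _ "map r [0..<Q]"]) auto
  qed
qed

text \<open>The distance of two points is recovered from their distances to the points of a dense set, by letting
these tend to one of the two points.\<close>

lemma Gdist_le_if_all_Gdist_diff_le:
  fixes A B :: "nat \<Rightarrow> 'a::real_normed_vector"
  assumes dense: "\<And>e. 0 < e \<Longrightarrow> \<exists>R\<in>\<T>. tdist Q B R < e"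
    and le: "\<And>R. R \<in> \<T> \<Longrightarrow> ennreal \<bar>tdist Q A R - tdist Q B R\<bar> \<le> c"
  shows "ennreal (tdist Q A B) \<le> c"
proof (cases c)
  case (real r)
  have "tdist Q A B \<le> r + e" if e: "0 < e" for e
  proof -
    obtain R where R: "R \<in> \<T>" "tdist Q B R < e / 2" using dense[of "e / 2"] e by auto
    have "\<bar>tdist Q A R - tdist Q B R\<bar> \<le> r" using le[OF R(1)] real by simp
    then show ?thesis
      using Gdist_triangle[of Q "Qpoint Q A" "Qpoint Q B" "Qpoint Q R"] R(2)
        Gdist_sym[of Q "Qpoint Q B" "Qpoint Q R"] by linarith
  qed
  then have "tdist Q A B \<le> r" by (rule field_le_epsilon)
  then show ?thesis using real by (simp add: ennreal_leI)
qed simp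

section \<open>Difference quotients of a Sobolev map\<close>

abbreviation segment_integral :: "('a::euclidean_space \<Rightarrow> real) \<Rightarrow> 'a \<Rightarrow> 'a \<Rightarrow> ennreal"
  where "segment_integral \<phi> x w \<equiv> \<integral>\<^sup>+s. indicator {0..1} s * ennreal (norm w * \<phi> (x + s *\<^sub>R w)) \<partial>lborel"

text \<open>This is \<open>shift_formula\<close> for \<open>H = \<Sum>j. w $ j * h j\<close>. The function \<open>u\<close> and its derivatives are cut off outside
the closed ball of radius \<open>\<rho> + norm w\<close>, which contains every segment that starts in the ball of radius \<open>\<rho>\<close>
and makes them globally integrable.\<close>

lemma weak_partial_difference_bound:
  fixes U u :: "real^'n \<Rightarrow> real" and h \<phi> :: "'n \<Rightarrow> real^'n \<Rightarrow> real"
  assumes wp: "\<And>j. weak_partial (ball 0 1) j U (h j)"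
    and u [measurable]: "u \<in> borel_measurable borel" and Uu: "AE x in lborel. x \<in> ball 0 1 \<longrightarrow> U x = u x"
    and \<phi> [measurable]: "\<And>j. \<phi> j \<in> borel_measurable borel"
    and h\<phi>: "\<And>j. AE x in lborel. x \<in> ball 0 1 \<longrightarrow> \<bar>h j x\<bar> \<le> \<phi> j x"
    and \<rho>: "0 < \<rho>" "\<rho> + norm w < 1"
  shows "AE x in lborel. norm x < \<rho> \<longrightarrow> ennreal \<bar>u (x + w) - u x\<bar> \<le>
    segment_integral (\<lambda>y. \<Sum>j\<in>UNIV. \<bar>\<phi> j y\<bar>) x w"
proof -
  define \<sigma> where "\<sigma> = \<rho> + norm w"
  have \<sigma>: "\<sigma> < 1" "0 < \<sigma>" using \<rho> by (auto simp: \<sigma>_def intro: add_pos_nonneg)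
  have cb: "cball 0 \<sigma> \<subseteq> ball (0::real^'n) 1" using \<sigma> by auto
  have "\<exists>h'. h' \<in> borel_measurable borel \<and> (AE x in lborel. x \<in> ball 0 1 \<longrightarrow> h j x = h' x)" for j
  proof -
    have "h j \<in> borel_measurable (lebesgue_on (ball 0 1))"
      using wp[of j] unfolding weak_partial_def L1_loc_def by blast
    from borel_representative_real[OF _ this] show ?thesis by auto
  qed
  then have "\<forall>j. \<exists>h'. h' \<in> borel_measurable borel \<and> (AE x in lborel. x \<in> ball 0 1 \<longrightarrow> h j x = h' x)" by blast
  from choice[OF this] obtain h' where h' [measurable]: "\<And>j. h' j \<in> borel_measurable borel"
    and hh': "\<And>j. AE x in lborel. x \<in> ball 0 1 \<longrightarrow> h j x = h' j x" by blast
  \<comment> \<open>a Borel version of the weak derivative for which the bound holds everywhere\<close>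
  define k where "k j x = (if \<bar>h' j x\<bar> \<le> \<phi> j x then h' j x else 0)" for j x
  have [measurable]: "k j \<in> borel_measurable borel" for j unfolding k_def[abs_def] by measurable
  have hk: "AE x in lborel. x \<in> ball 0 1 \<longrightarrow> h j x = k j x" for j
    using hh'[of j] h\<phi>[of j] by eventually_elim (auto simp: k_def)
  have k\<phi>: "\<bar>k j x\<bar> \<le> \<bar>\<phi> j x\<bar>" for j x by (auto simp: k_def)
  let ?I = "indicat_real (cball (0::real^'n) \<sigma>)"
  have iu: "integrable lborel (\<lambda>x. ?I x * u x)"
  proof -
    have "integrable (lebesgue_on (cball 0 \<sigma>)) U"
      using wp[of undefined] cb by (auto simp: weak_partial_def L1_loc_def)
    moreover have "AE x in lborel. x \<in> cball 0 \<sigma> \<longrightarrow> U x = u x"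
      using Uu by eventually_elim (use cb in auto)
    ultimately show ?thesis
      by (subst (asm) lebesgue_on_integrable_borel[where F' = u]) auto
  qed
  have ik: "integrable lborel (\<lambda>x. ?I x * k j x)" for j
  proof -
    have "integrable (lebesgue_on (cball 0 \<sigma>)) (h j)"
      using wp[of j] cb by (auto simp: weak_partial_def L1_loc_def)
    moreover have "AE x in lborel. x \<in> cball 0 \<sigma> \<longrightarrow> h j x = k j x"
      using hk[of j] by eventually_elim (use cb in auto)
    ultimately show ?thesis
      by (subst (asm) lebesgue_on_integrable_borel[where F' = "k j"]) auto
  qed
  define H where "H x = (\<Sum>j\<in>UNIV. w $ j * (?I x * k j x))" for x
  have iH: "integrable lborel H"
    unfolding H_def[abs_def] by (intro Bochner_Integration.integrable_sum integrable_mult_right ik)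
  have weak: "(LBINT x. (?I x * u x) * frechet_derivative \<eta> (at x) w) = - (LBINT x. H x * \<eta> x)"
    if sm: "smooth_on UNIV \<eta>" and out: "\<And>x. \<sigma> < norm x \<Longrightarrow> \<eta> x = 0" for \<eta>
  proof -
    define d where "d j x = frechet_derivative \<eta> (at x) (axis j 1)" for j x
    have dc: "continuous_on UNIV (d j)" for j
      unfolding d_def[abs_def] by (intro smooth_on_continuous smooth_on_frechet_derivative sm)
    have [measurable]: "\<eta> \<in> borel_measurable borel" "d j \<in> borel_measurable borel" for j
      by (rule borel_measurable_continuous_onI, rule smooth_on_continuous[OF sm])
        (rule borel_measurable_continuous_onI, rule dc)
    have d0: "d j x = 0" if "\<sigma> < norm x" for j x
      unfolding d_def by (rule frechet_derivative_zero_outside[OF out that])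
    obtain C where C: "\<And>x. \<bar>\<eta> x\<bar> \<le> C"
      using continuous_compact_support_bounded[OF smooth_on_continuous[OF sm] out] by blast
    have "\<exists>C\<ge>0. \<forall>x. \<bar>d j x\<bar> \<le> C" for j
      by (rule continuous_compact_support_bounded[OF dc d0])
    then have "\<forall>j. \<exists>C. \<forall>x. \<bar>d j x\<bar> \<le> C" by blast
    from choice[OF this] obtain C1 where C1: "\<And>j x. \<bar>d j x\<bar> \<le> C1 j" by blast
    have tf: "test_function (ball 0 1) \<eta>" by (rule test_functionI[OF sm \<sigma>(1) out])
    have one: "(LBINT x. (?I x * u x) * d j x) = - (LBINT x. (?I x * k j x) * \<eta> x)" for j
    proof -
      have "(LINT x|lebesgue_on (ball 0 1). U x * d j x) = - (LINT x|lebesgue_on (ball 0 1). h j x * \<eta> x)"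
        using wp[of j] tf unfolding weak_partial_def d_def by blast
      moreover have "(LINT x|lebesgue_on (ball 0 1). U x * d j x) = (LBINT x. indicat_real (ball 0 1) x * (u x * d j x))"
        using Uu by (intro lebesgue_on_integral_borel) auto
      moreover have "(LINT x|lebesgue_on (ball 0 1). h j x * \<eta> x) = (LBINT x. indicat_real (ball 0 1) x * (k j x * \<eta> x))"
        using hk[of j] by (intro lebesgue_on_integral_borel) auto
      moreover have "indicat_real (ball 0 1) x * (u x * d j x) = (?I x * u x) * d j x" for x
        using d0[of x j] \<sigma> by (auto simp: indicator_def not_le)
      moreover have "indicat_real (ball 0 1) x * (k j x * \<eta> x) = (?I x * k j x) * \<eta> x" for x
        using out[of x] \<sigma> by (auto simp: indicator_def not_le)
      ultimately show ?thesis by simp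
    qed
    have dw: "frechet_derivative \<eta> (at x) w = (\<Sum>j\<in>UNIV. w $ j * d j x)" for x
    proof -
      have l: "linear (frechet_derivative \<eta> (at x))"
        by (rule has_derivative_linear[OF smooth_on_has_derivative[OF sm]])
      have "frechet_derivative \<eta> (at x) w = frechet_derivative \<eta> (at x) (\<Sum>j\<in>UNIV. w $ j *\<^sub>R axis j 1)"
        by (simp add: basis_expansion scalar_mult_eq_scaleR[symmetric])
      also have "\<dots> = (\<Sum>j\<in>UNIV. w $ j * d j x)"
        by (simp add: linear_sum[OF l] linear_scale[OF l] d_def)
      finally show ?thesis .
    qed
    have "(LBINT x. (?I x * u x) * frechet_derivative \<eta> (at x) w) = (LBINT x. \<Sum>j\<in>UNIV. w $ j * ((?I x * u x) * d j x))"
      unfolding dw sum_distrib_left by (simp add: mult_ac)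
    also have "\<dots> = (\<Sum>j\<in>UNIV. w $ j * (LBINT x. (?I x * u x) * d j x))"
      by (subst Bochner_Integration.integral_sum) (auto intro!: integrable_mult_right integrable_mult_bounded[OF iu] C1)
    also have "\<dots> = - (\<Sum>j\<in>UNIV. w $ j * (LBINT x. (?I x * k j x) * \<eta> x))"
      unfolding one by (simp add: sum_negf)
    also have "(\<Sum>j\<in>UNIV. w $ j * (LBINT x. (?I x * k j x) * \<eta> x)) = (LBINT x. \<Sum>j\<in>UNIV. w $ j * ((?I x * k j x) * \<eta> x))"
      by (subst Bochner_Integration.integral_sum) (auto intro!: integrable_mult_right integrable_mult_bounded[OF ik] C)
    also have "(\<lambda>x. \<Sum>j\<in>UNIV. w $ j * ((?I x * k j x) * \<eta> x)) = (\<lambda>x. H x * \<eta> x)"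
      by (simp add: H_def sum_distrib_right mult.assoc)
    finally show ?thesis .
  qed
  have "AE x in lborel. norm x < \<rho> \<longrightarrow> ?I (x + w) * u (x + w) - ?I x * u x
      = (LBINT s. indicat_real {0..1} s * H (x + s *\<^sub>R w))"
    by (rule shift_formula[OF iu iH weak \<rho>(1)]) (assumption | simp add: \<sigma>_def)+
  then show ?thesis
  proof eventually_elim
    case (elim x)
    show ?case
    proof
      assume x: "norm x < \<rho>"
      have Hb: "\<bar>H y\<bar> \<le> norm w * (\<Sum>j\<in>UNIV. \<bar>\<phi> j y\<bar>)" for y
      proof -
        have "\<bar>H y\<bar> \<le> (\<Sum>j\<in>UNIV. \<bar>w $ j * (?I y * k j y)\<bar>)" unfolding H_def by (rule sum_abs)
        also have "\<dots> \<le> (\<Sum>j\<in>UNIV. norm w * \<bar>\<phi> j y\<bar>)"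
        proof (rule sum_mono)
          fix j
          have "\<bar>?I y * k j y\<bar> \<le> \<bar>\<phi> j y\<bar>" using k\<phi>[of j y] by (auto simp: indicator_def)
          then show "\<bar>w $ j * (?I y * k j y)\<bar> \<le> norm w * \<bar>\<phi> j y\<bar>"
            unfolding abs_mult[of "w $ j"] by (intro mult_mono component_le_norm_cart) auto
        qed
        finally show ?thesis by (simp add: sum_distrib_left)
      qed
      have "norm (x + w) \<le> \<sigma>" using x norm_triangle_ineq[of x w] by (simp add: \<sigma>_def)
      moreover have "norm x \<le> \<sigma>" using x by (simp add: \<sigma>_def add_increasing2)
      ultimately have "\<bar>u (x + w) - u x\<bar> = \<bar>LBINT s. indicat_real {0..1} s * H (x + s *\<^sub>R w)\<bar>"
        using elim x by simp
      then have "ennreal \<bar>u (x + w) - u x\<bar> \<le> (\<integral>\<^sup>+s. ennreal \<bar>indicat_real {0..1} s * H (x + s *\<^sub>R w)\<bar> \<partial>lborel)"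
        using ennreal_abs_integral_le by metis
      also have "\<dots> \<le> segment_integral (\<lambda>y. \<Sum>j\<in>UNIV. \<bar>\<phi> j y\<bar>) x w"
      proof (rule nn_integral_mono)
        show "ennreal \<bar>indicat_real {0..1} s * H (x + s *\<^sub>R w)\<bar>
            \<le> indicator {0..1} s * ennreal (norm w * (\<Sum>j\<in>UNIV. \<bar>\<phi> j (x + s *\<^sub>R w)\<bar>))" for s
          using Hb[of "x + s *\<^sub>R w"] by (cases "s \<in> {0..1}") (auto intro: ennreal_leI)
      qed
      finally show "ennreal \<bar>u (x + w) - u x\<bar> \<le> segment_integral (\<lambda>y. \<Sum>j\<in>UNIV. \<bar>\<phi> j y\<bar>) x w" .
    qed
  qed
qed

text \<open>The bound \<open>\<phi>\<close> on the weak derivatives is the same for all \<open>T\<close>, so the estimate for \<open>G (f x, T)\<close> holds for all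
\<open>T\<close> of a countable dense set simultaneously, hence for \<open>G (f (x + w), f x)\<close>.\<close>

lemma W12_difference_bound:
  fixes f :: "real^'n \<Rightarrow> (real^'m) multiset" and g :: "nat \<Rightarrow> real^'n \<Rightarrow> real^'m"
  assumes f: "f \<in> W12 Q (ball 0 1)" and g [measurable]: "\<And>i. g i \<in> borel_measurable borel"
    and fg: "AE x in lborel. x \<in> ball 0 1 \<longrightarrow> f x = Qpoint Q (\<lambda>i. g i x)"
  obtains \<Phi> where "\<Phi> \<in> borel_measurable borel" "\<And>x. 0 \<le> \<Phi> x" "(\<integral>\<^sup>+x. ennreal ((\<Phi> x)\<^sup>2) \<partial>lborel) < \<infinity>"
    "\<And>w \<rho>. 0 < \<rho> \<Longrightarrow> \<rho> + norm w < 1 \<Longrightarrow> AE x in lborel. norm x < \<rho> \<longrightarrow>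
      ennreal (tdist Q (\<lambda>i. g i (x + w)) (\<lambda>i. g i x)) \<le>
        segment_integral \<Phi> x w"
proof -
  let ?B = "ball (0::real^'n) 1"
  have "\<exists>\<phi>. (\<forall>j. L2 ?B (\<phi> j)) \<and> (\<forall>T\<in>AQ Q. W12_loc ?B (\<lambda>x. Gdist Q (f x) T) \<and>
      (\<forall>j h. weak_partial ?B j (\<lambda>x. Gdist Q (f x) T) h \<longrightarrow> (AE x in lebesgue_on ?B. \<bar>h x\<bar> \<le> \<phi> j x)))"
    using f[unfolded W12_def, THEN CollectD, THEN conjunct2, THEN conjunct2] .
  then obtain \<phi> where \<phi>: "\<forall>j. L2 ?B (\<phi> j)"
    and T: "\<forall>T\<in>AQ Q. W12_loc ?B (\<lambda>x. Gdist Q (f x) T) \<and>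
      (\<forall>j h. weak_partial ?B j (\<lambda>x. Gdist Q (f x) T) h \<longrightarrow> (AE x in lebesgue_on ?B. \<bar>h x\<bar> \<le> \<phi> j x))"
    by (elim exE conjE) (rule that)
  note w12 = T[rule_format, THEN conjunct1] and le = T[rule_format, THEN conjunct2, rule_format]
  have "\<exists>F. F \<in> borel_measurable borel \<and> (AE x in lborel. x \<in> ?B \<longrightarrow> \<phi> j x = F x) \<and> (\<forall>x. x \<notin> ?B \<longrightarrow> F x = 0)" for j
  proof -
    have "\<phi> j \<in> borel_measurable (lebesgue_on ?B)" using \<phi> by (simp add: L2_def)
    then show ?thesis
      by (rule borel_representative[OF borel_open[OF open_ball]]) blast
  qed
  then have "\<forall>j. \<exists>F. F \<in> borel_measurable borel \<and> (AE x in lborel. x \<in> ?B \<longrightarrow> \<phi> j x = F x) \<and> (\<forall>x. x \<notin> ?B \<longrightarrow> F x = 0)"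
    by blast
  from choice[OF this] obtain \<phi>' where \<phi>' [measurable]: "\<And>j. \<phi>' j \<in> borel_measurable borel"
    and ae: "\<And>j. AE x in lborel. x \<in> ?B \<longrightarrow> \<phi> j x = \<phi>' j x" and out: "\<And>j x. x \<notin> ?B \<Longrightarrow> \<phi>' j x = 0"
    by blast
  define \<Phi> where "\<Phi> x = (\<Sum>j\<in>UNIV. \<bar>\<phi>' j x\<bar>)" for x
  have \<Phi>m [measurable]: "\<Phi> \<in> borel_measurable borel" unfolding \<Phi>_def[abs_def] by measurable
  show thesis
  proof (rule that[OF \<Phi>m])
    show "0 \<le> \<Phi> x" for x by (simp add: \<Phi>_def sum_nonneg)
    have int: "integrable lborel (\<lambda>x. (\<phi>' j x)\<^sup>2)" for j
    proof -
      have "integrable lborel (\<lambda>x. indicat_real ?B x * (\<phi>' j x)\<^sup>2)"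
      proof (subst lebesgue_on_integrable_borel[symmetric, where F = "\<lambda>x. (\<phi> j x)\<^sup>2"])
        show "AE x in lborel. x \<in> ?B \<longrightarrow> (\<phi> j x)\<^sup>2 = (\<phi>' j x)\<^sup>2"
          using ae[of j] by eventually_elim simp
        show "integrable (lebesgue_on ?B) (\<lambda>x. (\<phi> j x)\<^sup>2)" using \<phi> by (simp add: L2_def)
      qed simp_all
      moreover have "(\<lambda>x. indicat_real ?B x * (\<phi>' j x)\<^sup>2) = (\<lambda>x. (\<phi>' j x)\<^sup>2)"
        using out[of _ j] by (intro ext) (auto simp: indicator_def)
      ultimately show ?thesis by simp
    qed
    have "integrable lborel (\<lambda>x. (\<Phi> x)\<^sup>2)"
    proof (rule Bochner_Integration.integrable_bound)
      show "integrable lborel (\<lambda>x. real CARD('n) * (\<Sum>j\<in>UNIV. (\<phi>' j x)\<^sup>2))"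
        by (intro integrable_mult_right Bochner_Integration.integrable_sum int)
      show "AE x in lborel. norm ((\<Phi> x)\<^sup>2) \<le> norm (real CARD('n) * (\<Sum>j\<in>UNIV. (\<phi>' j x)\<^sup>2))" (is "AE x in _. ?P x")
      proof (rule AE_I2)
        fix x
        show "?P x"
          using sum_squared_le_sum_of_squares[of "\<lambda>j. \<bar>\<phi>' j x\<bar>" "UNIV :: 'n set"]
          by (simp add: \<Phi>_def sum_nonneg mult.commute)
      qed
    qed measurable
    then show "(\<integral>\<^sup>+x. ennreal ((\<Phi> x)\<^sup>2) \<partial>lborel) < \<infinity>"
      by (simp add: integrable_iff_bounded)
    fix w :: "real^'n" and \<rho> :: real
    assume \<rho>: "0 < \<rho>" "\<rho> + norm w < 1"
    obtain \<T> :: "(nat \<Rightarrow> real^'m) set" where \<T>: "countable \<T>" "\<And>P e. 0 < e \<Longrightarrow> \<exists>R\<in>\<T>. tdist Q P R < e"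
      using countable_dense_AQ by blast
    have "AE x in lborel. \<forall>R\<in>\<T>. norm x < \<rho> \<longrightarrow>
      ennreal \<bar>tdist Q (\<lambda>i. g i (x + w)) R - tdist Q (\<lambda>i. g i x) R\<bar> \<le>
        segment_integral \<Phi> x w"
      unfolding AE_ball_countable[OF \<T>(1)]
    proof
      fix R :: "nat \<Rightarrow> real^'m"
      let ?U = "\<lambda>x. Gdist Q (f x) (Qpoint Q R)"
      have "\<exists>h. weak_partial ?B j ?U h" for j
        using w12[OF Qpoint_in_AQ, of R] unfolding W12_loc_def by blast
      then have "\<forall>j. \<exists>h. weak_partial ?B j ?U h" by blast
      from choice[OF this] obtain h where h: "\<And>j. weak_partial ?B j ?U (h j)" by blast
      show "AE x in lborel. norm x < \<rho> \<longrightarrow>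
        ennreal \<bar>tdist Q (\<lambda>i. g i (x + w)) R - tdist Q (\<lambda>i. g i x) R\<bar> \<le>
        segment_integral \<Phi> x w"
        unfolding \<Phi>_def
      proof (rule weak_partial_difference_bound[OF h _ _ _ _ \<rho>])
        show "(\<lambda>x. tdist Q (\<lambda>i. g i x) R) \<in> borel_measurable borel" by measurable
        show "AE x in lborel. x \<in> ?B \<longrightarrow> ?U x = tdist Q (\<lambda>i. g i x) R"
          using fg by eventually_elim auto
        show "AE x in lborel. x \<in> ?B \<longrightarrow> \<bar>h j x\<bar> \<le> \<phi>' j x" for j
          using le[OF Qpoint_in_AQ h, of j] ae[of j] unfolding lebesgue_on_AE_iff[OF borel_open[OF open_ball]]
          by eventually_elim auto
      qed measurable
    qed
    then show "AE x in lborel. norm x < \<rho> \<longrightarrow>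
      ennreal (tdist Q (\<lambda>i. g i (x + w)) (\<lambda>i. g i x)) \<le>
        segment_integral \<Phi> x w"
    proof eventually_elim
      case (elim x)
      then show ?case
        using Gdist_le_if_all_Gdist_diff_le[of \<T> Q "\<lambda>i. g i x" "\<lambda>i. g i (x + w)", OF \<T>(2)] by blast
    qed
  qed
qed

section \<open>Blowing up at almost every point\<close>

lemma matrix_vector_mult_borel [measurable (raw)]:
  fixes A :: "'i \<Rightarrow> real^'n^'m" and v :: "'i \<Rightarrow> real^'n"
  assumes "A \<in> borel_measurable M" "v \<in> borel_measurable M"
  shows "(\<lambda>x. A x *v v x) \<in> borel_measurable M"
proof (rule borel_measurable_continuous_Pair[OF assms])
  show "continuous_on UNIV (\<lambda>p::(real^'n^'m) \<times> (real^'n). fst p *v snd p)"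
    unfolding matrix_vector_mult_def by (intro continuous_on_vec_lambda continuous_intros)
qed

lemma tdist_self [simp]: "tdist Q P P = 0"
  by (simp add: Gdist_eq_0_iff Qpoint_in_AQ)

abbreviation affine_within ::
    "nat \<Rightarrow> (nat \<Rightarrow> real^'n \<Rightarrow> real^'m) \<Rightarrow> (nat \<Rightarrow> real^'n \<Rightarrow> real^'n^'m) \<Rightarrow> real^'n \<Rightarrow> (real^'n) set \<Rightarrow> bool"
  where "affine_within Q g D x E \<equiv> ((\<lambda>y. tdist Q (\<lambda>i. g i y) (\<lambda>i. g i x + D i x *v (y - x)) / norm (y - x)) \<longlongrightarrow> 0) (at x within E)"

text \<open>The data of a Sobolev \<open>Q\<close>-valued map on the unit ball in Borel form: a selection \<open>g\<close>, extended by 0, an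
approximate differential \<open>D\<close> paired with it, and a square integrable function \<open>\<Phi>\<close> whose integrals over
segments control the differences of the map.\<close>

locale Sobolev_tuple =
  fixes Q :: nat and g :: "nat \<Rightarrow> real^'n \<Rightarrow> real^'m" and D :: "nat \<Rightarrow> real^'n \<Rightarrow> real^'n^'m"
    and \<Phi> :: "real^'n \<Rightarrow> real"
  assumes g_borel [measurable]: "\<And>i. g i \<in> borel_measurable borel"
    and D_borel [measurable]: "\<And>i. D i \<in> borel_measurable borel"
    and g_outside: "\<And>i x. 1 \<le> norm x \<Longrightarrow> g i x = 0"
    and g_L2: "integrable lborel (\<lambda>x. (tnorm Q (\<lambda>i. g i x))\<^sup>2)"
    and \<Phi>_borel [measurable]: "\<Phi> \<in> borel_measurable borel"
    and \<Phi>_nonneg: "\<And>x. 0 \<le> \<Phi> x"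
    and \<Phi>_L2: "(\<integral>\<^sup>+x. ennreal ((\<Phi> x)\<^sup>2) \<partial>lborel) < \<infinity>"
    and difference_bound: "\<And>w \<rho>. 0 < \<rho> \<Longrightarrow> \<rho> + norm w < 1 \<Longrightarrow> AE x in lborel. norm x < \<rho> \<longrightarrow>
      ennreal (tdist Q (\<lambda>i. g i (x + w)) (\<lambda>i. g i x)) \<le>
        segment_integral \<Phi> x w"
    and approx_affine: "AE x in lborel. norm x < 1 \<longrightarrow> (\<exists>E. E \<in> sets borel \<and> density_one E x \<and>
      affine_within Q g D x E)"
begin

text \<open>The rescaled distance between the map and its affine approximation at \<open>x\<close>, seen at scale \<open>t\<close> in the
direction \<open>v\<close>.\<close>

definition blow :: "real \<Rightarrow> real^'n \<Rightarrow> real^'n \<Rightarrow> real"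
  where "blow t x v = tdist Q (\<lambda>i. g i (x + t *\<^sub>R v)) (\<lambda>i. g i x + D i x *v (t *\<^sub>R v)) / t"

definition quot :: "real \<Rightarrow> real^'n \<Rightarrow> real^'n \<Rightarrow> real"
  where "quot t x v = tdist Q (\<lambda>i. g i (x + t *\<^sub>R v)) (\<lambda>i. g i x) / t"

lemma blow_borel [measurable (raw)]:
  assumes [measurable]: "a \<in> borel_measurable M" "b \<in> borel_measurable M"
  shows "(\<lambda>z. blow t (a z) (b z)) \<in> borel_measurable M"
  unfolding blow_def by measurable

lemma quot_borel [measurable (raw)]:
  assumes [measurable]: "a \<in> borel_measurable M" "b \<in> borel_measurable M"
  shows "(\<lambda>z. quot t (a z) (b z)) \<in> borel_measurable M"
  unfolding quot_def by measurable

lemma blow_nonneg: "0 < t \<Longrightarrow> 0 \<le> blow t x v"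
  by (simp add: blow_def Gdist_nonneg)

text \<open>Wherever \<open>x + t v\<close> lies in the set \<open>E\<close> of density one, the error is at most \<open>\<epsilon>\<close>; the exceptional
directions \<open>v\<close> form a rescaled copy of \<open>ball x t - E\<close>, whose relative measure tends to 0.\<close>

lemma blowup_in_measure:
  assumes E: "E \<in> sets borel" "density_one E x"
    and lim: "affine_within Q g D x E"
    and t: "\<And>k. 0 < t k" "t \<longlonglongrightarrow> 0"
  shows "(\<lambda>k. LBINT v. indicat_real (ball 0 1) v * min 1 (blow (t k) x v)) \<longlonglongrightarrow> 0"
proof (rule LIMSEQ_I)
  fix e :: real assume e: "0 < e"
  define b where "b = measure lborel (ball (0::real^'n) 1)"
  have b: "0 < b" unfolding b_def using content_ball_pos[of 1 "0::real^'n"] by simp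
  define \<epsilon> where "\<epsilon> = e / (4 * b)"
  have \<epsilon>: "0 < \<epsilon>" using e b by (simp add: \<epsilon>_def)
  obtain d1 where d1: "0 < d1" and d1': "\<forall>y\<in>E. y \<noteq> x \<and> dist y x < d1 \<longrightarrow>
      dist (tdist Q (\<lambda>i. g i y) (\<lambda>i. g i x + D i x *v (y - x)) / norm (y - x)) 0 < \<epsilon>"
    using tendstoD[OF lim \<epsilon>] unfolding eventually_at by blast
  have d1'': "\<And>y. y \<in> E \<Longrightarrow> y \<noteq> x \<Longrightarrow> dist y x < d1 \<Longrightarrow>
      tdist Q (\<lambda>i. g i y) (\<lambda>i. g i x + D i x *v (y - x)) / norm (y - x) < \<epsilon>"
    using d1' abs_ge_self by (fastforce simp: dist_real_def simp del: abs_divide)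
  have "((\<lambda>r. measure lebesgue (E \<inter> ball x r) / measure lebesgue (ball x r)) \<longlongrightarrow> 1) (at_right 0)"
    using E(2) by (simp add: density_one_def)
  from tendstoD[OF this \<epsilon>] obtain d2 where d2: "0 < d2" "\<And>r. 0 < r \<Longrightarrow> r < d2 \<Longrightarrow>
      \<bar>measure lebesgue (E \<inter> ball x r) / measure lebesgue (ball x r) - 1\<bar> < \<epsilon>"
    unfolding eventually_at_right_field dist_real_def by auto
  have "\<forall>\<^sub>F k in sequentially. t k < min d1 d2"
    using order_tendstoD(2)[OF t(2), of "min d1 d2"] d1 d2(1) by simp
  then obtain N where N: "\<And>k. N \<le> k \<Longrightarrow> t k < min d1 d2"
    by (auto simp: eventually_sequentially)
  show "\<exists>N. \<forall>k\<ge>N. norm ((LBINT v. indicat_real (ball 0 1) v * min 1 (blow (t k) x v)) - 0) < e"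
  proof (intro exI allI impI)
    fix k assume "N \<le> k"
    define r where "r = t k"
    have r: "0 < r" "r < d1" "r < d2" using N[OF \<open>N \<le> k\<close>] t(1)[of k] by (auto simp: r_def)
    define A where "A = {v \<in> ball 0 1. x + r *\<^sub>R v \<notin> E}"
    have A [measurable]: "A \<in> sets borel"
      unfolding A_def using E(1) by measurable
    have im: "(\<lambda>v. r *\<^sub>R v + x) ` A = ball x r - E"
    proof (intro equalityI subsetI)
      fix y assume y: "y \<in> ball x r - E"
      have "y = r *\<^sub>R ((1 / r) *\<^sub>R (y - x)) + x" using r(1) by simp
      moreover have "norm ((1 / r) *\<^sub>R (y - x)) < 1"
        using y r(1) by (simp add: dist_norm norm_minus_commute)
      ultimately show "y \<in> (\<lambda>v. r *\<^sub>R v + x) ` A"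
        using y by (intro image_eqI[where x = "(1 / r) *\<^sub>R (y - x)"]) (auto simp: A_def add.commute)
    qed (use r(1) in \<open>auto simp: A_def dist_norm add.commute\<close>)
    have imB: "(\<lambda>v. r *\<^sub>R v + x) ` ball 0 1 = ball x r"
    proof (intro equalityI subsetI)
      fix y assume y: "y \<in> ball x r"
      have "y = r *\<^sub>R ((1 / r) *\<^sub>R (y - x)) + x" using r(1) by simp
      moreover have "norm ((1 / r) *\<^sub>R (y - x)) < 1"
        using y r(1) by (simp add: dist_norm norm_minus_commute)
      ultimately show "y \<in> (\<lambda>v. r *\<^sub>R v + x) ` ball 0 1"
        by (intro image_eqI[where x = "(1 / r) *\<^sub>R (y - x)"]) auto
    qed (use r(1) in \<open>auto simp: dist_norm\<close>)
    define c where "c = r ^ CARD('n)"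
    have c: "0 < c" using r(1) by (simp add: c_def)
    have affine: "measure lebesgue ((\<lambda>v. r *\<^sub>R v + x) ` S) = c * measure lebesgue S" for S :: "(real^'n) set"
      using emeasure_lebesgue_affine[of r x S] r(1) by (simp add: measure_def c_def enn2real_mult)
    have mb: "measure lebesgue (ball x r) = c * b"
      using affine[of "ball 0 1"] imB by (simp add: b_def)
    have "ball x r - E = ball x r - (E \<inter> ball x r)" by auto
    then have "measure lebesgue (ball x r - E) = measure lebesgue (ball x r) - measure lebesgue (E \<inter> ball x r)"
      using E(1) by (simp only:) (rule measurable_measure_Diff, auto)
    also have "\<dots> \<le> \<epsilon> * (c * b)"
    proof -
      have "1 - \<epsilon> \<le> measure lebesgue (E \<inter> ball x r) / measure lebesgue (ball x r)"
        using d2(2)[OF r(1,3)] by linarith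
      then have "(1 - \<epsilon>) * (c * b) \<le> measure lebesgue (E \<inter> ball x r)"
        using c b unfolding mb by (simp add: pos_le_divide_eq)
      then show ?thesis unfolding mb by (simp add: algebra_simps)
    qed
    finally have "c * measure lebesgue A \<le> c * (\<epsilon> * b)"
      using affine[of A] im by (simp add: mult_ac)
    then have mA: "measure lborel A \<le> \<epsilon> * b" using c by simp
    have fin: "emeasure lborel (ball (0::real^'n) 1) < \<infinity>" "emeasure lborel A < \<infinity>"
    proof -
      show 1: "emeasure lborel (ball (0::real^'n) 1) < \<infinity>" using emeasure_lborel_ball_finite by auto
      have "emeasure lborel A \<le> emeasure lborel (ball (0::real^'n) 1)"
        by (rule emeasure_mono) (auto simp: A_def)
      then show "emeasure lborel A < \<infinity>" using 1 by (rule le_less_trans)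
    qed
    have pt: "indicat_real (ball 0 1) v * min 1 (blow r x v) \<le> \<epsilon> * indicat_real (ball 0 1) v + indicat_real A v" for v
    proof (cases "v \<in> ball 0 1 \<and> v \<notin> A")
      case True
      then have y: "x + r *\<^sub>R v \<in> E" "norm v < 1" by (auto simp: A_def)
      have "blow r x v \<le> \<epsilon>"
      proof (cases "v = 0")
        case True then show ?thesis using \<epsilon> by (simp add: blow_def)
      next
        case False
        have "r * norm v < d1" using r y(2) mult_strict_mono[of r d1 "norm v" 1] by simp
        then have "tdist Q (\<lambda>i. g i (x + r *\<^sub>R v)) (\<lambda>i. g i x + D i x *v (r *\<^sub>R v)) / (r * norm v) < \<epsilon>"
          using d1''[OF y(1)] False r(1) by (simp add: dist_norm)
        then have "tdist Q (\<lambda>i. g i (x + r *\<^sub>R v)) (\<lambda>i. g i x + D i x *v (r *\<^sub>R v)) < \<epsilon> * (r * norm v)"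
          using False r(1) by (simp add: pos_divide_less_eq)
        also have "\<dots> \<le> \<epsilon> * (r * 1)" using \<epsilon> r(1) y(2) by (intro mult_left_mono) auto
        finally show ?thesis using r(1) by (simp add: blow_def pos_divide_le_eq)
      qed
      then show ?thesis using True by (simp add: min.coboundedI2)
    next
      case False
      show ?thesis
      proof (cases "v \<in> A")
        case True
        have "indicat_real (ball 0 1) v * min 1 (blow r x v) \<le> 1 * 1"
          using blow_nonneg[OF r(1), of x v] by (intro mult_mono) (auto simp: indicator_def)
        then show ?thesis using True \<epsilon> by (simp add: add_increasing)
      next
        case F: False
        with False have "v \<notin> ball 0 1" by blast
        then show ?thesis by simp
      qed
    qed
    have nn: "0 \<le> indicat_real (ball 0 1) v * min 1 (blow r x v)" for v
      using blow_nonneg[OF r(1), of x v] by simp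
    have i1: "integrable lborel (\<lambda>v. \<epsilon> * indicat_real (ball (0::real^'n) 1) v + indicat_real A v)"
      using fin by (intro Bochner_Integration.integrable_add integrable_mult_right integrable_real_indicator) auto
    have i2: "integrable lborel (\<lambda>v. indicat_real (ball 0 1) v * min 1 (blow r x v))"
    proof (rule Bochner_Integration.integrable_bound[OF i1])
      have [measurable]: "ball (0::real^'n) 1 \<in> sets borel" by simp
      show "(\<lambda>v. indicat_real (ball 0 1) v * min 1 (blow r x v)) \<in> borel_measurable lborel"
        by measurable
      show "AE v in lborel. norm (indicat_real (ball 0 1) v * min 1 (blow r x v))
          \<le> norm (\<epsilon> * indicat_real (ball 0 1) v + indicat_real A v)" (is "AE x in _. ?P x")
      proof (rule AE_I2)
        fix v
        show "?P v"
          using order_trans[OF pt[of v] abs_ge_self]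
          unfolding real_norm_def abs_of_nonneg[OF nn[of v]] .
      qed
    qed
    have "(LBINT v. indicat_real (ball 0 1) v * min 1 (blow r x v)) \<le> (LBINT v. \<epsilon> * indicat_real (ball (0::real^'n) 1) v + indicat_real A v)"
      by (rule integral_mono[OF i2 i1 pt])
    also have "\<dots> = \<epsilon> * b + measure lborel A"
      using fin by (simp add: b_def)
    also have "\<dots> \<le> \<epsilon> * b + \<epsilon> * b" using mA by simp
    also have "\<dots> < e" using b e by (simp add: \<epsilon>_def)
    finally have "(LBINT v. indicat_real (ball 0 1) v * min 1 (blow r x v)) < e" .
    moreover have "0 \<le> (LBINT v. indicat_real (ball 0 1) v * min 1 (blow r x v))"
      by (rule integral_nonneg_AE) (use nn in auto)
    ultimately show "norm ((LBINT v. indicat_real (ball 0 1) v * min 1 (blow (t k) x v)) - 0) < e"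
      by (simp add: r_def)
  qed
qed

text \<open>Convergence in measure in \<open>v\<close> for almost every \<open>x\<close> gives, by dominated convergence, convergence in \<open>L\<^sup>1\<close> of
the truncated errors over the product of two balls, hence almost everywhere convergence along a
subsequence. The bound \<open>1 - \<rho>\<close> keeps \<open>x + t v\<close> inside the unit ball when \<open>norm x < \<rho>\<close>.\<close>

lemma blowup_sequence:
  assumes \<rho>: "\<rho> < 1"
  shows "\<exists>t. (\<forall>k. 0 < t k \<and> t k < 1 - \<rho>) \<and> t \<longlonglongrightarrow> 0 \<and>
    (AE z in lborel \<Otimes>\<^sub>M lborel. norm (fst z) < 1 \<longrightarrow> norm (snd z) < 1 \<longrightarrow>
      (\<lambda>k. blow (t k) (fst z) (snd z)) \<longlonglongrightarrow> 0)"
proof -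
  let ?B = "ball (0::real^'n) 1"
  let ?I = "indicat_real ?B"
  define s where "s k = (1 - \<rho>) * (1 / (real (Suc (Suc k))))" for k
  have s: "0 < s k" "s k < 1 - \<rho>" for k
    using \<rho> mult_strict_left_mono[of "1 / real (Suc (Suc k))" 1 "1 - \<rho>"] by (auto simp: s_def)
  have "(\<lambda>k. 1 / real (Suc (Suc k))) \<longlonglongrightarrow> 0"
    using LIMSEQ_ignore_initial_segment[OF lim_1_over_n, of 2] by (simp add: eval_nat_numeral)
  from tendsto_mult_left[OF this, of "1 - \<rho>"] have s0: "s \<longlonglongrightarrow> 0" by (simp add: s_def[abs_def])
  have fin: "emeasure lborel ?B < \<infinity>" using emeasure_lborel_ball_finite by auto
  have [measurable]: "?B \<in> sets borel" by simp
  have iB: "integrable lborel ?I" using fin by (intro integrable_real_indicator) auto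
  define u where "u k z = ?I (fst z) * (?I (snd z) * min 1 (blow (s k) (fst z) (snd z)))" for k z
  have u_nn: "0 \<le> u k z" for k z
    using blow_nonneg[OF s(1), of k] by (simp add: u_def)
  have [measurable]: "u k \<in> borel_measurable (lborel \<Otimes>\<^sub>M lborel)" for k
    unfolding u_def[abs_def] by measurable
  have iBB: "integrable (lborel \<Otimes>\<^sub>M lborel) (\<lambda>z. ?I (fst z) * ?I (snd z))"
    using iB by (intro lborel_pair.Fubini_integrable) auto
  have iu: "integrable (lborel \<Otimes>\<^sub>M lborel) (u k)" for k
    by (rule Bochner_Integration.integrable_bound[OF iBB])
      (use blow_nonneg[OF s(1), of k] in \<open>auto simp: u_def abs_mult intro!: AE_I2 mult_left_mono mult_left_le\<close>)
  have inner: "(LBINT v. u k (x, v)) = ?I x * (LBINT v. ?I v * min 1 (blow (s k) x v))" for k x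
    by (simp add: u_def)
  have "(\<lambda>k. LBINT x. LBINT v. u k (x, v)) \<longlonglongrightarrow> (LBINT x::real^'n. 0)"
  proof (rule integral_dominated_convergence[where w = "\<lambda>x. ?I x * measure lborel ?B"])
    show "integrable lborel (\<lambda>x. ?I x * measure lborel ?B)" using iB by simp
    show "AE x in lborel. (\<lambda>k. LBINT v. u k (x, v)) \<longlonglongrightarrow> 0"
      using approx_affine
    proof eventually_elim
      case (elim x)
      show ?case
      proof (cases "norm x < 1")
        case True
        with elim obtain E where "E \<in> sets borel" "density_one E x"
          "affine_within Q g D x E"
          by blast
        from blowup_in_measure[OF this s(1) s0] True show ?thesis
          unfolding inner by simp
      qed (simp add: inner)
    qed
    show "AE x in lborel. norm (LBINT v. u k (x, v)) \<le> ?I x * measure lborel ?B" (is "AE x in _. ?P x") for k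
    proof (rule AE_I2)
      fix x
      have "0 \<le> (LBINT v. ?I v * min 1 (blow (s k) x v))"
        by (rule integral_nonneg_AE) (use blow_nonneg[OF s(1), of k] in auto)
      moreover have "(LBINT v. ?I v * min 1 (blow (s k) x v)) \<le> (LBINT v. ?I v)"
        using iB blow_nonneg[OF s(1), of k x]
        by (intro integral_mono Bochner_Integration.integrable_bound[OF iB]) (auto simp: abs_mult intro!: mult_left_le)
      ultimately show "?P x"
        using fin by (simp add: inner abs_mult mult_left_mono)
    qed
  qed auto
  moreover have "(LBINT x. LBINT v. u k (x, v)) = (\<integral>z. norm (u k z) \<partial>(lborel \<Otimes>\<^sub>M lborel))" for k
    using lborel_pair.integral_fst'[OF iu, of k] u_nn by simp
  ultimately have "(\<lambda>k. \<integral>z. norm (u k z) \<partial>(lborel \<Otimes>\<^sub>M lborel)) \<longlonglongrightarrow> 0" by simp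
  from tendsto_L1_AE_subseq[OF iu this] obtain r where r: "strict_mono r"
    and ae: "AE z in lborel \<Otimes>\<^sub>M lborel. (\<lambda>k. u (r k) z) \<longlonglongrightarrow> 0" by blast
  show ?thesis
  proof (intro exI conjI allI)
    show "0 < (s \<circ> r) k" "(s \<circ> r) k < 1 - \<rho>" for k using s by auto
    show "(s \<circ> r) \<longlonglongrightarrow> 0" by (rule LIMSEQ_subseq_LIMSEQ[OF s0 r])
    show "AE z in lborel \<Otimes>\<^sub>M lborel. norm (fst z) < 1 \<longrightarrow> norm (snd z) < 1 \<longrightarrow>
        (\<lambda>k. blow ((s \<circ> r) k) (fst z) (snd z)) \<longlonglongrightarrow> 0"
      using ae
    proof eventually_elim
      case (elim z)
      show ?case
      proof (intro impI)
        assume "norm (fst z) < 1" "norm (snd z) < 1"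
        then have m: "(\<lambda>k. min 1 (blow (s (r k)) (fst z) (snd z))) \<longlonglongrightarrow> 0" using elim by (simp add: u_def)
        have "\<forall>\<^sub>F k in sequentially. min 1 (blow (s (r k)) (fst z) (snd z)) < 1"
          by (rule order_tendstoD(2)[OF m]) simp
        then have "\<forall>\<^sub>F k in sequentially. min 1 (blow (s (r k)) (fst z) (snd z)) = blow (s (r k)) (fst z) (snd z)"
          by eventually_elim (simp add: min_def split: if_splits)
        then show "(\<lambda>k. blow ((s \<circ> r) k) (fst z) (snd z)) \<longlonglongrightarrow> 0"
          using m by (simp add: filterlim_cong[OF refl refl])
      qed
    qed
  qed
qed

text \<open>By the Cauchy-Schwarz inequality on the segment and translation invariance, the estimate for the
difference quotients does not depend on the scale \<open>t\<close>.\<close>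

lemma quot_L2_bound:
  assumes \<rho>: "0 < \<rho>" and t: "0 < t" "t < 1 - \<rho>"
  shows "(\<integral>\<^sup>+z. indicator (ball 0 \<rho> \<times> ball 0 1) z * ennreal ((quot t (fst z) (snd z))\<^sup>2) \<partial>(lborel \<Otimes>\<^sub>M lborel))
    \<le> emeasure lborel (ball (0::real^'n) 1) * (\<integral>\<^sup>+x. ennreal ((\<Phi> x)\<^sup>2) \<partial>lborel)"
proof -
  let ?J = "\<lambda>s. indicator {0..1::real} s :: ennreal"
  have [measurable]: "ball (0::real^'n) r \<in> sets borel" for r by simp
  define c where "c = (\<integral>\<^sup>+x. ennreal ((\<Phi> x)\<^sup>2) \<partial>lborel)"
  have one: "(\<integral>\<^sup>+x. indicator (ball 0 \<rho>) x * ennreal ((quot t x v)\<^sup>2) \<partial>lborel) \<le> c" if v: "norm v < 1" for v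
  proof -
    define w where "w = t *\<^sub>R v"
    have "norm w = t * norm v" using t(1) by (simp add: w_def)
    then have w: "norm w \<le> t" "\<rho> + norm w < 1"
      using t v mult_left_le[of "norm v" t] by linarith+
    define K where "K x = (\<integral>\<^sup>+s. ?J s * ennreal (\<Phi> (x + s *\<^sub>R w)) \<partial>lborel)" for x
    have sq: "(K x)\<^sup>2 \<le> (\<integral>\<^sup>+s. ?J s * ennreal ((\<Phi> (x + s *\<^sub>R w))\<^sup>2) \<partial>lborel)" for x
    proof -
      have "K x = (\<integral>\<^sup>+s. ?J s * (?J s * ennreal (\<Phi> (x + s *\<^sub>R w))) \<partial>lborel)"
        unfolding K_def by (intro nn_integral_cong) (auto simp: indicator_def)
      then have "(K x)\<^sup>2 \<le> (\<integral>\<^sup>+s. (?J s)\<^sup>2 \<partial>lborel) * (\<integral>\<^sup>+s. (?J s * ennreal (\<Phi> (x + s *\<^sub>R w)))\<^sup>2 \<partial>lborel)"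
        by (simp only:) (rule Cauchy_Schwarz_nn_integral, measurable)
      also have "(\<integral>\<^sup>+s. (?J s)\<^sup>2 \<partial>lborel) = (\<integral>\<^sup>+s. ?J s \<partial>lborel)"
        by (intro nn_integral_cong) (auto simp: indicator_def)
      also have "\<dots> = 1" by simp
      also have "(\<integral>\<^sup>+s. (?J s * ennreal (\<Phi> (x + s *\<^sub>R w)))\<^sup>2 \<partial>lborel) = (\<integral>\<^sup>+s. ?J s * ennreal ((\<Phi> (x + s *\<^sub>R w))\<^sup>2) \<partial>lborel)"
        using \<Phi>_nonneg by (intro nn_integral_cong) (auto simp: indicator_def ennreal_power)
      finally show ?thesis by simp
    qed
    have "AE x in lborel. indicator (ball 0 \<rho>) x * ennreal ((quot t x v)\<^sup>2) \<le> (K x)\<^sup>2"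
      using difference_bound[OF \<rho> w(2)]
    proof eventually_elim
      case (elim x)
      show ?case
      proof (cases "norm x < \<rho>")
        case True
        have "ennreal (tdist Q (\<lambda>i. g i (x + w)) (\<lambda>i. g i x)) \<le> (\<integral>\<^sup>+s. ?J s * ennreal (norm w * \<Phi> (x + s *\<^sub>R w)) \<partial>lborel)"
          using elim True by blast
        also have "\<dots> \<le> (\<integral>\<^sup>+s. ennreal t * (?J s * ennreal (\<Phi> (x + s *\<^sub>R w))) \<partial>lborel)"
          using w(1) \<Phi>_nonneg t(1)
          by (intro nn_integral_mono) (auto simp: indicator_def ennreal_mult[symmetric] intro!: ennreal_leI mult_right_mono)
        also have "\<dots> = ennreal t * K x"
          unfolding K_def by (rule nn_integral_cmult) measurable
        finally have le: "ennreal (tdist Q (\<lambda>i. g i (x + w)) (\<lambda>i. g i x)) \<le> ennreal t * K x" .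
        have "ennreal (quot t x v) \<le> K x"
        proof (cases "K x")
          case (real r)
          then have "tdist Q (\<lambda>i. g i (x + w)) (\<lambda>i. g i x) \<le> t * r"
            using le t(1) by (simp add: ennreal_mult[symmetric])
          then show ?thesis using real t(1) by (simp add: quot_def w_def[symmetric] pos_divide_le_eq mult.commute ennreal_leI)
        qed simp
        then have "(ennreal (quot t x v))\<^sup>2 \<le> (K x)\<^sup>2" by (rule power_mono) simp
        then show ?thesis using True t(1) by (simp add: ennreal_power quot_def Gdist_nonneg)
      qed simp
    qed
    then have "(\<integral>\<^sup>+x. indicator (ball 0 \<rho>) x * ennreal ((quot t x v)\<^sup>2) \<partial>lborel) \<le> (\<integral>\<^sup>+x. (K x)\<^sup>2 \<partial>lborel)"
      by (rule nn_integral_mono_AE)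
    also have "\<dots> \<le> (\<integral>\<^sup>+x. \<integral>\<^sup>+s. ?J s * ennreal ((\<Phi> (x + s *\<^sub>R w))\<^sup>2) \<partial>lborel \<partial>lborel)"
      by (rule nn_integral_mono[OF sq])
    also have "\<dots> = (\<integral>\<^sup>+s. \<integral>\<^sup>+x. ?J s * ennreal ((\<Phi> (x + s *\<^sub>R w))\<^sup>2) \<partial>lborel \<partial>lborel)"
      by (rule lborel_pair.Fubini') measurable
    also have "\<dots> = (\<integral>\<^sup>+s. ?J s * c \<partial>lborel)"
    proof (rule nn_integral_cong)
      fix s :: real
      have "(\<integral>\<^sup>+x. ?J s * ennreal ((\<Phi> (x + s *\<^sub>R w))\<^sup>2) \<partial>lborel) = ?J s * (\<integral>\<^sup>+x. ennreal ((\<Phi> (x + s *\<^sub>R w))\<^sup>2) \<partial>lborel)"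
        by (rule nn_integral_cmult) measurable
      also have "(\<integral>\<^sup>+x. ennreal ((\<Phi> (x + s *\<^sub>R w))\<^sup>2) \<partial>lborel) = c"
        unfolding c_def by (rule nn_integral_lborel_translate) measurable
      finally show "(\<integral>\<^sup>+x. ?J s * ennreal ((\<Phi> (x + s *\<^sub>R w))\<^sup>2) \<partial>lborel) = ?J s * c" .
    qed
    also have "\<dots> = c" by (simp add: nn_integral_multc)
    finally show ?thesis .
  qed
  have "(\<integral>\<^sup>+z. indicator (ball 0 \<rho> \<times> ball 0 1) z * ennreal ((quot t (fst z) (snd z))\<^sup>2) \<partial>(lborel \<Otimes>\<^sub>M lborel))
     = (\<integral>\<^sup>+v. \<integral>\<^sup>+x. indicator (ball 0 \<rho> \<times> ball 0 1) (x, v) * ennreal ((quot t x v)\<^sup>2) \<partial>lborel \<partial>lborel)"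
    by (subst lborel_pair.nn_integral_snd[symmetric]) auto
  also have "\<dots> \<le> (\<integral>\<^sup>+v. indicator (ball (0::real^'n) 1) v * c \<partial>lborel)"
  proof (rule nn_integral_mono)
    fix v :: "real^'n"
    show "(\<integral>\<^sup>+x. indicator (ball 0 \<rho> \<times> ball 0 1) (x, v) * ennreal ((quot t x v)\<^sup>2) \<partial>lborel) \<le> indicator (ball 0 1) v * c"
      using one[of v] by (cases "norm v < 1") (simp_all add: indicator_times)
  qed
  also have "\<dots> = emeasure lborel (ball (0::real^'n) 1) * c" by (subst nn_integral_multc) auto
  finally show ?thesis by (simp add: c_def)
qed

end

section \<open>Square integrability of the differential and the chain rule\<close>

lemma DERIV_sequentially:
  assumes "(h has_real_derivative d) (at 0)" and "\<And>k. 0 < t k" "t \<longlonglongrightarrow> (0::real)"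
  shows "(\<lambda>k. (h (t k) - h 0) / t k) \<longlonglongrightarrow> d"
proof -
  have "((\<lambda>y. (h y - h 0) / (y - 0)) \<longlongrightarrow> d) (at 0)"
    using assms(1) by (simp add: has_field_derivative_iff)
  then have "((\<lambda>y. (h y - h 0) / (y - 0)) \<circ> t) \<longlonglongrightarrow> d"
    unfolding tendsto_at_iff_sequentially using assms(2,3) by (metis Diff_iff UNIV_I less_irrefl singletonD)
  then show ?thesis by (simp add: o_def)
qed

lemma norm_matrix_sq_columns:
  fixes A :: "real^'n^'m"
  shows "(norm A)\<^sup>2 = (\<Sum>j\<in>UNIV. (norm (A *v axis j 1))\<^sup>2)"
proof -
  have "(norm A)\<^sup>2 = (\<Sum>i\<in>UNIV. \<Sum>j\<in>UNIV. A $ i $ j * A $ i $ j)"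
    by (simp add: power2_norm_eq_inner inner_vec_def)
  also have "\<dots> = (\<Sum>j\<in>UNIV. \<Sum>i\<in>UNIV. A $ i $ j * A $ i $ j)"
    by (rule sum.swap)
  also have "\<dots> = (\<Sum>j\<in>UNIV. (norm (A *v axis j 1))\<^sup>2)"
    by (simp add: power2_norm_eq_inner inner_vec_def matrix_vector_mult_basis column_def)
  finally show ?thesis .
qed

lemma tnorm_add_sq_le:
  fixes P R :: "nat \<Rightarrow> 'a::real_normed_vector"
  shows "(tnorm Q (\<lambda>i. P i + R i))\<^sup>2 \<le> 2 * (tnorm Q P)\<^sup>2 + 2 * (tnorm Q R)\<^sup>2"
proof -
  have "(norm (P i + R i))\<^sup>2 \<le> 2 * (norm (P i))\<^sup>2 + 2 * (norm (R i))\<^sup>2" for i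
  proof -
    have "(norm (P i + R i))\<^sup>2 \<le> (norm (P i) + norm (R i))\<^sup>2"
      by (intro power_mono norm_triangle_ineq) simp
    also have "\<dots> \<le> 2 * (norm (P i))\<^sup>2 + 2 * (norm (R i))\<^sup>2"
      using zero_le_power2[of "norm (P i) - norm (R i)"] by (simp add: power2_sum power2_diff)
    finally show ?thesis .
  qed
  then have "(\<Sum>i<Q. (norm (P i + R i))\<^sup>2) \<le> (\<Sum>i<Q. 2 * (norm (P i))\<^sup>2 + 2 * (norm (R i))\<^sup>2)"
    by (rule sum_mono)
  then show ?thesis by (simp add: tnorm_sq sum.distrib sum_distrib_left)
qed

lemma tnorm_scaleR: "tnorm Q (\<lambda>i. c *\<^sub>R P i) = \<bar>c\<bar> * tnorm Q P"
  by (simp add: tnorm_def power_mult_distrib sum_distrib_left[symmetric] real_sqrt_mult)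

context Sobolev_tuple
begin

abbreviation gnorm :: "real^'n \<Rightarrow> real"
  where "gnorm x \<equiv> tnorm Q (\<lambda>i. g i x)"

abbreviation dirichlet :: "real^'n \<Rightarrow> real"
  where "dirichlet x \<equiv> \<Sum>i<Q. (norm (D i x))\<^sup>2"

abbreviation pairing :: "real^'n \<Rightarrow> real^'n \<Rightarrow> real"
  where "pairing x v \<equiv> \<Sum>i<Q. g i x \<bullet> (D i x *v v)"

definition dnorm :: "real^'n \<Rightarrow> real^'n \<Rightarrow> real"
  where "dnorm x v = tnorm Q (\<lambda>i. D i x *v v)"

lemma dnorm_borel [measurable (raw)]:
  assumes [measurable]: "a \<in> borel_measurable M" "b \<in> borel_measurable M"
  shows "(\<lambda>z. dnorm (a z) (b z)) \<in> borel_measurable M"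
  unfolding dnorm_def by measurable

lemma dnorm_nonneg [simp]: "0 \<le> dnorm x v"
  by (simp add: dnorm_def)

lemma matrix_line: "D i x *v (t *\<^sub>R v) = t *\<^sub>R (D i x *v v)"
  by (rule linear_scale[OF matrix_vector_mul_linear])

text \<open>The map is close to its affine approximation, and the distance of the latter to its centre is exactly
\<open>t |Df v|\<close> once \<open>t\<close> is small.\<close>

lemma quot_tendsto:
  assumes t: "\<And>k. 0 < t k" "t \<longlonglongrightarrow> 0" and b: "(\<lambda>k. blow (t k) x v) \<longlonglongrightarrow> 0"
  shows "(\<lambda>k. quot (t k) x v) \<longlonglongrightarrow> dnorm x v"
proof -
  define L where "L i = D i x *v v" for i
  obtain d where d: "0 < d" "\<And>t. 0 < t \<Longrightarrow> t < d \<Longrightarrow> t * tnorm Q L \<le> tdist Q (\<lambda>i. g i x + t *\<^sub>R L i) (\<lambda>i. g i x)"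
    using tdist_line_lower[of Q L "\<lambda>i. g i x"] by blast
  have "\<forall>\<^sub>F k in sequentially. t k < d" using order_tendstoD(2)[OF t(2) d(1)] .
  then have "\<forall>\<^sub>F k in sequentially. norm (quot (t k) x v - dnorm x v) \<le> blow (t k) x v"
  proof eventually_elim
    case (elim k)
    let ?y = "Qpoint Q (\<lambda>i. g i (x + t k *\<^sub>R v))" and ?l = "Qpoint Q (\<lambda>i. g i x + t k *\<^sub>R L i)" and ?x = "Qpoint Q (\<lambda>i. g i x)"
    have "Gdist Q ?l ?x \<le> t k * tnorm Q L"
      using tdist_le_id[of Q "\<lambda>i. g i x + t k *\<^sub>R L i" "\<lambda>i. g i x"] tnorm_scaleR[of Q "t k" L] t(1)[of k]
      by (simp add: tnorm_def)
    with d(2)[OF t(1) elim] have l: "Gdist Q ?l ?x = t k * tnorm Q L" by simp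
    have "\<bar>Gdist Q ?y ?x - Gdist Q ?l ?x\<bar> \<le> Gdist Q ?y ?l"
      using Gdist_triangle[of Q ?y ?x ?l] Gdist_triangle[of Q ?l ?x ?y] Gdist_sym[of Q ?y ?l] by linarith
    then have "\<bar>Gdist Q ?y ?x - t k * tnorm Q L\<bar> / t k \<le> Gdist Q ?y ?l / t k"
      unfolding l using t(1)[of k] by (intro divide_right_mono) auto
    moreover have "\<bar>Gdist Q ?y ?x - t k * tnorm Q L\<bar> / t k = \<bar>Gdist Q ?y ?x / t k - tnorm Q L\<bar>"
    proof -
      have "Gdist Q ?y ?x / t k - tnorm Q L = (Gdist Q ?y ?x - t k * tnorm Q L) / t k"
        using t(1)[of k] by (simp add: diff_divide_distrib)
      then show ?thesis by (simp only: abs_divide abs_of_pos[OF t(1)])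
    qed
    ultimately show ?case
      by (simp add: quot_def blow_def dnorm_def matrix_line L_def[abs_def])
  qed
  then have "(\<lambda>k. quot (t k) x v - dnorm x v) \<longlonglongrightarrow> 0"
    using b by (rule Lim_null_comparison)
  then show ?thesis by (rule LIM_zero_cancel)
qed

text \<open>Fatou's lemma along the sequence of \<open>blowup_sequence\<close>.\<close>

lemma dnorm_L2_bound:
  assumes \<rho>: "0 < \<rho>" "\<rho> < 1"
  shows "(\<integral>\<^sup>+z. indicator (ball 0 \<rho> \<times> ball 0 1) z * ennreal ((dnorm (fst z) (snd z))\<^sup>2) \<partial>(lborel \<Otimes>\<^sub>M lborel))
    \<le> emeasure lborel (ball (0::real^'n) 1) * (\<integral>\<^sup>+x. ennreal ((\<Phi> x)\<^sup>2) \<partial>lborel)"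
    (is "_ \<le> ?C")
proof -
  have [measurable]: "ball (0::real^'n) r \<in> sets borel" for r by simp
  obtain t where t: "\<And>k. 0 < t k" "\<And>k. t k < 1 - \<rho>" "t \<longlonglongrightarrow> 0"
    and ae: "AE z in lborel \<Otimes>\<^sub>M lborel. norm (fst z) < 1 \<longrightarrow> norm (snd z) < 1 \<longrightarrow> (\<lambda>k. blow (t k) (fst z) (snd z)) \<longlonglongrightarrow> 0"
    using blowup_sequence[OF \<rho>(2)] by blast
  define u where "u k z = indicator (ball 0 \<rho> \<times> ball 0 1) z * ennreal ((quot (t k) (fst z) (snd z))\<^sup>2)" for k and z :: "(real^'n) \<times> (real^'n)"
  have [measurable]: "u k \<in> borel_measurable (lborel \<Otimes>\<^sub>M lborel)" for k
    unfolding u_def[abs_def] by measurable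
  have "AE z in lborel \<Otimes>\<^sub>M lborel. indicator (ball 0 \<rho> \<times> ball 0 1) z * ennreal ((dnorm (fst z) (snd z))\<^sup>2) = liminf (\<lambda>k. u k z)"
    using ae
  proof eventually_elim
    case (elim z)
    show ?case
    proof (cases "z \<in> ball 0 \<rho> \<times> ball 0 1")
      case True
      then have "norm (fst z) < 1" "norm (snd z) < 1" using \<rho>(2) by auto
      with elim have "(\<lambda>k. quot (t k) (fst z) (snd z)) \<longlonglongrightarrow> dnorm (fst z) (snd z)"
        using quot_tendsto[OF t(1,3)] by blast
      then have "(\<lambda>k. ennreal ((quot (t k) (fst z) (snd z))\<^sup>2)) \<longlonglongrightarrow> ennreal ((dnorm (fst z) (snd z))\<^sup>2)"
        by (intro tendsto_ennrealI tendsto_power)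
      then show ?thesis using True lim_imp_Liminf[OF sequentially_bot] by (fastforce simp: u_def)
    next
      case False
      then show ?thesis by (simp add: u_def Liminf_const)
    qed
  qed
  then have "(\<integral>\<^sup>+z. indicator (ball 0 \<rho> \<times> ball 0 1) z * ennreal ((dnorm (fst z) (snd z))\<^sup>2) \<partial>(lborel \<Otimes>\<^sub>M lborel))
      = (\<integral>\<^sup>+z. liminf (\<lambda>k. u k z) \<partial>(lborel \<Otimes>\<^sub>M lborel))"
    by (rule nn_integral_cong_AE)
  also have "\<dots> \<le> liminf (\<lambda>k. \<integral>\<^sup>+z. u k z \<partial>(lborel \<Otimes>\<^sub>M lborel))"
    by (rule nn_integral_liminf) measurable
  also have "\<dots> \<le> limsup (\<lambda>k. \<integral>\<^sup>+z. u k z \<partial>(lborel \<Otimes>\<^sub>M lborel))"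
    by (rule Liminf_le_Limsup) simp
  also have "\<dots> \<le> ?C"
    unfolding u_def using quot_L2_bound[OF \<rho>(1) t(1,2)] by (intro Limsup_bounded always_eventually) auto
  finally show ?thesis .
qed

lemma L2_constant_finite: "emeasure lborel (ball (0::real^'n) 1) * (\<integral>\<^sup>+x. ennreal ((\<Phi> x)\<^sup>2) \<partial>lborel) < \<infinity>"
  using \<Phi>_L2 emeasure_lborel_ball_finite[of "0::real^'n" 1] by (simp add: ennreal_mult_less_top)

text \<open>Finiteness of the double integral gives square integrability of \<open>Df v\<close> for almost every direction \<open>v\<close> of
the ball; the directions with this property form a subspace.\<close>

lemma dnorm_L2:
  assumes \<rho>: "0 < \<rho>" "\<rho> < 1"
  shows "integrable lborel (\<lambda>x. indicat_real (ball 0 \<rho>) x * (dnorm x v)\<^sup>2)"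
proof -
  have [measurable]: "ball (0::real^'n) r \<in> sets borel" for r by simp
  define I where "I v = (\<integral>\<^sup>+x. indicator (ball 0 \<rho>) x * ennreal ((dnorm x v)\<^sup>2) \<partial>lborel)" for v
  have [measurable]: "I \<in> borel_measurable borel"
    unfolding I_def[abs_def] by measurable
  have "(\<integral>\<^sup>+v. indicator (ball 0 1) v * I v \<partial>lborel) < \<infinity>"
  proof -
    have "(\<integral>\<^sup>+v. indicator (ball 0 1) v * I v \<partial>lborel)
      = (\<integral>\<^sup>+v. \<integral>\<^sup>+x. indicator (ball 0 \<rho> \<times> ball 0 1) (x, v) * ennreal ((dnorm x v)\<^sup>2) \<partial>lborel \<partial>lborel)"
    proof (rule nn_integral_cong)
      fix v :: "real^'n"
      have "indicator (ball 0 1) v * I v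
          = (\<integral>\<^sup>+x. indicator (ball 0 1) v * (indicator (ball 0 \<rho>) x * ennreal ((dnorm x v)\<^sup>2)) \<partial>lborel)"
        unfolding I_def by (rule nn_integral_cmult[symmetric]) measurable
      also have "\<dots> = (\<integral>\<^sup>+x. indicator (ball 0 \<rho> \<times> ball 0 1) (x, v) * ennreal ((dnorm x v)\<^sup>2) \<partial>lborel)"
        by (intro nn_integral_cong) (simp add: indicator_times mult_ac)
      finally show "indicator (ball 0 1) v * I v
          = (\<integral>\<^sup>+x. indicator (ball 0 \<rho> \<times> ball 0 1) (x, v) * ennreal ((dnorm x v)\<^sup>2) \<partial>lborel)" .
    qed
    also have "\<dots> = (\<integral>\<^sup>+z. indicator (ball 0 \<rho> \<times> ball 0 1) z * ennreal ((dnorm (fst z) (snd z))\<^sup>2) \<partial>(lborel \<Otimes>\<^sub>M lborel))"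
      by (subst lborel_pair.nn_integral_snd[symmetric]) auto
    also have "\<dots> < \<infinity>"
      using dnorm_L2_bound[OF \<rho>] L2_constant_finite by (rule order.strict_trans1)
    finally show ?thesis .
  qed
  then have "AE v in lborel. indicator (ball 0 1) v * I v \<noteq> \<infinity>"
  proof (intro nn_integral_PInf_AE)
    show "(\<lambda>v. indicator (ball 0 1) v * I v) \<in> borel_measurable lborel"
      by (intro borel_measurable_times_ennreal borel_measurable_indicator) auto
  qed simp
  then have ae: "AE v in lborel. norm v < 1 \<longrightarrow> v \<in> {v. I v < \<infinity>}"
  proof eventually_elim
    case (elim v)
    show ?case
    proof
      assume "norm v < 1"
      then have "indicator (ball 0 1) v = (1::ennreal)" by (simp add: indicator_def)
      with elim have "I v \<noteq> top" by (simp only: mult_1 infinity_ennreal_def not_False_eq_True)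
      then show "v \<in> {v. I v < \<infinity>}" unfolding mem_Collect_eq infinity_ennreal_def by (rule less_top[THEN iffD1])
    qed
  qed
  have "subspace {v. I v < \<infinity>}"
    unfolding subspace_def
  proof (intro conjI ballI allI)
    show "0 \<in> {v. I v < \<infinity>}" by (simp add: I_def dnorm_def tnorm_def)
  next
    fix a b assume ab: "a \<in> {v. I v < \<infinity>}" "b \<in> {v. I v < \<infinity>}"
    have "I (a + b) \<le> (\<integral>\<^sup>+x. 2 * (indicator (ball 0 \<rho>) x * ennreal ((dnorm x a)\<^sup>2)) + 2 * (indicator (ball 0 \<rho>) x * ennreal ((dnorm x b)\<^sup>2)) \<partial>lborel)"
      unfolding I_def
    proof (rule nn_integral_mono)
      fix x
      have "(dnorm x (a + b))\<^sup>2 \<le> 2 * (dnorm x a)\<^sup>2 + 2 * (dnorm x b)\<^sup>2"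
        unfolding dnorm_def matrix_vector_right_distrib by (rule tnorm_add_sq_le)
      then have "ennreal ((dnorm x (a + b))\<^sup>2) \<le> 2 * ennreal ((dnorm x a)\<^sup>2) + 2 * ennreal ((dnorm x b)\<^sup>2)"
        by (simp add: ennreal_plus[symmetric] ennreal_mult'[symmetric] flip: ennreal_numeral del: ennreal_plus)
      then show "indicator (ball 0 \<rho>) x * ennreal ((dnorm x (a + b))\<^sup>2)
        \<le> 2 * (indicator (ball 0 \<rho>) x * ennreal ((dnorm x a)\<^sup>2)) + 2 * (indicator (ball 0 \<rho>) x * ennreal ((dnorm x b)\<^sup>2))"
        by (simp split: split_indicator)
    qed
    also have "\<dots> = 2 * I a + 2 * I b"
      by (simp add: nn_integral_add nn_integral_cmult I_def)
    also have "\<dots> < \<infinity>" using ab by (simp add: ennreal_mult_less_top)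
    finally show "a + b \<in> {v. I v < \<infinity>}" by simp
  next
    fix c :: real and a assume a: "a \<in> {v. I v < \<infinity>}"
    have "dnorm x (c *\<^sub>R a) = \<bar>c\<bar> * dnorm x a" for x
      unfolding dnorm_def matrix_line by (rule tnorm_scaleR)
    then have "I (c *\<^sub>R a) = (\<integral>\<^sup>+x. ennreal (c\<^sup>2) * (indicator (ball 0 \<rho>) x * ennreal ((dnorm x a)\<^sup>2)) \<partial>lborel)"
      unfolding I_def by (simp add: power_mult_distrib ennreal_mult' mult_ac)
    also have "\<dots> = ennreal (c\<^sup>2) * I a" unfolding I_def by (rule nn_integral_cmult) measurable
    also have "\<dots> < \<infinity>" using a by (simp add: ennreal_mult_less_top)
    finally show "c *\<^sub>R a \<in> {v. I v < \<infinity>}" by simp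
  qed
  from subspace_ae_ball_UNIV[OF this ae] have "I v < \<infinity>" by auto
  then show ?thesis
    unfolding integrable_iff_bounded I_def by (simp add: ennreal_mult' ennreal_indicator abs_mult)
qed

lemma dnorm_L1:
  assumes \<rho>: "0 < \<rho>" "\<rho> < 1"
  shows "integrable lborel (\<lambda>x. indicat_real (ball 0 \<rho>) x * dnorm x v)"
proof (rule Bochner_Integration.integrable_bound)
  have [measurable]: "ball (0::real^'n) r \<in> sets borel" for r by simp
  have "integrable lborel (indicat_real (ball (0::real^'n) \<rho>))"
    using emeasure_lborel_ball_finite by (intro integrable_real_indicator) auto
  then show "integrable lborel (\<lambda>x. indicat_real (ball 0 \<rho>) x + indicat_real (ball 0 \<rho>) x * (dnorm x v)\<^sup>2)"
    by (intro Bochner_Integration.integrable_add dnorm_L2[OF \<rho>])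
  have le: "y \<le> 1 + y\<^sup>2" for y :: real
  proof -
    have "0 \<le> (y - 1)\<^sup>2" by simp
    then have "2 * y \<le> 1 + y\<^sup>2" by (simp add: power2_diff)
    moreover have "0 \<le> y\<^sup>2" by simp
    ultimately show ?thesis by linarith
  qed
  show "AE x in lborel. norm (indicat_real (ball 0 \<rho>) x * dnorm x v)
      \<le> norm (indicat_real (ball 0 \<rho>) x + indicat_real (ball 0 \<rho>) x * (dnorm x v)\<^sup>2)" (is "AE x in _. ?P x")
  proof (rule AE_I2)
    fix x
    show "?P x"
      using le[of "dnorm x v"] by (cases "x \<in> ball 0 \<rho>") simp_all
  qed
  show "(\<lambda>x. indicat_real (ball 0 \<rho>) x * dnorm x v) \<in> borel_measurable lborel"
    by measurable
qed

lemma D_L2: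
  assumes \<rho>: "0 < \<rho>" "\<rho> < 1"
  shows "integrable lborel (\<lambda>x. indicat_real (ball 0 \<rho>) x * dirichlet x)"
proof -
  have "dirichlet x = (\<Sum>j\<in>UNIV. (dnorm x (axis j 1))\<^sup>2)" for x
    unfolding norm_matrix_sq_columns dnorm_def tnorm_sq by (rule sum.swap)
  then have eq: "(\<lambda>x. indicat_real (ball 0 \<rho>) x * dirichlet x)
      = (\<lambda>x. \<Sum>j\<in>UNIV. indicat_real (ball 0 \<rho>) x * (dnorm x (axis j 1))\<^sup>2)"
    by (simp only: sum_distrib_left)
  show ?thesis
    unfolding eq by (intro Bochner_Integration.integrable_sum dnorm_L2[OF \<rho>])
qed


text \<open>The pointwise directional derivative of \<open>trunc m |f|\<close> computed from the differential \<open>D\<close>.\<close>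

definition slope :: "real \<Rightarrow> real^'n \<Rightarrow> real^'n \<Rightarrow> real"
  where "slope m x v = 2 * pairing x v / (1 + (gnorm x)\<^sup>2 / m\<^sup>2)\<^sup>2"

lemma slope_borel [measurable (raw)]:
  assumes [measurable]: "a \<in> borel_measurable M" "b \<in> borel_measurable M"
  shows "(\<lambda>z. slope m (a z) (b z)) \<in> borel_measurable M"
  unfolding slope_def by measurable

lemma abs_inner_le: "\<bar>pairing x v\<bar> \<le> gnorm x * dnorm x v"
  unfolding dnorm_def by (rule sum_inner_le_tnorm)

lemma abs_slope_le:
  assumes m: "0 < m"
  shows "\<bar>slope m x v\<bar> \<le> m * dnorm x v" and "\<bar>slope m x v\<bar> \<le> 2 * (gnorm x * dnorm x v)"
proof -
  define A where "A = 1 + (gnorm x)\<^sup>2 / m\<^sup>2"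
  have A: "1 \<le> A" by (simp add: A_def)
  have "\<bar>slope m x v\<bar> = 2 * \<bar>pairing x v\<bar> / A\<^sup>2"
    unfolding slope_def A_def[symmetric] by (simp add: abs_mult)
  also have "\<dots> \<le> 2 * (gnorm x * dnorm x v) / A\<^sup>2"
    using abs_inner_le[of x v] by (intro divide_right_mono mult_left_mono) auto
  finally have le: "\<bar>slope m x v\<bar> \<le> 2 * (gnorm x * dnorm x v) / A\<^sup>2" .
  have A2: "1 \<le> A\<^sup>2" using A by (simp add: one_le_power)
  have "2 * (gnorm x * dnorm x v) / A\<^sup>2 \<le> 2 * (gnorm x * dnorm x v) / 1"
    using A2 by (intro divide_left_mono) auto
  with le show "\<bar>slope m x v\<bar> \<le> 2 * (gnorm x * dnorm x v)" by simp
  have "2 * (gnorm x * dnorm x v) / A\<^sup>2 \<le> 2 * (gnorm x * dnorm x v) / A"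
    using A self_le_power[of A 2] by (intro divide_left_mono) auto
  also have "\<dots> = 2 * (gnorm x / A) * dnorm x v" by simp
  also have "\<dots> \<le> 2 * (m / 2) * dnorm x v"
    using trunc_half[OF m, of "gnorm x"] by (intro mult_right_mono mult_left_mono) (auto simp: A_def)
  finally show "\<bar>slope m x v\<bar> \<le> m * dnorm x v" using le by simp
qed

definition tquot :: "real \<Rightarrow> real \<Rightarrow> real^'n \<Rightarrow> real^'n \<Rightarrow> real"
  where "tquot m t x v = (trunc m (gnorm (x + t *\<^sub>R v)) - trunc m (gnorm x)) / t"

lemma trunc_borel [measurable (raw)]:
  assumes [measurable]: "a \<in> borel_measurable M"
  shows "(\<lambda>x. trunc m (a x)) \<in> borel_measurable M"
  unfolding trunc_def by measurable

lemma tquot_borel [measurable (raw)]: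
  assumes [measurable]: "a \<in> borel_measurable M" "b \<in> borel_measurable M"
  shows "(\<lambda>z. tquot m t (a z) (b z)) \<in> borel_measurable M"
  unfolding tquot_def by measurable

lemma trunc_tnorm_diff_le:
  assumes "0 < m"
  shows "\<bar>trunc m (tnorm Q P) - trunc m (tnorm Q R)\<bar> \<le> m * tdist Q P R"
proof (rule order_trans)
  show "\<bar>trunc m (tnorm Q P) - trunc m (tnorm Q R)\<bar> \<le> m * \<bar>tnorm Q P - tnorm Q R\<bar>"
    by (rule trunc_Lipschitz[OF assms]) simp_all
  show "m * \<bar>tnorm Q P - tnorm Q R\<bar> \<le> m * tdist Q P R"
    using assms by (intro mult_left_mono abs_tnorm_diff_le) simp
qed

lemma abs_tquot_le:
  assumes "0 < m" "0 < t"
  shows "\<bar>tquot m t x v\<bar> \<le> m * quot t x v"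
  using divide_right_mono[OF trunc_tnorm_diff_le[OF assms(1)] less_imp_le[OF assms(2)]]
  unfolding tquot_def quot_def abs_divide abs_of_pos[OF assms(2)] times_divide_eq_right .

lemma tquot_tendsto:
  assumes m: "0 < m" and t: "\<And>k. 0 < t k" "t \<longlonglongrightarrow> 0" and b: "(\<lambda>k. blow (t k) x v) \<longlonglongrightarrow> 0"
  shows "(\<lambda>k. tquot m (t k) x v) \<longlonglongrightarrow> slope m x v"
proof -
  define h where "h t = trunc m (tnorm Q (\<lambda>i. g i x + t *\<^sub>R (D i x *v v)))" for t
  have "(h has_real_derivative slope m x v) (at 0)"
    unfolding h_def slope_def by (rule trunc_tnorm_line_derivative)
  from DERIV_sequentially[OF this t] have lim: "(\<lambda>k. (h (t k) - h 0) / t k) \<longlonglongrightarrow> slope m x v" .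
  have "norm (tquot m (t k) x v - (h (t k) - h 0) / t k) \<le> m * blow (t k) x v" for k
  proof -
    have "tquot m (t k) x v - (h (t k) - h 0) / t k = (trunc m (gnorm (x + t k *\<^sub>R v)) - h (t k)) / t k"
      by (simp add: tquot_def h_def diff_divide_distrib)
    moreover have "\<bar>(trunc m (gnorm (x + t k *\<^sub>R v)) - h (t k)) / t k\<bar> \<le> m * blow (t k) x v"
      using divide_right_mono[OF trunc_tnorm_diff_le[OF m] less_imp_le[OF t(1)]]
      unfolding h_def blow_def matrix_line abs_divide abs_of_pos[OF t(1)] times_divide_eq_right .
    ultimately show ?thesis by (simp only: real_norm_def)
  qed
  then have "(\<lambda>k. tquot m (t k) x v - (h (t k) - h 0) / t k) \<longlonglongrightarrow> 0"
    by (intro Lim_null_comparison[OF always_eventually tendsto_mult_right_zero[OF b, of m]] allI)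
  from tendsto_add[OF this lim] show ?thesis by simp
qed

text \<open>The quotients of \<open>trunc m |f|\<close> and their limits are dominated by \<open>m\<close> times the quotients of \<open>f\<close> and \<open>m\<close>
times \<open>|Df v|\<close>. Both are bounded in \<open>L\<^sup>2\<close>, so almost everywhere convergence improves to convergence in
\<open>L\<^sup>1\<close>.\<close>

lemma tquot_L1_tendsto:
  assumes m: "0 < m" and \<rho>: "0 < \<rho>" "\<rho> < 1"
  shows "\<exists>t Z. (\<forall>k. 0 < t k) \<and> t \<longlonglongrightarrow> 0 \<and>
    (\<forall>k z. Z k z = indicat_real (ball 0 \<rho> \<times> ball 0 1) z * (tquot m (t k) (fst z) (snd z) - slope m (fst z) (snd z))) \<and>
    (\<forall>k. integrable (lborel \<Otimes>\<^sub>M lborel) (Z k)) \<and> (\<lambda>k. \<integral>z. \<bar>Z k z\<bar> \<partial>(lborel \<Otimes>\<^sub>M lborel)) \<longlonglongrightarrow> 0"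
proof -
  have [measurable]: "ball (0::real^'n) r \<in> sets borel" for r by simp
  obtain t where t: "\<And>k. 0 < t k" "\<And>k. t k < 1 - \<rho>" "t \<longlonglongrightarrow> 0"
    and ae: "AE z in lborel \<Otimes>\<^sub>M lborel. norm (fst z) < 1 \<longrightarrow> norm (snd z) < 1 \<longrightarrow> (\<lambda>k. blow (t k) (fst z) (snd z)) \<longlonglongrightarrow> 0"
    using blowup_sequence[OF \<rho>(2)] by blast
  let ?S = "ball (0::real^'n) \<rho> \<times> ball (0::real^'n) 1"
  let ?M = "lborel \<Otimes>\<^sub>M lborel :: ((real^'n) \<times> (real^'n)) measure"
  define Z where "Z k z = indicat_real ?S z * (tquot m (t k) (fst z) (snd z) - slope m (fst z) (snd z))" for k z
  define c where "c = emeasure lborel (ball (0::real^'n) 1) * (\<integral>\<^sup>+x. ennreal ((\<Phi> x)\<^sup>2) \<partial>lborel)"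
  have c: "c < \<infinity>" unfolding c_def by (rule L2_constant_finite)
  then obtain r where r: "0 \<le> r" "c = ennreal r" by (cases c) auto
  have S: "?S \<in> sets ?M" by measurable
  have fin: "emeasure ?M ?S < \<infinity>"
    using emeasure_lborel_ball_finite[of "0::real^'n"]
    by (subst lborel.emeasure_pair_measure_Times) (auto simp: ennreal_mult_less_top)
  have Zm: "Z k \<in> borel_measurable ?M" for k
    unfolding Z_def[abs_def] by measurable
  have lim: "AE z in ?M. (\<lambda>k. Z k z) \<longlonglongrightarrow> 0"
    using ae
  proof eventually_elim
    case (elim z)
    show ?case
    proof (cases "z \<in> ?S")
      case True
      then have "norm (fst z) < 1" "norm (snd z) < 1" using \<rho>(2) by auto
      with elim have "(\<lambda>k. tquot m (t k) (fst z) (snd z)) \<longlonglongrightarrow> slope m (fst z) (snd z)"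
        using tquot_tendsto[OF m t(1,3)] by blast
      then show ?thesis using True by (simp add: Z_def LIM_zero)
    qed (simp add: Z_def)
  qed
  have L2: "(\<integral>\<^sup>+z. ennreal ((Z k z)\<^sup>2) \<partial>?M) \<le> ennreal (2 * m\<^sup>2 * r + 2 * m\<^sup>2 * r)" for k
  proof -
    have "(\<integral>\<^sup>+z. ennreal ((Z k z)\<^sup>2) \<partial>?M)
      \<le> (\<integral>\<^sup>+z. ennreal (2 * m\<^sup>2) * (indicator ?S z * ennreal ((quot (t k) (fst z) (snd z))\<^sup>2))
          + ennreal (2 * m\<^sup>2) * (indicator ?S z * ennreal ((dnorm (fst z) (snd z))\<^sup>2)) \<partial>?M)"
    proof (rule nn_integral_mono)
      fix z :: "(real^'n) \<times> (real^'n)"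
      define a b where "a = quot (t k) (fst z) (snd z)" and "b = dnorm (fst z) (snd z)"
      have "\<bar>tquot m (t k) (fst z) (snd z) - slope m (fst z) (snd z)\<bar> \<le> m * a + m * b"
        using abs_tquot_le[OF m t(1)[of k], of "fst z" "snd z"] abs_slope_le(1)[OF m, of "fst z" "snd z"]
        unfolding a_def b_def by linarith
      then have "(tquot m (t k) (fst z) (snd z) - slope m (fst z) (snd z))\<^sup>2 \<le> (m * a + m * b)\<^sup>2"
        by (metis abs_ge_zero power2_abs power_mono)
      also have "\<dots> \<le> 2 * m\<^sup>2 * a\<^sup>2 + 2 * m\<^sup>2 * b\<^sup>2"
        using zero_le_power2[of "m * a - m * b"] by (simp add: power2_sum power2_diff power_mult_distrib algebra_simps)
      finally have "ennreal ((tquot m (t k) (fst z) (snd z) - slope m (fst z) (snd z))\<^sup>2)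
          \<le> ennreal (2 * m\<^sup>2 * a\<^sup>2 + 2 * m\<^sup>2 * b\<^sup>2)" by (rule ennreal_leI)
      also have "\<dots> = ennreal (2 * m\<^sup>2) * ennreal (a\<^sup>2) + ennreal (2 * m\<^sup>2) * ennreal (b\<^sup>2)"
      proof -
        have "ennreal (2 * m\<^sup>2 * a\<^sup>2 + 2 * m\<^sup>2 * b\<^sup>2) = ennreal (2 * m\<^sup>2 * a\<^sup>2) + ennreal (2 * m\<^sup>2 * b\<^sup>2)"
          by (rule ennreal_plus) auto
        moreover have "ennreal (2 * m\<^sup>2 * y\<^sup>2) = ennreal (2 * m\<^sup>2) * ennreal (y\<^sup>2)" for y
          by (rule ennreal_mult) auto
        ultimately show ?thesis by (simp only:)
      qed
      finally show "ennreal ((Z k z)\<^sup>2) \<le> ennreal (2 * m\<^sup>2) * (indicator ?S z * ennreal ((quot (t k) (fst z) (snd z))\<^sup>2))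
          + ennreal (2 * m\<^sup>2) * (indicator ?S z * ennreal ((dnorm (fst z) (snd z))\<^sup>2))"
        unfolding a_def b_def by (cases "z \<in> ?S") (simp_all add: Z_def)
    qed
    also have "\<dots> = ennreal (2 * m\<^sup>2) * (\<integral>\<^sup>+z. indicator ?S z * ennreal ((quot (t k) (fst z) (snd z))\<^sup>2) \<partial>?M)
        + ennreal (2 * m\<^sup>2) * (\<integral>\<^sup>+z. indicator ?S z * ennreal ((dnorm (fst z) (snd z))\<^sup>2) \<partial>?M)"
      by (subst nn_integral_add) (measurable, simp add: nn_integral_cmult)
    also have "\<dots> \<le> ennreal (2 * m\<^sup>2) * c + ennreal (2 * m\<^sup>2) * c"
      unfolding c_def by (intro add_mono mult_left_mono quot_L2_bound[OF \<rho>(1) t(1,2)] dnorm_L2_bound[OF \<rho>]) auto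
    also have "\<dots> = ennreal (2 * m\<^sup>2 * r + 2 * m\<^sup>2 * r)"
    proof -
      have "ennreal (2 * m\<^sup>2) * c = ennreal (2 * m\<^sup>2 * r)"
        unfolding r(2) using r(1) by (intro ennreal_mult[symmetric]) auto
      moreover have "ennreal (2 * m\<^sup>2 * r) + ennreal (2 * m\<^sup>2 * r) = ennreal (2 * m\<^sup>2 * r + 2 * m\<^sup>2 * r)"
        using r(1) by (intro ennreal_plus[symmetric]) auto
      ultimately show ?thesis by (simp only:)
    qed
    finally show ?thesis .
  qed
  have Z0: "Z k z = 0" if "z \<notin> ?S" for k z using that by (simp add: Z_def)
  note L1 = L2_bounded_imp_L1_tendsto[OF Zm S fin Z0 lim L2]
  show ?thesis
  proof (intro exI conjI allI)
    show "0 < t k" for k by (rule t(1))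
    show "t \<longlonglongrightarrow> 0" by (rule t(3))
    show "Z k z = indicat_real ?S z * (tquot m (t k) (fst z) (snd z) - slope m (fst z) (snd z))" for k z
      by (rule Z_def)
    show "integrable ?M (Z k)" for k by (rule L1(1))
    show "(\<lambda>k. \<integral>z. \<bar>Z k z\<bar> \<partial>?M) \<longlonglongrightarrow> 0" by (rule L1(2))
  qed
qed


lemma slope_linear:
  "slope m x (v + w) = slope m x v + slope m x w"
  "slope m x (c *\<^sub>R v) = c * slope m x v"
  by (simp_all add: slope_def matrix_vector_right_distrib matrix_line inner_add_right sum.distrib
      sum_distrib_left add_divide_distrib distrib_left mult_ac)

lemma slope_integrable:
  assumes m: "0 < m" and \<rho>: "0 < \<rho>" "\<rho> < 1"
  shows "integrable lborel (\<lambda>x. indicat_real (ball 0 \<rho>) x * slope m x v)"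
proof (rule Bochner_Integration.integrable_bound)
  have [measurable]: "ball (0::real^'n) r \<in> sets borel" for r by simp
  show "integrable lborel (\<lambda>x. m * (indicat_real (ball 0 \<rho>) x * dnorm x v))"
    by (intro integrable_mult_right dnorm_L1[OF \<rho>])
  show "(\<lambda>x. indicat_real (ball 0 \<rho>) x * slope m x v) \<in> borel_measurable lborel"
    by measurable
  show "AE x in lborel. norm (indicat_real (ball 0 \<rho>) x * slope m x v) \<le> norm (m * (indicat_real (ball 0 \<rho>) x * dnorm x v))" (is "AE x in _. ?P x")
  proof (rule AE_I2)
    fix x
    show "?P x"
      using abs_slope_le(1)[OF m, of x v] m by (cases "x \<in> ball 0 \<rho>") (simp_all add: abs_mult)
  qed
qed

lemma trunc_integrable: "integrable lborel (\<lambda>x. trunc m (gnorm x))"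
  by (rule Bochner_Integration.integrable_bound[OF g_L2]) (auto intro!: AE_I2 simp: trunc_bounds)

text \<open>Tested against \<open>\<eta>\<close>, the quotients of \<open>trunc m |f|\<close> converge to minus the integral of \<open>trunc m |f|\<close> against
the derivative of \<open>\<eta>\<close>, for every direction \<open>v\<close>, since the difference can be moved to \<open>\<eta>\<close>. On the other
hand they converge to the integral of \<open>slope\<close> for almost every direction, by \<open>L\<^sup>1\<close> convergence in \<open>(x, v)\<close>.
Both limits are linear in \<open>v\<close>.\<close>

lemma chain_rule_trunc:
  assumes m: "0 < m" and \<rho>: "0 < \<rho>" "\<rho> < 1"
    and sm: "smooth_on UNIV \<eta>" and out: "\<And>x. \<rho> \<le> norm x \<Longrightarrow> \<eta> x = 0"
  shows "(LBINT x. trunc m (gnorm x) * frechet_derivative \<eta> (at x) v) = - (LBINT x. slope m x v * \<eta> x)"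
proof -
  let ?M = "lborel \<Otimes>\<^sub>M lborel :: ((real^'n) \<times> (real^'n)) measure"
  define \<theta> where "\<theta> x = trunc m (gnorm x)" for x
  have \<theta>: "integrable lborel \<theta>" unfolding \<theta>_def by (rule trunc_integrable)
  then have [measurable]: "\<theta> \<in> borel_measurable borel" by auto
  have out': "\<rho> < norm x \<Longrightarrow> \<eta> x = 0" for x using out[of x] by simp
  have \<eta>c: "continuous_on UNIV \<eta>" by (rule smooth_on_continuous[OF sm])
  have dc: "continuous_on UNIV (\<lambda>x. frechet_derivative \<eta> (at x) v)" for v
    by (intro smooth_on_continuous smooth_on_frechet_derivative sm)
  have [measurable]: "\<eta> \<in> borel_measurable borel" by (rule borel_measurable_continuous_onI[OF \<eta>c])
  have dm [measurable]: "(\<lambda>x. frechet_derivative \<eta> (at x) v) \<in> borel_measurable borel" for v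
    by (rule borel_measurable_continuous_onI[OF dc])
  obtain C where C: "0 \<le> C" "\<And>x. \<bar>\<eta> x\<bar> \<le> C"
    using continuous_compact_support_bounded[OF \<eta>c out'] by blast
  have dC: "\<exists>C\<ge>0. \<forall>x. \<bar>frechet_derivative \<eta> (at x) v\<bar> \<le> C" for v
    by (rule continuous_compact_support_bounded[OF dc frechet_derivative_zero_outside[OF out']])
  have lin: "linear (frechet_derivative \<eta> (at x))" for x
    by (rule has_derivative_linear[OF smooth_on_has_derivative[OF sm]])
  define A where "A v = - (LBINT x. \<theta> x * frechet_derivative \<eta> (at x) v)" for v
  define lb where "lb v = (LBINT x. slope m x v * \<eta> x)" for v
  have isl: "integrable lborel (\<lambda>x. slope m x v * \<eta> x)" for v
  proof -
    have "(\<lambda>x. slope m x v * \<eta> x) = (\<lambda>x. (indicat_real (ball 0 \<rho>) x * slope m x v) * \<eta> x)"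
      using out by (intro ext) (auto simp: indicator_def)
    then show ?thesis
      using integrable_mult_bounded[OF slope_integrable[OF m \<rho>] _ C(2)] by simp
  qed
  have idr: "integrable lborel (\<lambda>x. \<theta> x * frechet_derivative \<eta> (at x) v)" for v
  proof -
    obtain C1 where C1: "\<And>x. \<bar>frechet_derivative \<eta> (at x) v\<bar> \<le> C1" using dC[of v] by blast
    show ?thesis by (rule integrable_mult_bounded[OF \<theta> _ C1]) measurable
  qed
  obtain t Z where t: "\<And>k. 0 < t k" "t \<longlonglongrightarrow> 0"
    and Z: "\<And>k z. Z k z = indicat_real (ball 0 \<rho> \<times> ball 0 1) z * (tquot m (t k) (fst z) (snd z) - slope m (fst z) (snd z))"
    and Zi: "\<And>k. integrable ?M (Z k)" and Zl: "(\<lambda>k. \<integral>z. \<bar>Z k z\<bar> \<partial>?M) \<longlonglongrightarrow> 0"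
    using tquot_L1_tendsto[OF m \<rho>] by blast
  define Y where "Y k z = Z k z * \<eta> (fst z)" for k z
  have Yi: "integrable ?M (Y k)" for k
    unfolding Y_def using C(2) by (intro integrable_mult_bounded[OF Zi, where c = C]) auto
  define b where "b k v = (LBINT x. Y k (x, v))" for k v
  have bi: "integrable lborel (b k)" for k
    using lborel_pair.integrable_snd[of "\<lambda>x v. Y k (x, v)"] Yi[of k] by (simp add: b_def[abs_def])
  have ble: "(LBINT v. norm (b k v)) \<le> C * (\<integral>z. \<bar>Z k z\<bar> \<partial>?M)" for k
  proof -
    have Ya: "integrable ?M (\<lambda>(x, v). \<bar>Y k (x, v)\<bar>)" using Yi[of k] by (simp add: case_prod_beta')
    have "(LBINT v. norm (b k v)) \<le> (LBINT v. LBINT x. \<bar>Y k (x, v)\<bar>)"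
    proof (rule integral_mono)
      show "integrable lborel (\<lambda>v. norm (b k v))" using bi[of k] by (rule integrable_norm)
      show "integrable lborel (\<lambda>v. LBINT x. \<bar>Y k (x, v)\<bar>)" by (rule lborel_pair.integrable_snd[OF Ya])
      show "norm (b k v) \<le> (LBINT x. \<bar>Y k (x, v)\<bar>)" for v
        unfolding b_def real_norm_def by (rule integral_abs_bound)
    qed
    also have "\<dots> = (\<integral>z. \<bar>Y k z\<bar> \<partial>?M)"
      unfolding lborel_pair.integral_snd[OF Ya] by (simp only: case_prod_beta' prod.collapse)
    also have "\<dots> \<le> (\<integral>z. C * \<bar>Z k z\<bar> \<partial>?M)"
    proof (rule integral_mono)
      show "integrable ?M (\<lambda>z. \<bar>Y k z\<bar>)" using Yi[of k] by (rule integrable_abs)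
      show "integrable ?M (\<lambda>z. C * \<bar>Z k z\<bar>)" using Zi[of k] by simp
      show "\<bar>Y k z\<bar> \<le> C * \<bar>Z k z\<bar>" for z
        unfolding Y_def abs_mult mult.commute[of C] by (intro mult_left_mono C) simp
    qed
    finally show ?thesis by simp
  qed
  have "(\<lambda>k. LBINT v. norm (b k v)) \<longlonglongrightarrow> 0"
  proof (rule tendsto_sandwich[OF always_eventually always_eventually tendsto_const])
    show "\<forall>k. 0 \<le> (LBINT v. norm (b k v))" by simp
    show "\<forall>k. (LBINT v. norm (b k v)) \<le> C * (\<integral>z. \<bar>Z k z\<bar> \<partial>?M)" using ble by blast
    show "(\<lambda>k. C * (\<integral>z. \<bar>Z k z\<bar> \<partial>?M)) \<longlonglongrightarrow> 0" by (rule tendsto_mult_right_zero[OF Zl])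
  qed
  from tendsto_L1_AE_subseq[OF bi this] obtain r where r: "strict_mono r"
    and ae: "AE v in lborel. (\<lambda>k. b (r k) v) \<longlonglongrightarrow> 0" by blast
  \<comment> \<open>translation moves the increment from the map to the smooth test function\<close>
  have beq: "b k v = (LBINT x. \<theta> x * ((\<eta> (x + - (t k *\<^sub>R v)) - \<eta> x) / t k)) - lb v" if v: "norm v < 1" for k v
  proof -
    have i1: "integrable lborel (\<lambda>x. \<theta> (x + t k *\<^sub>R v) * \<eta> x)"
      by (rule integrable_mult_bounded[OF integrable_lborel_translate[OF \<theta>] _ C(2)]) measurable
    have i2: "integrable lborel (\<lambda>x. \<theta> x * \<eta> x)"
      by (rule integrable_mult_bounded[OF \<theta> _ C(2)]) measurable
    have i3: "integrable lborel (\<lambda>x. \<theta> x * \<eta> (x + - (t k *\<^sub>R v)))"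
      by (rule integrable_mult_bounded[OF \<theta> _ C(2)]) measurable
    have "Y k (x, v) = (\<theta> (x + t k *\<^sub>R v) * \<eta> x - \<theta> x * \<eta> x) / t k - slope m x v * \<eta> x" for x
    proof (cases "norm x < \<rho>")
      case True
      then show ?thesis using v
        by (simp add: Y_def Z tquot_def \<theta>_def left_diff_distrib)
    next
      case False
      then show ?thesis using out[of x] by (simp add: Y_def)
    qed
    then have "b k v = (LBINT x. (\<theta> (x + t k *\<^sub>R v) * \<eta> x - \<theta> x * \<eta> x) / t k - slope m x v * \<eta> x)"
      by (simp add: b_def)
    also have "\<dots> = ((LBINT x. \<theta> (x + t k *\<^sub>R v) * \<eta> x) - (LBINT x. \<theta> x * \<eta> x)) / t k - lb v"
      using i1 i2 isl[of v] by (simp add: lb_def)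
    also have "(LBINT x. \<theta> (x + t k *\<^sub>R v) * \<eta> x) = (LBINT x. \<theta> x * \<eta> (x + - (t k *\<^sub>R v)))"
      using integral_lborel_translate[of "\<lambda>x. \<theta> (x + t k *\<^sub>R v) * \<eta> x" "- (t k *\<^sub>R v)"] by simp
    also have "((LBINT x. \<theta> x * \<eta> (x + - (t k *\<^sub>R v))) - (LBINT x. \<theta> x * \<eta> x)) / t k
        = (LBINT x. \<theta> x * ((\<eta> (x + - (t k *\<^sub>R v)) - \<eta> x) / t k))"
      using i2 i3 by (simp add: right_diff_distrib)
    finally show ?thesis .
  qed
  have lim: "(\<lambda>k. LBINT x. \<theta> x * ((\<eta> (x + - (t k *\<^sub>R v)) - \<eta> x) / t k)) \<longlonglongrightarrow> A v" for v
  proof -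
    obtain C1 where C1: "0 \<le> C1" "\<And>x. \<bar>frechet_derivative \<eta> (at x) v\<bar> \<le> C1" using dC[of v] by blast
    have der: "((\<lambda>s. \<eta> (x + - (s *\<^sub>R v))) has_real_derivative - frechet_derivative \<eta> (at (x + - (s *\<^sub>R v))) v) (at s)" for x s
    proof -
      have "((\<lambda>s. \<eta> (x + - (s *\<^sub>R v))) has_derivative
          (\<lambda>a. frechet_derivative \<eta> (at (x + - (s *\<^sub>R v))) (- (a *\<^sub>R v)))) (at s)"
        by (rule has_derivative_compose[OF _ smooth_on_has_derivative[OF sm]]) (auto intro!: derivative_eq_intros)
      moreover have "(\<lambda>a. frechet_derivative \<eta> (at (x + - (s *\<^sub>R v))) (- (a *\<^sub>R v)))
          = (*) (- frechet_derivative \<eta> (at (x + - (s *\<^sub>R v))) v)"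
        by (rule ext) (simp add: linear_neg[OF lin] linear_scale[OF lin] mult.commute)
      ultimately show ?thesis by (simp only: has_field_derivative_def)
    qed
    have "(\<lambda>k. LBINT x. \<theta> x * ((\<eta> (x + - (t k *\<^sub>R v)) - \<eta> x) / t k)) \<longlonglongrightarrow> (LBINT x. \<theta> x * - frechet_derivative \<eta> (at x) v)"
    proof (rule integral_dominated_convergence[where w = "\<lambda>x. C1 * \<bar>\<theta> x\<bar>"])
      show "AE x in lborel. (\<lambda>k. \<theta> x * ((\<eta> (x + - (t k *\<^sub>R v)) - \<eta> x) / t k)) \<longlonglongrightarrow> \<theta> x * - frechet_derivative \<eta> (at x) v"
      proof (intro AE_I2 tendsto_mult_left)
        fix x
        have "(\<lambda>k. (\<eta> (x + - (t k *\<^sub>R v)) - \<eta> (x + - (0 *\<^sub>R v))) / t k)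
            \<longlonglongrightarrow> - frechet_derivative \<eta> (at (x + - (0 *\<^sub>R v))) v"
          by (rule DERIV_sequentially[OF der t])
        then show "(\<lambda>k. (\<eta> (x + - (t k *\<^sub>R v)) - \<eta> x) / t k) \<longlonglongrightarrow> - frechet_derivative \<eta> (at x) v"
          by (simp only: scaleR_zero_left minus_zero add_0_right)
      qed
      show "AE x in lborel. norm (\<theta> x * ((\<eta> (x + - (t k *\<^sub>R v)) - \<eta> x) / t k)) \<le> C1 * \<bar>\<theta> x\<bar>" (is "AE x in _. ?P x") for k
      proof (rule AE_I2)
        fix x
        have "norm (\<eta> (x + - (t k *\<^sub>R v)) - \<eta> (x + - (0 *\<^sub>R v))) \<le> C1 * norm (t k - 0)"
          by (rule field_differentiable_bound[OF convex_UNIV]) (use der[THEN DERIV_subset] C1 in auto)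
        then have "\<bar>\<eta> (x + - (t k *\<^sub>R v)) - \<eta> x\<bar> \<le> C1 * t k" using t(1)[of k] by simp
        then have "\<bar>(\<eta> (x + - (t k *\<^sub>R v)) - \<eta> x) / t k\<bar> \<le> C1"
          unfolding abs_divide abs_of_pos[OF t(1)] pos_divide_le_eq[OF t(1)] .
        then show "?P x"
          unfolding real_norm_def abs_mult[of "\<theta> x"] by (subst mult.commute) (rule mult_right_mono, auto)
      qed
    qed (use \<theta> in auto)
    then show ?thesis by (simp add: A_def)
  qed
  have "AE v in lborel. norm v < 1 \<longrightarrow> v \<in> {v. A v = lb v}"
    using ae
  proof eventually_elim
    case (elim v)
    show ?case
    proof
      assume v: "norm v < 1"
      have "(\<lambda>k. (LBINT x. \<theta> x * ((\<eta> (x + - (t (r k) *\<^sub>R v)) - \<eta> x) / t (r k))) - lb v) \<longlonglongrightarrow> A v - lb v"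
        using LIMSEQ_subseq_LIMSEQ[OF lim[of v] r] by (intro tendsto_diff tendsto_const) (simp add: o_def)
      then have "(\<lambda>k. b (r k) v) \<longlonglongrightarrow> A v - lb v" by (simp add: beq[OF v])
      with elim have "A v - lb v = 0" by (metis LIMSEQ_unique)
      then show "v \<in> {v. A v = lb v}" by simp
    qed
  qed
  moreover have "subspace {v. A v = lb v}"
    unfolding subspace_def
  proof (intro conjI ballI allI)
    show "0 \<in> {v. A v = lb v}" by (simp add: A_def lb_def slope_def linear_0[OF lin])
  next
    fix v w assume "v \<in> {v. A v = lb v}" "w \<in> {v. A v = lb v}"
    moreover have "A (v + w) = A v + A w"
      using idr by (simp add: A_def linear_add[OF lin] distrib_left)
    moreover have "lb (v + w) = lb v + lb w"
      using isl by (simp add: lb_def slope_linear distrib_right)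
    ultimately show "v + w \<in> {v. A v = lb v}" by simp
  next
    fix c :: real and v assume "v \<in> {v. A v = lb v}"
    moreover have "A (c *\<^sub>R v) = c * A v"
      by (simp add: A_def linear_scale[OF lin] mult.left_commute[of _ c])
    moreover have "lb (c *\<^sub>R v) = c * lb v"
      by (simp add: lb_def slope_linear mult.assoc)
    ultimately show "c *\<^sub>R v \<in> {v. A v = lb v}" by simp
  qed
  ultimately have "{v. A v = lb v} = UNIV" by (intro subspace_ae_ball_UNIV)
  then have "A v = lb v" by blast
  then show ?thesis by (simp add: A_def lb_def \<theta>_def)
qed

text \<open>The weak derivative of \<open>|f|\<^sup>2\<close> is \<open>2 f \<bullet> Df v\<close>: let \<open>m\<close> tend to infinity in \<open>chain_rule_trunc\<close>, with dominating
functions \<open>|f|\<^sup>2\<close> and \<open>|f|\<^sup>2 + |Df v|\<^sup>2\<close>.\<close>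

theorem chain_rule:
  assumes \<rho>: "0 < \<rho>" "\<rho> < 1"
    and sm: "smooth_on UNIV \<eta>" and out: "\<And>x. \<rho> \<le> norm x \<Longrightarrow> \<eta> x = 0"
  shows "(LBINT x. (gnorm x)\<^sup>2 * frechet_derivative \<eta> (at x) v)
    = - (LBINT x. 2 * pairing x v * \<eta> x)"
proof -
  have out': "\<rho> < norm x \<Longrightarrow> \<eta> x = 0" for x using out[of x] by simp
  have \<eta>c: "continuous_on UNIV \<eta>" by (rule smooth_on_continuous[OF sm])
  have dc: "continuous_on UNIV (\<lambda>x. frechet_derivative \<eta> (at x) v)"
    by (intro smooth_on_continuous smooth_on_frechet_derivative sm)
  have [measurable]: "\<eta> \<in> borel_measurable borel" "(\<lambda>x. frechet_derivative \<eta> (at x) v) \<in> borel_measurable borel"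
    by (rule borel_measurable_continuous_onI[OF \<eta>c], rule borel_measurable_continuous_onI[OF dc])
  obtain C where C: "0 \<le> C" "\<And>x. \<bar>\<eta> x\<bar> \<le> C"
    using continuous_compact_support_bounded[OF \<eta>c out'] by blast
  have "\<exists>C\<ge>0. \<forall>x. \<bar>frechet_derivative \<eta> (at x) v\<bar> \<le> C"
    by (rule continuous_compact_support_bounded[OF dc frechet_derivative_zero_outside[OF out']])
  then obtain C1 where C1: "0 \<le> C1" "\<And>x. \<bar>frechet_derivative \<eta> (at x) v\<bar> \<le> C1"
    by blast
  have q: "(\<lambda>k. 1 + s / (real (Suc k))\<^sup>2) \<longlonglongrightarrow> 1" for s
  proof -
    have "(\<lambda>k. 1 + s * (1 / real (Suc k)) ^ 2) \<longlonglongrightarrow> 1 + s * 0 ^ 2"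
      by (intro tendsto_intros LIMSEQ_Suc[OF lim_1_over_n])
    then show ?thesis by (simp add: power_divide)
  qed
  have m: "0 < real (Suc k)" for k by simp
  have "(\<lambda>k. LBINT x. trunc (real (Suc k)) (gnorm x) * frechet_derivative \<eta> (at x) v)
      \<longlonglongrightarrow> (LBINT x. (gnorm x)\<^sup>2 * frechet_derivative \<eta> (at x) v)"
  proof (rule integral_dominated_convergence[where w = "\<lambda>x. C1 * (gnorm x)\<^sup>2"])
    show "integrable lborel (\<lambda>x. C1 * (gnorm x)\<^sup>2)" using g_L2 by simp
    show "AE x in lborel. (\<lambda>k. trunc (real (Suc k)) (gnorm x) * frechet_derivative \<eta> (at x) v)
        \<longlonglongrightarrow> (gnorm x)\<^sup>2 * frechet_derivative \<eta> (at x) v"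
    proof (intro AE_I2 tendsto_mult_right)
      fix x
      have "(\<lambda>k. (gnorm x)\<^sup>2 / (1 + (gnorm x)\<^sup>2 / (real (Suc k))\<^sup>2)) \<longlonglongrightarrow> (gnorm x)\<^sup>2 / 1"
        by (intro tendsto_divide tendsto_const q) simp
      then show "(\<lambda>k. trunc (real (Suc k)) (gnorm x)) \<longlonglongrightarrow> (gnorm x)\<^sup>2" by (simp add: trunc_def)
    qed
    show "AE x in lborel. norm (trunc (real (Suc k)) (gnorm x) * frechet_derivative \<eta> (at x) v) \<le> C1 * (gnorm x)\<^sup>2" (is "AE x in _. ?P x") for k
    proof (rule AE_I2)
      fix x
      have "trunc (real (Suc k)) (gnorm x) * \<bar>frechet_derivative \<eta> (at x) v\<bar> \<le> (gnorm x)\<^sup>2 * C1"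
        by (intro mult_mono trunc_bounds C1) auto
      then show "?P x"
        by (simp add: abs_mult trunc_bounds mult.commute)
    qed
  qed measurable
  moreover have "(\<lambda>k. - (LBINT x. slope (real (Suc k)) x v * \<eta> x))
      \<longlonglongrightarrow> - (LBINT x. 2 * pairing x v * \<eta> x)"
  proof (intro tendsto_minus integral_dominated_convergence[where
        w = "\<lambda>x. C * ((gnorm x)\<^sup>2 + indicat_real (ball 0 \<rho>) x * (dnorm x v)\<^sup>2)"])
    show "integrable lborel (\<lambda>x. C * ((gnorm x)\<^sup>2 + indicat_real (ball 0 \<rho>) x * (dnorm x v)\<^sup>2))"
      by (intro integrable_mult_right Bochner_Integration.integrable_add g_L2 dnorm_L2[OF \<rho>])
    show "AE x in lborel. (\<lambda>k. slope (real (Suc k)) x v * \<eta> x) \<longlonglongrightarrow> 2 * pairing x v * \<eta> x"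
    proof (intro AE_I2 tendsto_mult_right)
      fix x
      have "(\<lambda>k. 2 * pairing x v / (1 + (gnorm x)\<^sup>2 / (real (Suc k))\<^sup>2)\<^sup>2)
          \<longlonglongrightarrow> 2 * pairing x v / 1\<^sup>2"
        by (intro tendsto_divide tendsto_const tendsto_power q) simp
      then show "(\<lambda>k. slope (real (Suc k)) x v) \<longlonglongrightarrow> 2 * pairing x v"
        by (simp add: slope_def)
    qed
    show "AE x in lborel. norm (slope (real (Suc k)) x v * \<eta> x) \<le> C * ((gnorm x)\<^sup>2 + indicat_real (ball 0 \<rho>) x * (dnorm x v)\<^sup>2)" (is "AE x in _. ?P x") for k
    proof (rule AE_I2)
      fix x
      show "?P x"
      proof (cases "norm x < \<rho>")
        case True
        have "2 * (gnorm x * dnorm x v) \<le> (gnorm x)\<^sup>2 + (dnorm x v)\<^sup>2"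
          using zero_le_power2[of "gnorm x - dnorm x v"] by (simp add: power2_diff)
        then have "\<bar>slope (real (Suc k)) x v\<bar> \<le> (gnorm x)\<^sup>2 + (dnorm x v)\<^sup>2"
          using abs_slope_le(2)[OF m, of k x v] by linarith
        then have "\<bar>slope (real (Suc k)) x v\<bar> * \<bar>\<eta> x\<bar> \<le> ((gnorm x)\<^sup>2 + (dnorm x v)\<^sup>2) * C"
          by (intro mult_mono C) auto
        then show ?thesis using True by (simp add: abs_mult mult.commute)
      qed (use out C in simp)
    qed
  qed measurable
  moreover have "(LBINT x. trunc (real (Suc k)) (gnorm x) * frechet_derivative \<eta> (at x) v)
      = - (LBINT x. slope (real (Suc k)) x v * \<eta> x)" for k
    by (rule chain_rule_trunc[OF m \<rho> sm out])
  ultimately show ?thesis by (simp only:) (rule LIMSEQ_unique)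
qed

end

section \<open>Monotonicity of the frequency\<close>

lemma bump_has_derivative_radius:
  fixes x :: "'a::real_inner"
  assumes "0 < r"
  shows "((\<lambda>r. bump k r x) has_real_derivative
    (bump (k + 2) r x - real k * bump (k + 1) r x) * (2 * (x \<bullet> x) / r ^ 3)) (at r)"
proof -
  have "((\<lambda>r. 1 - (x \<bullet> x) / r\<^sup>2) has_real_derivative 2 * (x \<bullet> x) / r ^ 3) (at r)"
    using assms by (auto intro!: derivative_eq_intros simp: field_simps power2_eq_square power3_eq_cube)
  from DERIV_chain2[OF flat_has_derivative this] show ?thesis
    by (simp add: bump_def)
qed

lemma bump_inner_le:
  assumes "0 < r"
  shows "bump k r x * (x \<bullet> x) \<le> fact k * r\<^sup>2"
proof (cases "norm x < r")
  case True
  then have "x \<bullet> x \<le> r\<^sup>2" by (simp add: dot_square_norm power_mono)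
  then show ?thesis by (intro mult_mono bump_le) auto
next
  case False
  then show ?thesis using assms by (simp add: bump_outside)
qed

lemma bump_integrable:
  fixes F :: "'a::euclidean_space \<Rightarrow> real"
  assumes F: "\<And>\<rho>. 0 < \<rho> \<Longrightarrow> \<rho> < 1 \<Longrightarrow> integrable lborel (\<lambda>x. indicat_real (ball 0 \<rho>) x * F x)"
    and r: "0 < r" "r < 1"
  shows "integrable lborel (\<lambda>x. F x * bump k r x)"
    and "integrable lborel (\<lambda>x. F x * (bump k r x * (x \<bullet> x)))"
proof -
  have b: "indicat_real (ball 0 r) x * F x * bump k r x = F x * bump k r x" for x :: 'a
    using bump_outside[OF r(1), of x k] by (auto simp: indicator_def)
  have "integrable lborel (\<lambda>x. indicat_real (ball 0 r) x * F x * bump k r x)"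
    by (rule integrable_mult_bounded[OF F[OF r] _ bump_abs_le]) measurable
  then show "integrable lborel (\<lambda>x. F x * bump k r x)" by (simp only: b)
  have "\<bar>bump k r x * (x \<bullet> x)\<bar> \<le> fact k * r\<^sup>2" for x :: 'a
    using bump_inner_le[OF r(1), of k x] by simp
  from integrable_mult_bounded[OF F[OF r] _ this]
  have "integrable lborel (\<lambda>x. indicat_real (ball 0 r) x * F x * (bump k r x * (x \<bullet> x)))" by simp
  moreover have "indicat_real (ball 0 r) x * F x * (bump k r x * (x \<bullet> x)) = F x * (bump k r x * (x \<bullet> x))" for x
    by (simp only: mult.assoc[symmetric] b)
  ultimately show "integrable lborel (\<lambda>x. F x * (bump k r x * (x \<bullet> x)))"
    by (simp only:)
qed

text \<open>The derivative of \<open>bump k\<close> in \<open>r\<close> is bounded near each \<open>r > 0\<close> because \<open>x \<bullet> x \<le> r\<^sup>2\<close> on its support. As \<open>F\<close> is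
integrable only on smaller balls, it is first cut off at a radius between \<open>r\<close> and 1.\<close>

lemma bump_integral_has_derivative:
  fixes F :: "'a::euclidean_space \<Rightarrow> real"
  assumes F: "\<And>\<rho>. 0 < \<rho> \<Longrightarrow> \<rho> < 1 \<Longrightarrow> integrable lborel (\<lambda>x. indicat_real (ball 0 \<rho>) x * F x)"
    and r: "0 < r" "r < 1" and k': "k1 = k + 1" "k2 = k + 2"
  shows "((\<lambda>r. LBINT x. F x * bump k r x) has_real_derivative
    (LBINT x. F x * ((bump k2 r x - real k * bump k1 r x) * (2 * (x \<bullet> x) / r ^ 3)))) (at r)"
proof -
  define \<rho> where "\<rho> = (1 + r) / 2"
  have \<rho>: "0 < \<rho>" "\<rho> < 1" "r < \<rho>" using r by (auto simp: \<rho>_def)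
  define G where "G x = indicat_real (ball 0 \<rho>) x * F x" for x
  have G: "integrable lborel G" unfolding G_def by (rule F[OF \<rho>(1,2)])
  let ?b' = "\<lambda>r x. (bump (k + 2) r x - real k * bump (k + 1) r x) * (2 * (x \<bullet> x) / r ^ 3)"
  have "((\<lambda>r. LBINT x. G x * bump k r x) has_real_derivative (LBINT x. G x * ?b' r x)) (at r)"
  proof (rule has_real_derivative_integral[OF G, where B = "fact k" and U = "{r / 2<..}"
        and B' = "(fact (k + 2) + real k * fact (k + 1)) * (4 / r)"])
    show "\<bar>bump k s x\<bar> \<le> fact k" for s and x :: 'a by (rule bump_abs_le)
    show "open {r / 2<..}" "convex {r / 2<..}" "r \<in> {r / 2<..}" using r by auto
    show "((\<lambda>r. bump k r x) has_real_derivative ?b' s x) (at s)" if "s \<in> {r / 2<..}" for s and x :: 'a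
      by (rule bump_has_derivative_radius) (use that r in auto)
    show "\<bar>?b' s x\<bar> \<le> (fact (k + 2) + real k * fact (k + 1)) * (4 / r)" if "s \<in> {r / 2<..}" for s and x :: 'a
    proof -
      have s: "0 < s" "r / 2 < s" using that r by auto
      have Y: "0 \<le> 2 * (x \<bullet> x) / s ^ 3" using s(1) by simp
      have "0 \<le> bump (k + 2) s x" "0 \<le> real k * bump (k + 1) s x" by simp_all
      then have "\<bar>bump (k + 2) s x - real k * bump (k + 1) s x\<bar> \<le> bump (k + 2) s x + real k * bump (k + 1) s x"
        by linarith
      then have "\<bar>?b' s x\<bar> \<le> (bump (k + 2) s x + real k * bump (k + 1) s x) * (2 * (x \<bullet> x) / s ^ 3)"
        unfolding abs_mult abs_of_nonneg[OF Y] by (rule mult_right_mono[OF _ Y])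
      also have "\<dots> = (bump (k + 2) s x * (x \<bullet> x) + real k * (bump (k + 1) s x * (x \<bullet> x))) * (2 / s ^ 3)"
        by (simp add: algebra_simps)
      also have "\<dots> \<le> (fact (k + 2) * s\<^sup>2 + real k * (fact (k + 1) * s\<^sup>2)) * (2 / s ^ 3)"
        using s(1) by (intro mult_right_mono add_mono mult_left_mono bump_inner_le) auto
      also have "\<dots> = (fact (k + 2) + real k * fact (k + 1)) * (2 / s)"
        using s(1) by (simp add: field_simps power2_eq_square power3_eq_cube del: fact_Suc)
      also have "\<dots> \<le> (fact (k + 2) + real k * fact (k + 1)) * (4 / r)"
        using s r by (intro mult_left_mono) (auto simp: field_simps)
      finally show ?thesis .
    qed
  qed measurable
  moreover have "(LBINT x. G x * ?b' r x) = (LBINT x. F x * ?b' r x)"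
  proof (intro Bochner_Integration.integral_cong refl)
    fix x
    show "G x * ?b' r x = F x * ?b' r x"
    proof (cases "norm x < \<rho>")
      case False
      then have "r \<le> norm x" using \<rho>(3) by simp
      then show ?thesis by (simp only: bump_outside[OF r(1)]) simp
    qed (simp add: G_def)
  qed
  ultimately have "((\<lambda>r. LBINT x. G x * bump k r x) has_real_derivative (LBINT x. F x * ?b' r x)) (at r)" by (simp only:)
  then show ?thesis
    unfolding k'
  proof (rule has_field_derivative_transform_within_open[of _ _ _ "{0<..<\<rho>}"])
    fix s assume "s \<in> {0<..<\<rho>}"
    then show "(LBINT x. G x * bump k s x) = (LBINT x. F x * bump k s x)"
    proof (intro Bochner_Integration.integral_cong refl)
      fix x
      show "G x * bump k s x = F x * bump k s x"
      proof (cases "norm x < \<rho>")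
        case False
        then have "bump k s x = 0" using \<open>s \<in> {0<..<\<rho>}\<close> by (intro bump_outside) auto
        then show ?thesis by simp
      qed (simp add: G_def)
    qed
  qed (use r \<rho> in auto)
qed

context Sobolev_tuple
begin

lemma g_L2_ball: "integrable lborel (\<lambda>x. indicat_real (ball 0 \<rho>) x * (gnorm x)\<^sup>2)"
  using integrable_mult_indicator[OF _ g_L2, of "ball 0 \<rho>"] by simp

lemma dnorm_le: "(dnorm x v)\<^sup>2 \<le> dirichlet x * (norm v)\<^sup>2"
proof -
  have "norm (A *v v) \<le> norm A * norm v" for A :: "real^'n^'m"
  proof -
    have "(norm (A *v v))\<^sup>2 = (A *v v) \<bullet> (A *v v)" by (rule power2_norm_eq_inner)
    also have "\<dots> = (\<Sum>i\<in>UNIV. ((A $ i) \<bullet> v)\<^sup>2)"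
      by (simp add: inner_vec_def[of "A *v v"] matrix_vector_mul_component power2_eq_square)
    also have "\<dots> \<le> (\<Sum>i\<in>UNIV. (norm (A $ i))\<^sup>2 * (norm v)\<^sup>2)"
      using Cauchy_Schwarz_ineq[of _ v] by (intro sum_mono) (simp add: power2_norm_eq_inner)
    also have "\<dots> = (\<Sum>i\<in>UNIV. (norm (A $ i))\<^sup>2) * (norm v)\<^sup>2"
      by (rule sum_distrib_right[symmetric])
    also have "(\<Sum>i\<in>UNIV. (norm (A $ i))\<^sup>2) = (norm A)\<^sup>2"
      by (simp add: norm_vec_def[of A] L2_set_def sum_nonneg)
    also have "(norm A)\<^sup>2 * (norm v)\<^sup>2 = (norm A * norm v)\<^sup>2" by (rule power_mult_distrib[symmetric])
    finally show ?thesis by (rule power2_le_imp_le) simp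
  qed
  then have "(norm (D i x *v v))\<^sup>2 \<le> (norm (D i x))\<^sup>2 * (norm v)\<^sup>2" for i
    unfolding power_mult_distrib[symmetric] by (rule power_mono) simp
  then show ?thesis
    unfolding dnorm_def tnorm_sq sum_distrib_right by (intro sum_mono)
qed

lemma radial_L2_ball:
  assumes "0 < \<rho>" "\<rho> < 1"
  shows "integrable lborel (\<lambda>x. indicat_real (ball 0 \<rho>) x * (dnorm x x)\<^sup>2)"
proof (rule Bochner_Integration.integrable_bound[OF D_L2[OF assms]])
  have [measurable]: "ball (0::real^'n) r \<in> sets borel" for r by simp
  show "(\<lambda>x. indicat_real (ball 0 \<rho>) x * (dnorm x x)\<^sup>2) \<in> borel_measurable lborel" by measurable
  show "AE x in lborel. norm (indicat_real (ball 0 \<rho>) x * (dnorm x x)\<^sup>2) \<le> norm (indicat_real (ball 0 \<rho>) x * dirichlet x)" (is "AE x in _. ?P x")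
  proof (rule AE_I2)
    fix x
    show "?P x"
    proof (cases "x \<in> ball 0 \<rho>")
      case True
      then have "(norm x)\<^sup>2 \<le> 1" using assms by (simp add: power_le_one)
      then have "(dnorm x x)\<^sup>2 \<le> dirichlet x"
        using dnorm_le[of x x] mult_left_le[of "(norm x)\<^sup>2" "dirichlet x"] by (simp add: sum_nonneg)
      then show ?thesis using True by (simp add: sum_nonneg)
    qed simp
  qed
qed

lemma pairing_L1_ball:
  assumes v [measurable]: "v \<in> borel_measurable borel"
    and int: "integrable lborel (\<lambda>x. indicat_real (ball 0 \<rho>) x * (dnorm x (v x))\<^sup>2)"
  shows "integrable lborel (\<lambda>x. indicat_real (ball 0 \<rho>) x * (\<Sum>i<Q. g i x \<bullet> (D i x *v v x)))"
proof (rule Bochner_Integration.integrable_bound[OF Bochner_Integration.integrable_add[OF g_L2_ball int]])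
  have [measurable]: "ball (0::real^'n) r \<in> sets borel" for r by simp
  show "(\<lambda>x. indicat_real (ball 0 \<rho>) x * (\<Sum>i<Q. g i x \<bullet> (D i x *v v x))) \<in> borel_measurable lborel" by measurable
  show "AE x in lborel. norm (indicat_real (ball 0 \<rho>) x * (\<Sum>i<Q. g i x \<bullet> (D i x *v v x)))
      \<le> norm (indicat_real (ball 0 \<rho>) x * (gnorm x)\<^sup>2 + indicat_real (ball 0 \<rho>) x * (dnorm x (v x))\<^sup>2)"
    (is "AE x in _. ?P x")
  proof (rule AE_I2)
    fix x
    have "2 * (gnorm x * dnorm x (v x)) \<le> (gnorm x)\<^sup>2 + (dnorm x (v x))\<^sup>2"
      using zero_le_power2[of "gnorm x - dnorm x (v x)"] by (simp add: power2_diff)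
    moreover have "0 \<le> gnorm x * dnorm x (v x)" by simp
    ultimately have "\<bar>\<Sum>i<Q. g i x \<bullet> (D i x *v v x)\<bar> \<le> (gnorm x)\<^sup>2 + (dnorm x (v x))\<^sup>2"
      using abs_inner_le[of x "v x"] by linarith
    then show "?P x" by (cases "x \<in> ball 0 \<rho>") simp_all
  qed
qed

lemma inner_L1_ball:
  assumes "0 < \<rho>" "\<rho> < 1"
  shows "integrable lborel (\<lambda>x. indicat_real (ball 0 \<rho>) x * pairing x x)"
  by (rule pairing_L1_ball[OF _ radial_L2_ball[OF assms]]) simp

end

text \<open>Stationarity enters only through the two identities below. They result from the outer variation
\<open>bump 0 r x *\<^sub>R u\<close> and the inner variation \<open>bump 0 r x *\<^sub>R x\<close>, see \<open>outer_stationary_bump\<close> and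
\<open>inner_stationary_bump\<close>.\<close>

locale stationary_tuple = Sobolev_tuple Q g D \<Phi>
  for Q and g :: "nat \<Rightarrow> real^'n \<Rightarrow> real^'m" and D :: "nat \<Rightarrow> real^'n \<Rightarrow> real^'n^'m" and \<Phi> +
  assumes outer_variation: "\<And>r. 0 < r \<Longrightarrow> r < 1 \<Longrightarrow>
      (LBINT x. dirichlet x * bump 0 r x) = 2 / r\<^sup>2 * (LBINT x. pairing x x * bump 2 r x)"
    and inner_variation: "\<And>r. 0 < r \<Longrightarrow> r < 1 \<Longrightarrow>
      2 / r\<^sup>2 * (LBINT x. dirichlet x * (bump 2 r x * (x \<bullet> x))) =
        (real CARD('n) - 2) * (LBINT x. dirichlet x * bump 0 r x)
        + 4 / r\<^sup>2 * (LBINT x. (dnorm x x)\<^sup>2 * bump 2 r x)"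
begin

text \<open>The quantities \<open>D\<close>, \<open>H\<close> and \<open>E\<close> of the frequency argument.\<close>

definition energy :: "real \<Rightarrow> real" where
  "energy r = (LBINT x. dirichlet x * bump 0 r x)"

definition height :: "real \<Rightarrow> real" where
  "height r = (LBINT x. (gnorm x)\<^sup>2 * bump 2 r x)"

definition radial :: "real \<Rightarrow> real" where
  "radial r = (LBINT x. (dnorm x x)\<^sup>2 * bump 2 r x)"

lemma outer_energy:
  assumes "0 < r" "r < 1"
  shows "2 * (LBINT x. pairing x x * bump 2 r x) = r\<^sup>2 * energy r"
  using outer_variation[OF assms] assms by (simp add: energy_def field_simps)

lemma energy_derivative:
  assumes r: "0 < r" "r < 1"
  shows "(energy has_real_derivative ((real CARD('n) - 2) * energy r + 4 / r\<^sup>2 * radial r) / r) (at r)"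
proof -
  let ?e = "\<lambda>x. dirichlet x"
  have "(LBINT x. ?e x * ((bump 2 r x - real 0 * bump 1 r x) * (2 * (x \<bullet> x) / r ^ 3)))
      = (LBINT x. (2 / r ^ 3) * (?e x * (bump 2 r x * (x \<bullet> x))))"
    by (intro Bochner_Integration.integral_cong) (auto simp: field_simps)
  also have "\<dots> = (2 / r ^ 3) * (LBINT x. ?e x * (bump 2 r x * (x \<bullet> x)))"
    by (rule integral_mult_right_zero)
  also have "\<dots> = (2 / r\<^sup>2 * (LBINT x. ?e x * (bump 2 r x * (x \<bullet> x)))) / r"
    using r by (simp add: field_simps power2_eq_square power3_eq_cube)
  also have "\<dots> = ((real CARD('n) - 2) * energy r + 4 / r\<^sup>2 * radial r) / r"
    unfolding inner_variation[OF r] energy_def radial_def ..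
  finally show ?thesis
    using bump_integral_has_derivative[OF D_L2 r, of 1 0 2] unfolding energy_def[abs_def] by simp
qed

text \<open>Both \<open>H'\<close> and the outer variation are reached from the divergence of the radial field \<open>bump 2 r x *\<^sub>R x\<close>:
the chain rule turns \<open>\<integral> |f|\<^sup>2 div (bump 2 r x *\<^sub>R x)\<close> into \<open>- 2 \<integral> bump 2 r x f \<bullet> Df x = - r\<^sup>2 D\<close>, while the
divergence itself is \<open>n bump 2 r x\<close> minus \<open>r\<close> times the \<open>r\<close>-derivative of \<open>bump 2 r x\<close>.\<close>

lemma height_derivative:
  assumes r: "0 < r" "r < 1"
  shows "(height has_real_derivative (real CARD('n) * height r + r\<^sup>2 * energy r) / r) (at r)"
proof -
  let ?F = "\<lambda>x. (gnorm x)\<^sup>2" and ?b' = "\<lambda>x. bump 4 r x - 2 * bump 3 r x"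
  have iF: "integrable lborel (\<lambda>x. ?F x * bump k r x)" "integrable lborel (\<lambda>x. ?F x * (bump k r x * (x \<bullet> x)))" for k
    using bump_integrable[of ?F, OF g_L2_ball r] by auto
  have iF': "integrable lborel (\<lambda>x. ?F x * (?b' x * (x \<bullet> x)))"
  proof -
    have "integrable lborel (\<lambda>x. ?F x * (bump 4 r x * (x \<bullet> x)) - 2 * (?F x * (bump 3 r x * (x \<bullet> x))))"
      using iF by (intro Bochner_Integration.integrable_diff integrable_mult_right)
    then show ?thesis by (simp add: algebra_simps)
  qed
  \<comment> \<open>the chain rule for the \<open>j\<close>-th component of the radial field; both sides are summed over \<open>j\<close> below\<close>
  have cr: "(LBINT x. ?F x * (bump 2 r x + x $ j * (?b' x * (- (2 / r\<^sup>2) * x $ j))))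
      = - (LBINT x. 2 * pairing x (axis j 1) * (x $ j * bump 2 r x))"
    and intj: "integrable lborel (\<lambda>x. ?F x * (bump 2 r x + x $ j * (?b' x * (- (2 / r\<^sup>2) * x $ j))))"
    and intr: "integrable lborel (\<lambda>x. 2 * pairing x (axis j 1) * (x $ j * bump 2 r x))" for j
  proof -
    have bl: "bounded_linear (\<lambda>x::real^'n. x $ j)" by (rule bounded_linear_vec_nth)
    have sm: "smooth_on UNIV (\<lambda>x. x $ j * bump 2 r x)"
      by (intro smooth_on_mult smooth_on_bounded_linear bl smooth_on_bump)
    define d where "d x v = x $ j * (?b' x * (- (2 / r\<^sup>2) * (x \<bullet> v))) + v $ j * bump 2 r x" for x v :: "real^'n"
    have "((\<lambda>x. x $ j * bump 2 r x) has_derivative d x) (at x)" for x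
      unfolding d_def
      using has_derivative_mult[OF bounded_linear_imp_has_derivative[OF bl] bump_has_derivative[of 2 r x]]
      by simp
    from frechet_derivative_at[OF this]
    have "frechet_derivative (\<lambda>x. x $ j * bump 2 r x) (at x) = d x" for x by (rule sym)
    then have fd: "frechet_derivative (\<lambda>x. x $ j * bump 2 r x) (at x) (axis j 1)
        = bump 2 r x + x $ j * (?b' x * (- (2 / r\<^sup>2) * x $ j))" for x
      by (simp add: d_def inner_axis)
    have out: "r \<le> norm x \<Longrightarrow> x $ j * bump 2 r x = 0" for x by (simp add: bump_outside[OF r(1)])
    have dc: "continuous_on UNIV (\<lambda>x. frechet_derivative (\<lambda>x. x $ j * bump 2 r x) (at x) (axis j 1))"
      by (intro smooth_on_continuous smooth_on_frechet_derivative sm)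
    have out': "r < norm x \<Longrightarrow> x $ j * bump 2 r x = 0" for x using out[of x] by simp
    have "frechet_derivative (\<lambda>x. x $ j * bump 2 r x) (at x) (axis j 1) = 0" if "r < norm x" for x
      by (rule frechet_derivative_zero_outside[OF out' that])
    from continuous_compact_support_bounded[OF dc this]
    obtain C where C: "\<And>x. \<bar>frechet_derivative (\<lambda>x. x $ j * bump 2 r x) (at x) (axis j 1)\<bar> \<le> C"
      by blast
    show "integrable lborel (\<lambda>x. ?F x * (bump 2 r x + x $ j * (?b' x * (- (2 / r\<^sup>2) * x $ j))))"
      using C unfolding fd by (intro integrable_mult_bounded[OF g_L2]) measurable
    obtain C where C: "\<And>x. \<bar>x $ j * bump 2 r x\<bar> \<le> C"
      using continuous_compact_support_bounded[OF smooth_on_continuous[OF sm] out'] by blast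
    have "integrable lborel (\<lambda>x. 2 * (indicat_real (ball 0 r) x * pairing x (axis j 1)) * (x $ j * bump 2 r x))"
      using C by (intro integrable_mult_bounded integrable_mult_right pairing_L1_ball dnorm_L2[OF r]) measurable
    moreover have "2 * (indicat_real (ball 0 r) x * pairing x (axis j 1)) * (x $ j * bump 2 r x)
        = 2 * pairing x (axis j 1) * (x $ j * bump 2 r x)" for x
      using out[of x] by (cases "norm x < r") simp_all
    ultimately show "integrable lborel (\<lambda>x. 2 * pairing x (axis j 1) * (x $ j * bump 2 r x))"
      by (simp only:)
    show "(LBINT x. ?F x * (bump 2 r x + x $ j * (?b' x * (- (2 / r\<^sup>2) * x $ j))))
        = - (LBINT x. 2 * pairing x (axis j 1) * (x $ j * bump 2 r x))"
      using chain_rule[OF r sm out, of "axis j 1"] unfolding fd .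
  qed
  have xx: "x \<bullet> x = (\<Sum>j\<in>UNIV. x $ j * x $ j)" for x :: "real^'n" by (simp add: inner_vec_def)
  have lhs: "(\<Sum>j\<in>UNIV. LBINT x. ?F x * (bump 2 r x + x $ j * (?b' x * (- (2 / r\<^sup>2) * x $ j))))
      = real CARD('n) * height r - 2 / r\<^sup>2 * (LBINT x. ?F x * (?b' x * (x \<bullet> x)))"
  proof -
    have "(\<Sum>j\<in>UNIV. LBINT x. ?F x * (bump 2 r x + x $ j * (?b' x * (- (2 / r\<^sup>2) * x $ j))))
        = (LBINT x. \<Sum>j\<in>UNIV. ?F x * (bump 2 r x + x $ j * (?b' x * (- (2 / r\<^sup>2) * x $ j))))"
      by (rule Bochner_Integration.integral_sum[symmetric]) (rule intj)
    also have "\<dots> = (LBINT x. real CARD('n) * (?F x * bump 2 r x) - 2 / r\<^sup>2 * (?F x * (?b' x * (x \<bullet> x))))"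
    proof (intro Bochner_Integration.integral_cong refl)
      fix x :: "real^'n"
      have "(\<Sum>j\<in>UNIV. ?F x * (bump 2 r x + x $ j * (?b' x * (- (2 / r\<^sup>2) * x $ j))))
          = (\<Sum>j\<in>UNIV. ?F x * bump 2 r x - (2 / r\<^sup>2 * (?F x * ?b' x)) * (x $ j * x $ j))"
        by (intro sum.cong refl) (simp add: algebra_simps)
      also have "\<dots> = real CARD('n) * (?F x * bump 2 r x) - (2 / r\<^sup>2 * (?F x * ?b' x)) * (x \<bullet> x)"
        unfolding xx sum_subtractf sum_distrib_left by simp
      finally show "(\<Sum>j\<in>UNIV. ?F x * (bump 2 r x + x $ j * (?b' x * (- (2 / r\<^sup>2) * x $ j))))
          = real CARD('n) * (?F x * bump 2 r x) - 2 / r\<^sup>2 * (?F x * (?b' x * (x \<bullet> x)))"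
        by (simp add: mult.assoc)
    qed
    also have "\<dots> = real CARD('n) * height r - 2 / r\<^sup>2 * (LBINT x. ?F x * (?b' x * (x \<bullet> x)))"
      using iF(1)[of 2] iF' by (simp add: height_def)
    finally show ?thesis .
  qed
  have rhs: "(\<Sum>j\<in>UNIV. - (LBINT x. 2 * pairing x (axis j 1) * (x $ j * bump 2 r x)))
      = - (r\<^sup>2 * energy r)"
  proof -
    have "(\<Sum>j\<in>UNIV. (LBINT x. 2 * pairing x (axis j 1) * (x $ j * bump 2 r x)))
        = (LBINT x. \<Sum>j\<in>UNIV. 2 * pairing x (axis j 1) * (x $ j * bump 2 r x))"
      by (rule Bochner_Integration.integral_sum[symmetric]) (rule intr)
    also have "\<dots> = (LBINT x. 2 * (pairing x x * bump 2 r x))"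
    proof (intro Bochner_Integration.integral_cong refl)
      fix x :: "real^'n"
      have Dx: "D i x *v x = (\<Sum>j\<in>UNIV. x $ j *\<^sub>R (D i x *v axis j 1))" for i
      proof -
        have "D i x *v x = D i x *v (\<Sum>j\<in>UNIV. x $ j *\<^sub>R axis j 1)"
          by (simp add: basis_expansion scalar_mult_eq_scaleR[symmetric])
        also have "\<dots> = (\<Sum>j\<in>UNIV. D i x *v (x $ j *\<^sub>R axis j 1))"
          by (rule linear_sum[OF matrix_vector_mul_linear])
        finally show ?thesis by (simp only: matrix_line)
      qed
      have "pairing x x = (\<Sum>j\<in>UNIV. x $ j * pairing x (axis j 1))"
        unfolding Dx inner_sum_right sum_distrib_left by (subst sum.swap) simp
      then show "(\<Sum>j\<in>UNIV. 2 * pairing x (axis j 1) * (x $ j * bump 2 r x))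
          = 2 * (pairing x x * bump 2 r x)"
        by (simp add: sum_distrib_left sum_distrib_right mult_ac)
    qed
    also have "\<dots> = r\<^sup>2 * energy r" using outer_energy[OF r] by simp
    finally show ?thesis by (simp add: sum_negf)
  qed
  have key: "2 / r\<^sup>2 * (LBINT x. ?F x * (?b' x * (x \<bullet> x))) = real CARD('n) * height r + r\<^sup>2 * energy r"
    using lhs rhs unfolding cr by simp
  have "(LBINT x. ?F x * ((bump 4 r x - real 2 * bump 3 r x) * (2 * (x \<bullet> x) / r ^ 3)))
      = (LBINT x. (2 / r ^ 3) * (?F x * (?b' x * (x \<bullet> x))))"
    by (intro Bochner_Integration.integral_cong) (auto simp: field_simps)
  also have "\<dots> = (2 / r ^ 3) * (LBINT x. ?F x * (?b' x * (x \<bullet> x)))"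
    by (rule integral_mult_right_zero)
  also have "\<dots> = (2 / r\<^sup>2 * (LBINT x. ?F x * (?b' x * (x \<bullet> x)))) / r"
    using r by (simp add: field_simps power2_eq_square power3_eq_cube)
  also have "\<dots> = (real CARD('n) * height r + r\<^sup>2 * energy r) / r"
    unfolding key ..
  finally show ?thesis
    using bump_integral_has_derivative[of ?F, OF g_L2_ball r, of 3 2 4] unfolding height_def[abs_def] by simp
qed


lemma height_nonneg: "0 \<le> height r"
  unfolding height_def by (rule integral_nonneg_AE) simp

text \<open>The quadratic polynomial \<open>s\<^sup>2 H + s r\<^sup>2 D + E\<close> is the integral of a function that is at least
\<open>(|s| |f| - |Df x|)\<^sup>2 bump 2 r x\<close>, so it is nonnegative; its minimum gives the inequality.\<close>

lemma Cauchy_Schwarz_frequency: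
  assumes r: "0 < r" "r < 1" and pos: "0 < height r"
  shows "(r\<^sup>2 * energy r)\<^sup>2 \<le> 4 * height r * radial r"
proof -
  let ?S = "\<lambda>x. pairing x x"
  have i: "integrable lborel (\<lambda>x. (gnorm x)\<^sup>2 * bump 2 r x)" "integrable lborel (\<lambda>x. ?S x * bump 2 r x)"
    "integrable lborel (\<lambda>x. (dnorm x x)\<^sup>2 * bump 2 r x)"
    using bump_integrable(1)[of "\<lambda>x. (gnorm x)\<^sup>2", OF g_L2_ball r] bump_integrable(1)[of ?S, OF inner_L1_ball r]
      bump_integrable(1)[of "\<lambda>x. (dnorm x x)\<^sup>2", OF radial_L2_ball r] by blast+
  have q: "0 \<le> s\<^sup>2 * height r + s * (r\<^sup>2 * energy r) + radial r" for s
  proof -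
    have "0 \<le> (LBINT x. s\<^sup>2 * ((gnorm x)\<^sup>2 * bump 2 r x) + 2 * s * (?S x * bump 2 r x) + (dnorm x x)\<^sup>2 * bump 2 r x)"
    proof (rule integral_nonneg_AE, rule AE_I2)
      fix x
      have "\<bar>s * ?S x\<bar> \<le> \<bar>s\<bar> * (gnorm x * dnorm x x)"
        unfolding abs_mult by (intro mult_left_mono abs_inner_le) simp
      then have "- (2 * (\<bar>s\<bar> * (gnorm x * dnorm x x))) \<le> 2 * (s * ?S x)"
        by linarith
      then have "- (2 * (\<bar>s\<bar> * (gnorm x * dnorm x x))) \<le> 2 * s * ?S x"
        by (simp only: mult.assoc)
      moreover have "0 \<le> (\<bar>s\<bar> * gnorm x - dnorm x x)\<^sup>2" by simp
      then have "0 \<le> s\<^sup>2 * (gnorm x)\<^sup>2 - 2 * (\<bar>s\<bar> * (gnorm x * dnorm x x)) + (dnorm x x)\<^sup>2"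
        by (simp add: power2_diff power_mult_distrib mult.assoc)
      ultimately have "0 \<le> s\<^sup>2 * (gnorm x)\<^sup>2 + 2 * s * ?S x + (dnorm x x)\<^sup>2" by linarith
      then have "0 \<le> (s\<^sup>2 * (gnorm x)\<^sup>2 + 2 * s * ?S x + (dnorm x x)\<^sup>2) * bump 2 r x"
        by (intro mult_nonneg_nonneg) auto
      then show "0 \<le> s\<^sup>2 * ((gnorm x)\<^sup>2 * bump 2 r x) + 2 * s * (?S x * bump 2 r x) + (dnorm x x)\<^sup>2 * bump 2 r x"
        by (simp only: distrib_right mult.assoc)
    qed
    also have "\<dots> = s\<^sup>2 * height r + 2 * s * (LBINT x. ?S x * bump 2 r x) + radial r"
      using i by (simp add: height_def radial_def)
    also have "2 * s * (LBINT x. ?S x * bump 2 r x) = s * (r\<^sup>2 * energy r)"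
      unfolding outer_energy[OF r, symmetric] by simp
    finally show ?thesis .
  qed
  define e where "e = r\<^sup>2 * energy r"
  \<comment> \<open>the minimum point of the quadratic polynomial\<close>
  define s where "s = - e / (2 * height r)"
  have "s\<^sup>2 * height r + s * e = - (e\<^sup>2 / (4 * height r))"
    using pos by (simp add: s_def power2_eq_square field_simps)
  then have "e\<^sup>2 / (4 * height r) \<le> radial r"
    using q[of s] by (simp add: e_def)
  then show ?thesis
    using pos by (simp add: pos_divide_le_eq e_def mult_ac)
qed

definition frequency :: "real \<Rightarrow> real" where
  "frequency r = r\<^sup>2 * energy r / height r"

text \<open>After multiplication by \<open>r H\<^sup>2\<close>, the terms with \<open>n\<close> cancel and \<open>4 H E - (r\<^sup>2 D)\<^sup>2\<close> remains.\<close>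

lemma frequency_derivative_nonneg:
  assumes r: "0 < r" "r < 1" and pos: "0 < height r"
  shows "\<exists>d. (frequency has_real_derivative d) (at r) \<and> 0 \<le> d"
proof -
  define n where "n = real CARD('n)"
  define e' where "e' = ((n - 2) * energy r + 4 / r\<^sup>2 * radial r) / r"
  define h' where "h' = (n * height r + r\<^sup>2 * energy r) / r"
  have num: "((\<lambda>r. r\<^sup>2 * energy r) has_real_derivative (2 * r * energy r + r\<^sup>2 * e')) (at r)"
    using energy_derivative[OF r] unfolding e'_def n_def
    by (auto intro!: derivative_eq_intros)
  have den: "(height has_real_derivative h') (at r)"
    using height_derivative[OF r] unfolding h'_def n_def .
  have "(frequency has_real_derivative
      ((2 * r * energy r + r\<^sup>2 * e') * height r - (r\<^sup>2 * energy r) * h') / (height r * height r)) (at r)"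
    unfolding frequency_def[abs_def] using pos by (intro DERIV_divide num den) simp
  moreover have "0 \<le> ((2 * r * energy r + r\<^sup>2 * e') * height r - (r\<^sup>2 * energy r) * h') / (height r * height r)"
  proof -
    have re: "r * e' = (n - 2) * energy r + 4 / r\<^sup>2 * radial r" and rh: "r * h' = n * height r + r\<^sup>2 * energy r"
      using r by (simp_all add: e'_def h'_def)
    have "r * ((2 * r * energy r + r\<^sup>2 * e') * height r - (r\<^sup>2 * energy r) * h')
        = 2 * r\<^sup>2 * energy r * height r + r\<^sup>2 * (r * e') * height r - (r\<^sup>2 * energy r) * (r * h')"
      by (simp add: algebra_simps power2_eq_square)
    also have "\<dots> = 4 * (r\<^sup>2 / r\<^sup>2) * radial r * height r - (r\<^sup>2 * energy r)\<^sup>2"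
      unfolding re rh by (simp add: algebra_simps power2_eq_square)
    also have "\<dots> = 4 * height r * radial r - (r\<^sup>2 * energy r)\<^sup>2" using r by simp
    also have "0 \<le> \<dots>" using Cauchy_Schwarz_frequency[OF r pos] by simp
    finally have "0 \<le> (2 * r * energy r + r\<^sup>2 * e') * height r - (r\<^sup>2 * energy r) * h'"
      using r by (simp add: zero_le_mult_iff)
    then show ?thesis by simp
  qed
  ultimately show ?thesis by blast
qed

text \<open>As the frequency on the interval is at most its value at \<open>r\<close>, the derivative of \<open>H t / t ^ K\<close> is not
positive.\<close>

lemma height_growth:
  assumes s: "0 < s" "s \<le> r" "r < 1" and pos: "\<And>t. s \<le> t \<Longrightarrow> t \<le> r \<Longrightarrow> 0 < height t"
    and K: "real CARD('n) + frequency r \<le> real K"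
  shows "height r / r ^ K \<le> height s / s ^ K"
proof (rule DERIV_nonpos_imp_nonincreasing[OF s(2)])
  fix t assume t: "s \<le> t" "t \<le> r"
  then have t01: "0 < t" "t < 1" using s by auto
  have "frequency t \<le> frequency r"
  proof (rule DERIV_nonneg_imp_nondecreasing[OF t(2)])
    fix u assume u: "t \<le> u" "u \<le> r"
    then have "0 < u" "u < 1" "0 < height u" using t s pos by auto
    from frequency_derivative_nonneg[OF this]
    show "\<exists>y. (frequency has_real_derivative y) (at u) \<and> 0 \<le> y" .
  qed
  then have "(real CARD('n) + frequency t) * height t \<le> real K * height t"
    using K pos[OF t] by (intro mult_right_mono) auto
  moreover have "frequency t * height t = t\<^sup>2 * energy t"
    using pos[OF t] by (simp add: frequency_def)
  ultimately have le: "real CARD('n) * height t + t\<^sup>2 * energy t \<le> real K * height t"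
    by (simp add: distrib_right)
  define h' where "h' = (real CARD('n) * height t + t\<^sup>2 * energy t) / t"
  have h': "h' \<le> real K * height t / t"
    unfolding h'_def using le t01 by (intro divide_right_mono) auto
  have "((\<lambda>t. height t / t ^ K) has_real_derivative
      (h' * t ^ K - height t * (real K * t ^ (K - 1))) / (t ^ K * t ^ K)) (at t)"
    using t01 by (intro DERIV_divide height_derivative[OF t01, folded h'_def])
      (auto intro!: derivative_eq_intros)
  moreover have "(h' * t ^ K - height t * (real K * t ^ (K - 1))) / (t ^ K * t ^ K) \<le> 0"
  proof -
    have "real K * t ^ (K - 1) = real K * t ^ K / t"
      using t01 by (cases K) auto
    then have "h' * t ^ K - height t * (real K * t ^ (K - 1)) = (h' - real K * height t / t) * t ^ K"
      by (simp add: left_diff_distrib)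
    also have "\<dots> \<le> 0" using h' t01 by (intro mult_nonpos_nonneg) auto
    finally show ?thesis using t01 by (intro divide_nonpos_nonneg) auto
  qed
  ultimately show "\<exists>y. ((\<lambda>t. height t / t ^ K) has_real_derivative y) (at t) \<and> y \<le> 0" by blast
qed

text \<open>To the right of a largest zero of \<open>H\<close> below \<open>r0\<close>, \<open>height_growth\<close> keeps \<open>H\<close> away from 0, which contradicts
continuity at that zero. So \<open>H\<close> has no zeros and the growth estimate holds on the whole interval.\<close>

lemma height_lower_bound:
  assumes r0: "0 < r0" "r0 < 1" and pos: "0 < height r0"
  shows "\<exists>K c. 0 < c \<and> (\<forall>r. 0 < r \<longrightarrow> r \<le> r0 \<longrightarrow> c * r ^ K \<le> height r)"
proof -
  obtain K :: nat where K: "real CARD('n) + frequency r0 \<le> real K"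
    using real_arch_simple by blast
  define c where "c = height r0 / r0 ^ K"
  have c: "0 < c" using pos r0 by (simp add: c_def)
  have bound: "c * r ^ K \<le> height r" if r: "0 < r" "r \<le> r0" and p: "\<And>t. r \<le> t \<Longrightarrow> t \<le> r0 \<Longrightarrow> 0 < height t" for r
  proof -
    have "c \<le> height r / r ^ K"
      unfolding c_def by (rule height_growth[OF r r0(2) p K])
    then show ?thesis using r by (simp add: pos_le_divide_eq)
  qed
  have allpos: "0 < height r1" if r1: "0 < r1" "r1 \<le> r0" for r1
  proof (rule ccontr)
    assume "\<not> 0 < height r1"
    then have z1: "height r1 = 0" using height_nonneg[of r1] by simp
    have cont: "isCont height r" if "0 < r" "r < 1" for r
      using height_derivative[OF that] by (rule DERIV_isCont)
    define Z where "Z = {r \<in> {r1..r0}. height r = 0}"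
    have "closed Z"
      unfolding Z_def
      by (rule continuous_closed_preimage_constant) (use cont r1 r0 in \<open>auto intro!: continuous_at_imp_continuous_on\<close>)
    moreover have "bounded Z"
      by (rule bounded_subset[OF compact_imp_bounded[OF compact_Icc[of r1 r0]]]) (auto simp: Z_def)
    ultimately have "compact Z"
      by (simp only: compact_eq_bounded_closed)
    moreover have "r1 \<in> Z" using z1 r1 by (simp add: Z_def)
    ultimately obtain s where s: "s \<in> Z" "\<And>t. t \<in> Z \<Longrightarrow> t \<le> s"
      using compact_attains_sup[of Z] by blast
    have s': "r1 \<le> s" "s < r0" "height s = 0"
      using s(1) pos unfolding Z_def by (auto simp: less_le)
    have p: "0 < height t" if "s < t" "t \<le> r0" for t
    proof -
      have "t \<notin> Z" using s(2)[of t] that by auto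
      then have "height t \<noteq> 0" using that s' by (auto simp: Z_def)
      then show ?thesis using height_nonneg[of t] by simp
    qed
    have "(height \<longlongrightarrow> height s) (at_right s)"
      by (rule tendsto_within_subset[OF _ subset_UNIV]) (use cont[of s] s' r1 r0 in \<open>auto simp: isCont_def\<close>)
    moreover have "\<forall>\<^sub>F t in at_right s. c * s ^ K \<le> height t"
      unfolding eventually_at_right_field
    proof (intro exI conjI allI impI)
      show "s < r0" by (rule s'(2))
      fix t assume t: "s < t" "t < r0"
      have "c * s ^ K \<le> c * t ^ K" using c t s' r1 by (intro mult_left_mono power_mono) auto
      also have "\<dots> \<le> height t" using t s' r1 p by (intro bound) auto
      finally show "c * s ^ K \<le> height t" .
    qed
    ultimately have "c * s ^ K \<le> height s"
      by (rule tendsto_lowerbound) simp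
    moreover have "0 < c * s ^ K" using c s' r1 by simp
    ultimately show False using s'(3) by simp
  qed
  show ?thesis
    using c bound allpos by (intro exI[of _ K] exI[of _ c]) auto
qed

theorem infinite_order_vanishing:
  assumes decay: "\<And>N::nat. ((\<lambda>r. 1 / r ^ N * (LBINT x. indicat_real (ball 0 r) x * (gnorm x)\<^sup>2)) \<longlongrightarrow> 0) (at_right 0)"
  shows "AE x in lborel. norm x < 1 \<longrightarrow> gnorm x = 0"
proof -
  have h0: "height r0 = 0" if r0: "0 < r0" "r0 < 1" for r0
  proof (rule ccontr)
    assume "height r0 \<noteq> 0"
    then have "0 < height r0" using height_nonneg[of r0] by simp
    from height_lower_bound[OF r0 this] obtain K c where c: "0 < c"
      and lower: "\<And>r. 0 < r \<Longrightarrow> r \<le> r0 \<Longrightarrow> c * r ^ K \<le> height r" by blast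
    have "\<forall>\<^sub>F r in at_right 0. c / 2 \<le> 1 / r ^ K * (LBINT x. indicat_real (ball 0 r) x * (gnorm x)\<^sup>2)"
      unfolding eventually_at_right_field
    proof (intro exI conjI allI impI)
      show "0 < r0" by (rule r0(1))
      fix r assume r: "0 < r" "r < r0"
      have "height r \<le> (LBINT x. 2 * (indicat_real (ball 0 r) x * (gnorm x)\<^sup>2))"
        unfolding height_def
      proof (rule integral_mono)
        show "integrable lborel (\<lambda>x. (gnorm x)\<^sup>2 * bump 2 r x)"
          using bump_integrable(1)[of "\<lambda>x. (gnorm x)\<^sup>2", OF g_L2_ball] r r0 by auto
        show "integrable lborel (\<lambda>x. 2 * (indicat_real (ball 0 r) x * (gnorm x)\<^sup>2))"
          by (intro integrable_mult_right g_L2_ball)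
        fix x
        show "(gnorm x)\<^sup>2 * bump 2 r x \<le> 2 * (indicat_real (ball 0 r) x * (gnorm x)\<^sup>2)"
        proof (cases "norm x < r")
          case True
          have "bump 2 r x \<le> 2" using bump_le[of 2 r x] by (simp add: eval_nat_numeral)
          then have "(gnorm x)\<^sup>2 * bump 2 r x \<le> (gnorm x)\<^sup>2 * 2" by (intro mult_left_mono) auto
          then show ?thesis using True by simp
        qed (simp add: bump_outside[OF r(1)])
      qed
      then have "c * r ^ K \<le> 2 * (LBINT x. indicat_real (ball 0 r) x * (gnorm x)\<^sup>2)"
        using lower[of r] r by simp
      then show "c / 2 \<le> 1 / r ^ K * (LBINT x. indicat_real (ball 0 r) x * (gnorm x)\<^sup>2)"
        using r by (simp add: pos_le_divide_eq)
    qed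
    from tendsto_lowerbound[OF decay this] have "c / 2 \<le> 0" by simp
    then show False using c by simp
  qed
  have "AE x in lborel. \<forall>k::nat. norm x < 1 - 1 / real (Suc (Suc k)) \<longrightarrow> gnorm x = 0"
    unfolding AE_all_countable
  proof
    fix k :: nat
    define r where "r = 1 - 1 / real (Suc (Suc k))"
    have r: "0 < r" "r < 1" by (auto simp: r_def)
    have "AE x in lborel. (gnorm x)\<^sup>2 * bump 2 r x = 0"
      using h0[OF r] bump_integrable(1)[of "\<lambda>x. (gnorm x)\<^sup>2", OF g_L2_ball r, of 2] unfolding height_def
      by (subst (asm) integral_nonneg_eq_0_iff_AE) auto
    then show "AE x in lborel. norm x < 1 - 1 / real (Suc (Suc k)) \<longrightarrow> gnorm x = 0"
    proof eventually_elim
      case (elim x)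
      then show ?case using bump_pos[of x r 2] by (auto simp: r_def)
    qed
  qed
  then show ?thesis
  proof eventually_elim
    case (elim x)
    show ?case
    proof
      assume "norm x < 1"
      then obtain k where "inverse (real (Suc k)) < 1 - norm x"
        using reals_Archimedean[of "1 - norm x"] by auto
      moreover have "1 / real (Suc (Suc k)) \<le> inverse (real (Suc k))" by (simp add: field_simps)
      ultimately have "norm x < 1 - 1 / real (Suc (Suc k))" by linarith
      then show "gnorm x = 0" using elim by blast
    qed
  qed
qed

end

section \<open>From stationary maps to tuples\<close>

definition outer_prod :: "real^'m \<Rightarrow> real^'n \<Rightarrow> real^'n^'m"
  where "outer_prod u x = (\<chi> i j. u $ i * x $ j)"

lemma inner_outer_prod: "A \<bullet> outer_prod u x = u \<bullet> (A *v x)"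
  by (simp add: inner_vec_def matrix_vector_mult_def outer_prod_def sum_distrib_left mult_ac)

lemma matrix_mult_outer_prod: "A ** outer_prod u x = outer_prod (A *v u) x"
  by (simp add: vec_eq_iff matrix_matrix_mult_def matrix_vector_mult_def outer_prod_def sum_distrib_left mult_ac)

lemma matrix_mult_scaleR_right: "A ** (c *\<^sub>R B) = c *\<^sub>R (A ** B)"
  for A :: "real^'n^'m" and B :: "real^'k^'n"
  by (simp add: vec_eq_iff matrix_matrix_mult_def sum_distrib_left mult_ac)

lemma norm_outer_prod_le:
  fixes u :: "real^'m" and x :: "real^'n"
  shows "norm (outer_prod u x) \<le> real CARD('m) * (norm u * norm x)"
proof -
  have "norm (outer_prod u x) \<le> (\<Sum>i\<in>UNIV. norm (outer_prod u x $ i))"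
    unfolding norm_vec_def[of "outer_prod u x"] by (rule L2_set_le_sum) simp
  also have "\<dots> \<le> (\<Sum>i\<in>(UNIV::'m set). norm u * norm x)"
  proof (rule sum_mono)
    fix i
    have "outer_prod u x $ i = u $ i *\<^sub>R x" by (simp add: outer_prod_def vec_eq_iff)
    then show "norm (outer_prod u x $ i) \<le> norm u * norm x"
      by (simp add: component_le_norm_cart mult_right_mono)
  qed
  finally show ?thesis by simp
qed

lemma bump_0_has_derivative:
  "(bump 0 r has_derivative (\<lambda>v. bump 2 r x * (- (2 / r\<^sup>2) * (x \<bullet> v)))) (at x)"
  using bump_has_derivative[of 0 r x] by (simp only: add_0 of_nat_0 mult_zero_left diff_zero)

lemma jacobian_eq: "(f has_derivative f') (at x) \<Longrightarrow> jacobian f (at x) = matrix f'"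
  using frechet_derivative_at[of f f' x] by (simp add: jacobian_def)

lemma Dx_bump:
  fixes u :: "real^'m" and x :: "real^'n"
  shows "Dx (\<lambda>p. bump 0 r (fst p) *\<^sub>R snd p) x u = outer_prod ((- (2 / r\<^sup>2) * bump 2 r x) *\<^sub>R u) x"
proof -
  have "((\<lambda>y. bump 0 r y *\<^sub>R u) has_derivative (\<lambda>v. (bump 2 r x * (- (2 / r\<^sup>2) * (x \<bullet> v))) *\<^sub>R u)) (at x)"
    by (rule bounded_linear.has_derivative[OF bounded_linear_scaleR_left bump_0_has_derivative])
  from jacobian_eq[OF this] show ?thesis
    by (simp add: Dx_def matrix_def outer_prod_def vec_eq_iff inner_axis mult_ac)
qed

lemma Du_bump:
  fixes u :: "real^'m" and x :: "real^'n"
  shows "Du (\<lambda>p. bump 0 r (fst p) *\<^sub>R snd p) x u = bump 0 r x *\<^sub>R mat 1"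
proof -
  have "((\<lambda>w. bump 0 r x *\<^sub>R w) has_derivative (\<lambda>v. bump 0 r x *\<^sub>R v)) (at u)"
    by (rule bounded_linear_imp_has_derivative[OF bounded_linear_scaleR_right])
  from jacobian_eq[OF this] show ?thesis
    by (simp add: Du_def matrix_def mat_def axis_def vec_eq_iff)
qed

text \<open>The field grows linearly in \<open>u\<close>; its \<open>x\<close>-derivative is the rank one matrix of \<open>Dx_bump\<close>.\<close>

lemma outer_field_bump:
  assumes r: "0 < r" "r < 1"
  shows "outer_field (ball 0 1) (\<lambda>p :: (real^'n) \<times> (real^'m). bump 0 r (fst p) *\<^sub>R snd p)"
  unfolding outer_field_def
proof (intro conjI)
  have "smooth_on UNIV (\<lambda>p :: (real^'n) \<times> (real^'m). bump 0 r (fst p) *\<^sub>R snd p)"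
    by (intro smooth_on_scaleR smooth_on_compose_linear[OF bounded_linear_fst smooth_on_bump]
        smooth_on_bounded_linear bounded_linear_snd)
  then show "smooth_on (ball 0 1 \<times> UNIV) (\<lambda>p :: (real^'n) \<times> (real^'m). bump 0 r (fst p) *\<^sub>R snd p)"
    by (rule smooth_on_subset) simp
  show "\<exists>K. compact K \<and> K \<subseteq> ball 0 1 \<and>
      (\<forall>x\<in>ball 0 1 - K. \<forall>u. bump 0 r (fst (x :: real^'n, u :: real^'m)) *\<^sub>R snd (x, u) = 0)"
    using r by (intro exI[of _ "cball 0 r"]) (auto simp: bump_outside[OF r(1)])
  define C where "C = norm (mat 1 :: real^'m^'m) + 1 + 4 / r\<^sup>2 * real CARD('m)"
  have C: "norm (mat 1 :: real^'m^'m) \<le> C" "1 + 4 / r\<^sup>2 * real CARD('m) \<le> C" "0 \<le> 4 / r\<^sup>2 * real CARD('m)"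
    using norm_ge_zero[of "mat 1 :: real^'m^'m"] by (auto simp: C_def simp del: norm_ge_zero)
  have C0: "0 \<le> C" using C(1) norm_ge_zero order_trans by blast
  show "\<exists>C. \<forall>x\<in>ball 0 1. \<forall>u. norm (Du (\<lambda>p :: (real^'n) \<times> (real^'m). bump 0 r (fst p) *\<^sub>R snd p) x u) \<le> C \<and>
      norm (bump 0 r (fst (x, u)) *\<^sub>R snd (x, u)) + norm (Dx (\<lambda>p. bump 0 r (fst p) *\<^sub>R snd p) x u) \<le> C * (1 + norm u)"
  proof (intro exI ballI allI conjI)
    fix x :: "real^'n" and u :: "real^'m" assume x: "x \<in> ball 0 1"
    have b: "bump 0 r x \<le> 1" "bump 2 r x \<le> 2"
      using bump_le[of 0 r x] bump_le[of 2 r x] by (simp_all add: eval_nat_numeral)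
    have "norm (bump 0 r x *\<^sub>R mat 1 :: real^'m^'m) \<le> 1 * norm (mat 1 :: real^'m^'m)"
      using b(1) unfolding norm_scaleR by (intro mult_right_mono) auto
    then show "norm (Du (\<lambda>p. bump 0 r (fst p) *\<^sub>R snd p) x u) \<le> C"
      using C(1) unfolding Du_bump by linarith
    have "norm (outer_prod ((- (2 / r\<^sup>2) * bump 2 r x) *\<^sub>R u) x)
        \<le> real CARD('m) * (norm ((- (2 / r\<^sup>2) * bump 2 r x) *\<^sub>R u) * norm x)"
      by (rule norm_outer_prod_le)
    also have "\<dots> = (2 / r\<^sup>2 * real CARD('m) * norm u) * (bump 2 r x * norm x)"
      by (simp add: abs_mult)
    also have "\<dots> \<le> (2 / r\<^sup>2 * real CARD('m) * norm u) * (2 * 1)"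
      using b(2) x by (intro mult_left_mono mult_mono) auto
    finally have 1: "norm (outer_prod ((- (2 / r\<^sup>2) * bump 2 r x) *\<^sub>R u) x) \<le> 4 / r\<^sup>2 * real CARD('m) * norm u"
      by simp
    have 2: "norm (bump 0 r x *\<^sub>R u) \<le> 1 * norm u"
      using b(1) unfolding norm_scaleR by (intro mult_right_mono) auto
    have "norm (bump 0 r x *\<^sub>R u) + norm (outer_prod ((- (2 / r\<^sup>2) * bump 2 r x) *\<^sub>R u) x)
        \<le> (1 + 4 / r\<^sup>2 * real CARD('m)) * norm u"
      using 1 2 by (simp add: distrib_right)
    also have "\<dots> \<le> C * (1 + norm u)"
      using C C0 by (intro mult_mono) auto
    finally show "norm (bump 0 r (fst (x, u)) *\<^sub>R snd (x, u)) + norm (Dx (\<lambda>p. bump 0 r (fst p) *\<^sub>R snd p) x u) \<le> C * (1 + norm u)"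
      unfolding Dx_bump by simp
  qed
qed

lemma test_function_bump:
  assumes r: "0 < r" "r < 1"
  shows "test_function (ball 0 1) (\<lambda>x :: real^'n. bump 0 r x *\<^sub>R x)"
proof (rule test_functionI[OF _ r(2)])
  show "smooth_on UNIV (\<lambda>x :: real^'n. bump 0 r x *\<^sub>R x)"
    by (intro smooth_on_scaleR smooth_on_bump smooth_on_bounded_linear bounded_linear_ident)
qed (simp add: bump_outside[OF r(1)])

lemma jacobian_bump:
  fixes x :: "real^'n"
  shows "jacobian (\<lambda>x. bump 0 r x *\<^sub>R x) (at x) = bump 0 r x *\<^sub>R mat 1 + (- (2 / r\<^sup>2) * bump 2 r x) *\<^sub>R outer_prod x x"
proof -
  have "((\<lambda>x. bump 0 r x *\<^sub>R x) has_derivative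
      (\<lambda>v. bump 0 r x *\<^sub>R v + (bump 2 r x * (- (2 / r\<^sup>2) * (x \<bullet> v))) *\<^sub>R x)) (at x)"
    by (rule has_derivative_scaleR[OF bump_0_has_derivative has_derivative_ident])
  from jacobian_eq[OF this] show ?thesis
    by (simp add: matrix_def mat_def axis_def outer_prod_def vec_eq_iff inner_axis[unfolded axis_def] mult_ac)
qed

lemma divergence_bump:
  fixes x :: "real^'n"
  shows "divergence (\<lambda>x. bump 0 r x *\<^sub>R x) x = real CARD('n) * bump 0 r x + (- (2 / r\<^sup>2) * bump 2 r x) * (x \<bullet> x)"
  unfolding divergence_def jacobian_bump
  by (simp add: trace_def mat_def outer_prod_def inner_vec_def sum.distrib sum_distrib_left sum_subtractf sum_negf)

context Sobolev_tuple
begin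

lemma outer_stationary_bump:
  assumes st: "outer_stationary Q (ball 0 1) g0 D0"
    and ae: "AE x in lborel. x \<in> ball 0 1 \<longrightarrow> (\<forall>i<Q. g0 i x = g i x \<and> D0 i x = D i x)"
    and r: "0 < r" "r < 1"
  shows "(LBINT x. dirichlet x * bump 0 r x) = 2 / r\<^sup>2 * (LBINT x. pairing x x * bump 2 r x)"
proof -
  let ?\<psi> = "\<lambda>p :: (real^'n) \<times> (real^'m). bump 0 r (fst p) *\<^sub>R snd p"
  let ?S = "\<lambda>x. pairing x x" and ?e = "\<lambda>x. dirichlet x"
  define F where "F x = - (2 / r\<^sup>2) * (?S x * bump 2 r x) + ?e x * bump 0 r x" for x
  have [measurable]: "F \<in> borel_measurable borel" unfolding F_def[abs_def] by measurable
  have pt: "(\<Sum>i<Q. frob (D i x) (Dx ?\<psi> x (g i x)) + frob (D i x) (Du ?\<psi> x (g i x) ** D i x)) = F x" for x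
  proof -
    have "frob (D i x) (Dx ?\<psi> x (g i x)) = - (2 / r\<^sup>2) * (g i x \<bullet> (D i x *v x) * bump 2 r x)" for i
      by (simp add: frob_eq_inner Dx_bump inner_outer_prod)
    moreover have "frob (D i x) (Du ?\<psi> x (g i x) ** D i x) = (norm (D i x))\<^sup>2 * bump 0 r x" for i
    proof -
      have "(bump 0 r x *\<^sub>R mat 1) ** D i x = bump 0 r x *\<^sub>R D i x"
        by (simp add: scalar_matrix_assoc[symmetric])
      then show ?thesis by (simp add: frob_eq_inner Du_bump power2_norm_eq_inner)
    qed
    ultimately show ?thesis
      by (simp only: F_def sum.distrib sum_distrib_left sum_distrib_right)
  qed
  have "(LINT x|lebesgue_on (ball 0 1). (\<Sum>i<Q. frob (D0 i x) (Dx ?\<psi> x (g0 i x)) + frob (D0 i x) (Du ?\<psi> x (g0 i x) ** D0 i x))) = 0"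
    using st outer_field_bump[OF r] unfolding outer_stationary_def by blast
  also have "(LINT x|lebesgue_on (ball 0 1). (\<Sum>i<Q. frob (D0 i x) (Dx ?\<psi> x (g0 i x)) + frob (D0 i x) (Du ?\<psi> x (g0 i x) ** D0 i x)))
      = (LBINT x. indicat_real (ball 0 1) x * F x)"
  proof (rule lebesgue_on_integral_borel)
    show "AE x in lborel. x \<in> ball 0 1 \<longrightarrow>
        (\<Sum>i<Q. frob (D0 i x) (Dx ?\<psi> x (g0 i x)) + frob (D0 i x) (Du ?\<psi> x (g0 i x) ** D0 i x)) = F x"
      using ae
    proof eventually_elim
      case (elim x)
      show ?case
      proof
        assume "x \<in> ball 0 1"
        with elim have "g0 i x = g i x" "D0 i x = D i x" if "i < Q" for i using that by blast+
        then show "(\<Sum>i<Q. frob (D0 i x) (Dx ?\<psi> x (g0 i x)) + frob (D0 i x) (Du ?\<psi> x (g0 i x) ** D0 i x)) = F x"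
          unfolding pt[symmetric] by (intro sum.cong) auto
      qed
    qed
  qed auto
  also have "(\<lambda>x. indicat_real (ball 0 1) x * F x) = F"
  proof (rule ext)
    fix x show "indicat_real (ball 0 1) x * F x = F x"
      using r bump_outside[OF r(1), of x] by (cases "norm x < 1") (auto simp: F_def)
  qed
  also have "(LBINT x. F x) = - (2 / r\<^sup>2) * (LBINT x. ?S x * bump 2 r x) + (LBINT x. ?e x * bump 0 r x)"
    using bump_integrable(1)[of ?S, OF inner_L1_ball r, of 2] bump_integrable(1)[of ?e, OF D_L2 r, of 0]
    unfolding F_def by (subst Bochner_Integration.integral_add) simp_all
  finally show ?thesis by simp
qed

lemma inner_stationary_bump:
  assumes st: "inner_stationary Q (ball 0 1) D0"
    and ae: "AE x in lborel. x \<in> ball 0 1 \<longrightarrow> (\<forall>i<Q. D0 i x = D i x)"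
    and r: "0 < r" "r < 1"
  shows "2 / r\<^sup>2 * (LBINT x. dirichlet x * (bump 2 r x * (x \<bullet> x))) =
        (real CARD('n) - 2) * (LBINT x. dirichlet x * bump 0 r x)
        + 4 / r\<^sup>2 * (LBINT x. (dnorm x x)\<^sup>2 * bump 2 r x)"
proof -
  let ?\<phi> = "\<lambda>x :: real^'n. bump 0 r x *\<^sub>R x"
  let ?e = "\<lambda>x. dirichlet x"
  define F where "F x = ?e x * bump 0 r x + - (2 / r\<^sup>2) * ((dnorm x x)\<^sup>2 * bump 2 r x)" for x
  define G where "G x = real CARD('n) * (?e x * bump 0 r x) + - (2 / r\<^sup>2) * (?e x * (bump 2 r x * (x \<bullet> x)))" for x
  have [measurable]: "F \<in> borel_measurable borel" "G \<in> borel_measurable borel"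
    unfolding F_def[abs_def] G_def[abs_def] by measurable
  have ptF: "(\<Sum>i<Q. frob (D i x) (D i x ** jacobian ?\<phi> (at x))) = F x" for x
  proof -
    have "frob (D i x) (D i x ** jacobian ?\<phi> (at x))
        = (norm (D i x))\<^sup>2 * bump 0 r x + - (2 / r\<^sup>2) * ((norm (D i x *v x))\<^sup>2 * bump 2 r x)" for i
    proof -
      have "D i x ** jacobian ?\<phi> (at x) = bump 0 r x *\<^sub>R D i x + (- (2 / r\<^sup>2) * bump 2 r x) *\<^sub>R outer_prod (D i x *v x) x"
        unfolding jacobian_bump matrix_add_ldistrib matrix_mult_scaleR_right matrix_mult_outer_prod matrix_mul_rid ..
      then show ?thesis
        by (simp add: frob_eq_inner inner_add_right inner_diff_right inner_outer_prod power2_norm_eq_inner)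
    qed
    then show ?thesis
      by (simp only: F_def dnorm_def tnorm_sq sum.distrib sum_distrib_left sum_distrib_right)
  qed
  have ptG: "?e x * divergence ?\<phi> x = G x" for x
    unfolding divergence_bump G_def by (simp add: algebra_simps)
  have ae': "AE x in lborel. x \<in> ball 0 1 \<longrightarrow> (\<Sum>i<Q. frob (D0 i x) (D0 i x ** jacobian ?\<phi> (at x))) = F x
      \<and> (\<Sum>i<Q. (norm (D0 i x))\<^sup>2) * divergence ?\<phi> x = G x"
    using ae
  proof eventually_elim
    case (elim x)
    show ?case
    proof
      assume "x \<in> ball 0 1"
      with elim have eq: "D0 i x = D i x" if "i < Q" for i using that by blast
      show "(\<Sum>i<Q. frob (D0 i x) (D0 i x ** jacobian ?\<phi> (at x))) = F x
          \<and> (\<Sum>i<Q. (norm (D0 i x))\<^sup>2) * divergence ?\<phi> x = G x"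
        unfolding ptF[symmetric] ptG[symmetric] by (simp add: eq)
    qed
  qed
  have st': "2 * (LINT x|lebesgue_on (ball 0 1). (\<Sum>i<Q. frob (D0 i x) (D0 i x ** jacobian ?\<phi> (at x))))
      - (LINT x|lebesgue_on (ball 0 1). (\<Sum>i<Q. (norm (D0 i x))\<^sup>2) * divergence ?\<phi> x) = 0"
    using st test_function_bump[OF r] unfolding inner_stationary_def by blast
  have FG: "indicat_real (ball 0 1) x * F x = F x" "indicat_real (ball 0 1) x * G x = G x" for x
    using r bump_outside[OF r(1), of x] by (cases "norm x < 1"; auto simp: F_def G_def)+
  have lF: "(LINT x|lebesgue_on (ball 0 1). (\<Sum>i<Q. frob (D0 i x) (D0 i x ** jacobian ?\<phi> (at x)))) = (LBINT x. F x)"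
  proof -
    have "AE x in lborel. x \<in> ball 0 1 \<longrightarrow> (\<Sum>i<Q. frob (D0 i x) (D0 i x ** jacobian ?\<phi> (at x))) = F x"
      using ae' by eventually_elim blast
    from lebesgue_on_integral_borel[OF _ _ this] show ?thesis unfolding FG by simp
  qed
  have lG: "(LINT x|lebesgue_on (ball 0 1). (\<Sum>i<Q. (norm (D0 i x))\<^sup>2) * divergence ?\<phi> x) = (LBINT x. G x)"
  proof -
    have "AE x in lborel. x \<in> ball 0 1 \<longrightarrow> (\<Sum>i<Q. (norm (D0 i x))\<^sup>2) * divergence ?\<phi> x = G x"
      using ae' by eventually_elim blast
    from lebesgue_on_integral_borel[OF _ _ this] show ?thesis unfolding FG by simp
  qed
  note ie = bump_integrable[of ?e, OF D_L2 r] and ir = bump_integrable(1)[of "\<lambda>x. (dnorm x x)\<^sup>2", OF radial_L2_ball r]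
  have iF: "(LBINT x. F x) = (LBINT x. ?e x * bump 0 r x) + - (2 / r\<^sup>2) * (LBINT x. (dnorm x x)\<^sup>2 * bump 2 r x)"
    unfolding F_def using ie(1)[of 0] ir[of 2] by (subst Bochner_Integration.integral_add) simp_all
  have iG: "(LBINT x. G x) = real CARD('n) * (LBINT x. ?e x * bump 0 r x) + - (2 / r\<^sup>2) * (LBINT x. ?e x * (bump 2 r x * (x \<bullet> x)))"
    unfolding G_def using ie(1)[of 0] ie(2)[of 2] by (subst Bochner_Integration.integral_add) simp_all
  show ?thesis
    using st' unfolding lF lG iF iG by (simp add: algebra_simps)
qed

end

text \<open>Borel sets and exceptional null sets do not affect densities: the Borel part of \<open>E\<close>, with \<open>N\<close> removed,
differs from \<open>E\<close> by a null set.\<close>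

lemma density_one_borel_subset:
  fixes E :: "(real^'n) set"
  assumes E: "density_one E x" and N: "N \<in> null_sets lborel"
  shows "\<exists>E'. E' \<in> sets borel \<and> E' \<subseteq> E - N \<and> density_one E' x"
proof -
  have Es: "E \<in> sets lebesgue" using E by (simp add: density_one_def)
  define E' where "E' = main_part lborel E - N"
  have mp: "main_part lborel E \<in> sets borel" using Es main_part_sets[of E lborel] by auto
  have E'b: "E' \<in> sets borel" unfolding E'_def using mp N by (auto simp: null_sets_def)
  have un: "main_part lborel E \<union> null_part lborel E = E" by (rule main_part_null_part_Un[OF Es])
  have "AE y in lborel. y \<in> E \<longleftrightarrow> y \<in> E'"
    using AE_notin_null_part[OF Es] AE_not_in[OF N]
    by eventually_elim (use un in \<open>auto simp: E'_def\<close>)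
  from AE_completion[OF this] have ae: "AE y in lebesgue. y \<in> E \<inter> ball x r \<longleftrightarrow> y \<in> E' \<inter> ball x r" for r
    by (auto elim: eventually_mono)
  have "measure lebesgue (E \<inter> ball x r) = measure lebesgue (E' \<inter> ball x r)" for r
    using Es E'b by (intro measure_eq_AE[OF ae]) auto
  then have "density_one E' x"
    using E E'b by (simp add: density_one_def)
  then show ?thesis
    using E'b un by (intro exI[of _ E']) (auto simp: E'_def)
qed

lemma Dir_stationary_imp_stationary_tuple:
  fixes f :: "real^'n \<Rightarrow> (real^'m) multiset"
  assumes W: "f \<in> W12 Q (ball 0 1)" and st: "Dir_stationary Q (ball 0 1) f"
  obtains g D \<Phi> where "stationary_tuple Q g D \<Phi>"
    and "AE x in lborel. x \<in> ball 0 1 \<longrightarrow> f x = Qpoint Q (\<lambda>i. g i x)"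
proof -
  let ?B = "ball (0::real^'n) 1"
  have Bb: "?B \<in> sets borel" by simp
  obtain g0 D0 where sel: "measurable_selection Q ?B f g0" and dif: "ae_differential Q ?B f g0 D0"
    and out: "outer_stationary Q ?B g0 D0" and inn: "inner_stationary Q ?B D0"
    using st unfolding Dir_stationary_def by blast
  have "\<exists>G. G \<in> borel_measurable borel \<and> (i < Q \<longrightarrow> (AE x in lborel. x \<in> ?B \<longrightarrow> g0 i x = G x)) \<and> (\<forall>x. x \<notin> ?B \<longrightarrow> G x = 0)" for i
  proof (cases "i < Q")
    case True
    then have "g0 i \<in> borel_measurable (lebesgue_on ?B)" using sel by (simp add: measurable_selection_def)
    then show ?thesis by (rule borel_representative[OF Bb]) blast
  next
    case False
    then show ?thesis by (intro exI[of _ "\<lambda>x. 0"]) auto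
  qed
  then have "\<forall>i. \<exists>G. G \<in> borel_measurable borel \<and> (i < Q \<longrightarrow> (AE x in lborel. x \<in> ?B \<longrightarrow> g0 i x = G x)) \<and> (\<forall>x. x \<notin> ?B \<longrightarrow> G x = 0)"
    by blast
  from choice[OF this] obtain g where g [measurable]: "\<And>i. g i \<in> borel_measurable borel"
    and g0: "\<And>i. i < Q \<Longrightarrow> AE x in lborel. x \<in> ?B \<longrightarrow> g0 i x = g i x" and gout: "\<And>i x. x \<notin> ?B \<Longrightarrow> g i x = 0"
    by blast
  have "\<exists>G. G \<in> borel_measurable borel \<and> (i < Q \<longrightarrow> (AE x in lborel. x \<in> ?B \<longrightarrow> D0 i x = G x))" for i
  proof (cases "i < Q")
    case True
    then have "D0 i \<in> borel_measurable (lebesgue_on ?B)" using dif by (simp add: ae_differential_def)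
    then show ?thesis by (rule borel_representative[OF Bb]) blast
  next
    case False
    then show ?thesis by (intro exI[of _ "\<lambda>x. 0"]) auto
  qed
  then have "\<forall>i. \<exists>G. G \<in> borel_measurable borel \<and> (i < Q \<longrightarrow> (AE x in lborel. x \<in> ?B \<longrightarrow> D0 i x = G x))"
    by blast
  from choice[OF this] obtain D where D [measurable]: "\<And>i. D i \<in> borel_measurable borel"
    and D0: "\<And>i. i < Q \<Longrightarrow> AE x in lborel. x \<in> ?B \<longrightarrow> D0 i x = D i x"
    by blast
  have "AE x in lborel. \<forall>i\<in>{..<Q}. x \<in> ?B \<longrightarrow> g0 i x = g i x \<and> D0 i x = D i x"
  proof (intro AE_finite_allI)
    fix i assume "i \<in> {..<Q}"
    then show "AE x in lborel. x \<in> ?B \<longrightarrow> g0 i x = g i x \<and> D0 i x = D i x"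
      using g0[of i] D0[of i] by (auto elim: eventually_elim2)
  qed simp
  then have agree: "AE x in lborel. x \<in> ?B \<longrightarrow> (\<forall>i<Q. g0 i x = g i x \<and> D0 i x = D i x)"
    by eventually_elim auto
  have Qp: "Qpoint Q P = Qpoint Q R" if "\<And>i. i < Q \<Longrightarrow> P i = R i" for P R :: "nat \<Rightarrow> real^'m"
    unfolding Qpoint_def using that by (intro sum.cong) auto
  have f_g0: "f x = Qpoint Q (\<lambda>i. g0 i x)" if "x \<in> ?B" for x
    using sel that by (simp add: measurable_selection_def)
  have fg: "AE x in lborel. x \<in> ?B \<longrightarrow> f x = Qpoint Q (\<lambda>i. g i x)"
    using agree
  proof eventually_elim
    case (elim x)
    show ?case
    proof
      assume x: "x \<in> ?B"
      show "f x = Qpoint Q (\<lambda>i. g i x)"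
        unfolding f_g0[OF x] using elim x by (intro Qp) blast
    qed
  qed
  obtain \<Phi> where \<Phi>: "\<Phi> \<in> borel_measurable borel" "\<And>x. 0 \<le> \<Phi> x" "(\<integral>\<^sup>+x. ennreal ((\<Phi> x)\<^sup>2) \<partial>lborel) < \<infinity>"
    "\<And>w \<rho>. 0 < \<rho> \<Longrightarrow> \<rho> + norm w < 1 \<Longrightarrow> AE x in lborel. norm x < \<rho> \<longrightarrow>
      ennreal (tdist Q (\<lambda>i. g i (x + w)) (\<lambda>i. g i x)) \<le>
        segment_integral \<Phi> x w"
    by (rule W12_difference_bound[OF W g fg]) (rule that)
  have L2: "integrable lborel (\<lambda>x. (tnorm Q (\<lambda>i. g i x))\<^sup>2)"
  proof -
    have "L2 ?B (\<lambda>x. Qnorm (f x))"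
      using W[unfolded W12_def, THEN CollectD, THEN conjunct2, THEN conjunct1] .
    then have int: "integrable (lebesgue_on ?B) (\<lambda>x. (Qnorm (f x))\<^sup>2)" by (simp add: L2_def)
    have m: "(\<lambda>x. (tnorm Q (\<lambda>i. g i x))\<^sup>2) \<in> borel_measurable borel" by measurable
    have "AE x in lborel. x \<in> ?B \<longrightarrow> (Qnorm (f x))\<^sup>2 = (tnorm Q (\<lambda>i. g i x))\<^sup>2"
      using fg by eventually_elim (simp add: Qnorm_Qpoint)
    from lebesgue_on_integrable_borel[OF Bb m this] int
    have "integrable lborel (\<lambda>x. indicat_real ?B x * (tnorm Q (\<lambda>i. g i x))\<^sup>2)" by (rule iffD1)
    moreover have "indicat_real ?B x * (tnorm Q (\<lambda>i. g i x))\<^sup>2 = (tnorm Q (\<lambda>i. g i x))\<^sup>2" for x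
      using gout[of x] by (cases "x \<in> ?B") (simp_all add: tnorm_def)
    ultimately show ?thesis by (simp only:)
  qed
  have approx: "AE x in lborel. norm x < 1 \<longrightarrow> (\<exists>E. E \<in> sets borel \<and> density_one E x \<and>
      affine_within Q g D x E)"
  proof -
    obtain N where N1: "{x \<in> space lborel. \<not> (x \<in> ?B \<longrightarrow> (\<forall>i<Q. g0 i x = g i x \<and> D0 i x = D i x))} \<subseteq> N"
      and N2: "emeasure lborel N = 0" "N \<in> sets lborel"
      using agree by (rule AE_E)
    have N: "N \<in> null_sets lborel" using N2 by (rule null_setsI)
    have good: "g0 i y = g i y" "D0 i y = D i y" if "y \<in> ?B" "y \<notin> N" "i < Q" for y i
      using N1 that by auto
    have "AE x in lborel. x \<in> ?B \<longrightarrow> has_approx_differential Q ?B f x (\<lambda>i. g0 i x) (\<lambda>i. D0 i x)"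
      using dif unfolding ae_differential_def lebesgue_on_AE_iff[OF Bb] by blast
    then show ?thesis
      using AE_not_in[OF N]
    proof eventually_elim
      case (elim x)
      show ?case
      proof
        assume "norm x < 1"
        then have x: "x \<in> ?B" by simp
        with elim have "has_approx_differential Q ?B f x (\<lambda>i. g0 i x) (\<lambda>i. D0 i x)" by blast
        then obtain E where E: "E \<subseteq> ?B" "density_one E x"
          and lim: "((\<lambda>y. Gdist Q (f y) (Qpoint Q (\<lambda>i. g0 i x + D0 i x *v (y - x))) / norm (y - x)) \<longlongrightarrow> 0) (at x within E)"
          unfolding has_approx_differential_def by blast
        obtain E' where E': "E' \<in> sets borel" "E' \<subseteq> E - N" "density_one E' x"
          using density_one_borel_subset[OF E(2) N] by blast
        have "((\<lambda>y. Gdist Q (f y) (Qpoint Q (\<lambda>i. g0 i x + D0 i x *v (y - x))) / norm (y - x)) \<longlongrightarrow> 0) (at x within E')"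
          by (rule tendsto_within_subset[OF lim]) (use E' in blast)
        moreover have "\<forall>\<^sub>F y in at x within E'. Gdist Q (f y) (Qpoint Q (\<lambda>i. g0 i x + D0 i x *v (y - x))) / norm (y - x)
            = tdist Q (\<lambda>i. g i y) (\<lambda>i. g i x + D i x *v (y - x)) / norm (y - x)"
          unfolding eventually_at_filter
        proof (rule always_eventually, intro allI impI)
          fix y assume "y \<in> E'"
          then have y: "y \<in> ?B" "y \<notin> N" using E' E by auto
          have "f y = Qpoint Q (\<lambda>i. g i y)"
            unfolding f_g0[OF y(1)] by (intro Qp good y)
          moreover have "Qpoint Q (\<lambda>i. g0 i x + D0 i x *v (y - x)) = Qpoint Q (\<lambda>i. g i x + D i x *v (y - x))"
            using good[OF x] elim by (intro Qp) simp
          ultimately show "Gdist Q (f y) (Qpoint Q (\<lambda>i. g0 i x + D0 i x *v (y - x))) / norm (y - x)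
            = tdist Q (\<lambda>i. g i y) (\<lambda>i. g i x + D i x *v (y - x)) / norm (y - x)" by simp
        qed
        ultimately have "affine_within Q g D x E'"
          by (rule Lim_transform_eventually)
        with E' show "\<exists>E. E \<in> sets borel \<and> density_one E x \<and>
          affine_within Q g D x E"
          by blast
      qed
    qed
  qed
  interpret Sobolev_tuple Q g D \<Phi>
  proof
    show "g i \<in> borel_measurable borel" "D i \<in> borel_measurable borel" for i by (rule g, rule D)
    show "g i x = 0" if "1 \<le> norm x" for i x by (rule gout) (use that in simp)
  qed (fact L2 \<Phi> approx)+
  have "stationary_tuple Q g D \<Phi>"
  proof
    fix r :: real assume r: "0 < r" "r < 1"
    show "(LBINT x. (\<Sum>i<Q. (norm (D i x))\<^sup>2) * bump 0 r x) = 2 / r\<^sup>2 * (LBINT x. (\<Sum>i<Q. g i x \<bullet> (D i x *v x)) * bump 2 r x)"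
      by (rule outer_stationary_bump[OF out agree r])
    have "AE x in lborel. x \<in> ?B \<longrightarrow> (\<forall>i<Q. D0 i x = D i x)"
      using agree by eventually_elim blast
    then show "2 / r\<^sup>2 * (LBINT x. (\<Sum>i<Q. (norm (D i x))\<^sup>2) * (bump 2 r x * (x \<bullet> x))) =
        (real CARD('n) - 2) * (LBINT x. (\<Sum>i<Q. (norm (D i x))\<^sup>2) * bump 0 r x)
        + 4 / r\<^sup>2 * (LBINT x. (dnorm x x)\<^sup>2 * bump 2 r x)"
      by (rule inner_stationary_bump[OF inn _ r])
  qed
  then show thesis using fg by (rule that)
qed

theorem theorem1p2:
  fixes Q :: nat and f :: "real^'n \<Rightarrow> (real^'m) multiset"
  assumes "f \<in> W12 Q (ball 0 1)"
    and "Dir_stationary Q (ball 0 1) f"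
    and "\<forall>N::nat. ((\<lambda>r. 1 / r ^ N * (LINT x|lebesgue_on (ball 0 r). (Qnorm (f x))\<^sup>2)) \<longlongrightarrow> 0) (at_right 0)"
  shows "AE x in lebesgue_on (ball 0 1). f x = replicate_mset Q 0"
proof -
  let ?B = "ball (0::real^'n) 1"
  obtain g D \<Phi> where st: "stationary_tuple Q g D \<Phi>"
    and fg: "AE x in lborel. x \<in> ?B \<longrightarrow> f x = Qpoint Q (\<lambda>i. g i x)"
    by (rule Dir_stationary_imp_stationary_tuple[OF assms(1,2)])
  interpret stationary_tuple Q g D \<Phi> by (rule st)
  have "((\<lambda>r. 1 / r ^ N * (LBINT x. indicat_real (ball 0 r) x * (gnorm x)\<^sup>2)) \<longlongrightarrow> 0) (at_right 0)" for N :: nat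
  proof (rule Lim_transform_eventually[OF assms(3)[rule_format, of N]])
    show "\<forall>\<^sub>F r in at_right 0. 1 / r ^ N * (LINT x|lebesgue_on (ball 0 r). (Qnorm (f x))\<^sup>2)
        = 1 / r ^ N * (LBINT x. indicat_real (ball 0 r) x * (gnorm x)\<^sup>2)"
      unfolding eventually_at_right_field
    proof (intro exI conjI allI impI)
      show "(0::real) < 1" by simp
      fix r :: real assume r: "0 < r" "r < 1"
      have "(LINT x|lebesgue_on (ball 0 r). (Qnorm (f x))\<^sup>2) = (LBINT x. indicat_real (ball 0 r) x * (gnorm x)\<^sup>2)"
      proof (rule lebesgue_on_integral_borel)
        show "AE x in lborel. x \<in> ball 0 r \<longrightarrow> (Qnorm (f x))\<^sup>2 = (gnorm x)\<^sup>2"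
          using fg by eventually_elim (use r in \<open>auto simp: Qnorm_Qpoint\<close>)
      qed (simp, measurable)
      then show "1 / r ^ N * (LINT x|lebesgue_on (ball 0 r). (Qnorm (f x))\<^sup>2)
        = 1 / r ^ N * (LBINT x. indicat_real (ball 0 r) x * (gnorm x)\<^sup>2)" by simp
    qed
  qed
  then have "AE x in lborel. norm x < 1 \<longrightarrow> gnorm x = 0"
    by (rule infinite_order_vanishing)
  then have "AE x in lborel. x \<in> ?B \<longrightarrow> f x = replicate_mset Q 0"
    using fg
  proof eventually_elim
    case (elim x)
    show ?case
    proof
      assume x: "x \<in> ?B"
      then have "gnorm x = 0" using elim by simp
      then have "g i x = 0" if "i < Q" for i
        using that by (simp add: tnorm_def sum_nonneg_eq_0_iff)
      then have "Qpoint Q (\<lambda>i. g i x) = Qpoint Q (\<lambda>i. 0)"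
        unfolding Qpoint_def by (intro sum.cong) auto
      also have "\<dots> = replicate_mset Q 0"
        by (simp add: Qpoint_image_mset image_mset_const_eq)
      finally have "Qpoint Q (\<lambda>i. g i x) = replicate_mset Q 0" .
      then show "f x = replicate_mset Q 0" using elim x by simp
    qed
  qed
  then show ?thesis
    by (subst lebesgue_on_AE_iff) auto
qed

end
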